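(* Let $p$ be a prime, $n\geq2$, $S$ a free profinite group and $N$ a closed normal subgroup of $S$ with $N\leq S_n$. Then: (a) the pairing $(\sigma NS_{n+1},\alpha)\mapsto(\operatorname{trg}^{-1}(\alpha))(\sigma)$, for $\sigma\in S_n$ and $\alpha\in\operatorname{Ker}(H^2(S/S_n)_{n\text{-Massey}}\xrightarrow{\inf}H^2(S/N))$, is a well-defined non-degenerate bilinear map $S_n/NS_{n+1}\times\operatorname{Ker}(H^2(S/S_n)_{n\text{-Massey}}\xrightarrow{\inf}H^2(S/N))\to\mathbb{Z}/p$; (b) the kernels of the inflation maps $H^2(S/S_n)\to H^2(S/NS_{n+1})$ and $H^2(S/S_n)_{n\text{-Massey}}\to H^2(S/N)$ coincide.
   Context: $(S_n)$ is the $p$-Zassenhaus filtration: $S_1=S$, $S_n=S_{\lceil n/p\rceil}^p\prod_{i+j=n}[S_i,S_j]$. Cohomology with coefficients $\mathbb{Z}/p$ (trivial action) via continuous inhomogeneous cochains, $(\partial c)(\sigma,\tau)=c(\sigma)+c(\tau)-c(\sigma\tau)$, $(c\cup c')(\sigma,\tau)=c(\sigma)c'(\tau)$. A defining system of size $n$ is $c_{ij}\in C^1$, $1\le i\le j\le n$, $(i,j)\ne(1,n)$, with $\partial c_{ij}=-\sum_{r=i}^{j-1}c_{ir}\cup c_{r+1,j}$; the class of the 2-cocycle $\widetilde c_{1n}=-\sum_{r=1}^{n-1}c_{1r}\cup c_{r+1,n}$ is an $n$-fold Massey product, and $H^2(\Gamma)_{n\text{-Massey}}$ is the subgroup generated by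 them. $\operatorname{trg}\colon H^1(S_n)^S\to H^2(S/S_n)$ is the transgression of the extension $1\to S_n\to S\to S/S_n\to1$, an isomorphism since $H^2(S)=0$ and $S_n\le S^p[S,S]$. *)

theory Defs
  imports "HOL-Analysis.Analysis" "HOL-Algebra.Elementary_Groups"
begin

section \<open>Topological and profinite groups\<close>

definition topological_group :: "('a, 'm) monoid_scheme \<Rightarrow> 'a topology \<Rightarrow> bool" where
  "topological_group G T \<longleftrightarrow>
     group G \<and> topspace T = carrier G \<and>
     continuous_map (prod_topology T T) T (\<lambda>(x, y). x \<otimes>\<^bsub>G\<^esub> y) \<and>
     continuous_map T T (\<lambda>x. inv\<^bsub>G\<^esub> x)"

definition profinite_group :: "('a, 'm) monoid_scheme \<Rightarrow> 'a topology \<Rightarrow> bool" where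
  "profinite_group G T \<longleftrightarrow>
     topological_group G T \<and> compact_space T \<and> Hausdorff_space T \<and>
     (\<forall>C. connectedin T C \<longrightarrow> (\<exists>x. C \<subseteq> {x}))"

definition closed_subgroup_generated ::
    "('a, 'm) monoid_scheme \<Rightarrow> 'a topology \<Rightarrow> 'a set \<Rightarrow> 'a set" where
  "closed_subgroup_generated G T A = T closure_of (generate G A)"

definition converges_to_one ::
    "('a, 'm) monoid_scheme \<Rightarrow> 'a topology \<Rightarrow> 'x set \<Rightarrow> ('x \<Rightarrow> 'a) \<Rightarrow> bool" where
  "converges_to_one G T X f \<longleftrightarrow>
     f \<in> X \<rightarrow> carrier G \<and>
     (\<forall>U. U \<lhd> G \<and> openin T U \<longrightarrow> finite {x \<in> X. f x \<notin> U})"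

text \<open>
  A free profinite group has a basis \<open>X\<close>: a topological generating set that converges to 1 and
  has the universal property for maps, converging to 1, into profinite groups.  (The extension
  is unique because \<open>X\<close> generates.)  The universal property quantifies over groups
  on the type \<open>'a + nat\<close>; this is no restriction.  Replacing the target by the closed subgroup
  generated by the image, one may assume the extension to be onto, so that the target is a quotient
  of \<open>G\<close> and has a copy on \<open>'a\<close>.  Conversely the summand \<open>nat\<close> makes room for all finite
  groups, even if \<open>'a\<close> is finite, and these determine the property for all profinite groups, which
  are inverse limits of finite ones.
\<close>

definition free_profinite_basis :: "('a, 'm) monoid_scheme \<Rightarrow> 'a topology \<Rightarrow> 'a set \<Rightarrow> bool" where
  "free_profinite_basis G T X \<longleftrightarrow>
     X \<subseteq> carrier G \<and> converges_to_one G T X (\<lambda>x. x) \<and>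
     closed_subgroup_generated G T X = carrier G \<and>
     (\<forall>(H :: ('a + nat) monoid) T' f.
        profinite_group H T' \<and> converges_to_one H T' X f \<longrightarrow>
        (\<exists>h \<in> hom G H. continuous_map T T' h \<and> (\<forall>x\<in>X. h x = f x)))"

definition free_profinite_group :: "('a, 'm) monoid_scheme \<Rightarrow> 'a topology \<Rightarrow> bool" where
  "free_profinite_group G T \<longleftrightarrow>
     profinite_group G T \<and> (\<exists>X. free_profinite_basis G T X)"

definition quotient_topology :: "'a topology \<Rightarrow> ('a \<Rightarrow> 'b) \<Rightarrow> 'b topology" where
  "quotient_topology T f =
     topology (\<lambda>U. U \<subseteq> f ` topspace T \<and> openin T {x \<in> topspace T. f x \<in> U})"

lemma openin_quotient_topology:
  "openin (quotient_topology T f) U \<longleftrightarrow>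
     U \<subseteq> f ` topspace T \<and> openin T {x \<in> topspace T. f x \<in> U}"
proof -
  have "istopology (\<lambda>U. U \<subseteq> f ` topspace T \<and> openin T {x \<in> topspace T. f x \<in> U})"
    unfolding istopology_def
  proof (intro conjI allI impI)
    fix U V
    assume "U \<subseteq> f ` topspace T \<and> openin T {x \<in> topspace T. f x \<in> U}"
      and "V \<subseteq> f ` topspace T \<and> openin T {x \<in> topspace T. f x \<in> V}"
    moreover have "{x \<in> topspace T. f x \<in> U \<inter> V} =
        {x \<in> topspace T. f x \<in> U} \<inter> {x \<in> topspace T. f x \<in> V}"
      by blast
    ultimately show "U \<inter> V \<subseteq> f ` topspace T" "openin T {x \<in> topspace T. f x \<in> U \<inter> V}"
      by auto
  next
    fix \<K>
    assume *: "\<forall>K\<in>\<K>. K \<subseteq> f ` topspace T \<and> openin T {x \<in> topspace T. f x \<in> K}"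
    have "{x \<in> topspace T. f x \<in> \<Union> \<K>} = (\<Union>K\<in>\<K>. {x \<in> topspace T. f x \<in> K})"
      by blast
    with * show "\<Union> \<K> \<subseteq> f ` topspace T" "openin T {x \<in> topspace T. f x \<in> \<Union> \<K>}"
      by auto
  qed
  then show ?thesis
    by (simp add: quotient_topology_def topology_inverse')
qed

lemma topspace_quotient_topology: "topspace (quotient_topology T f) = f ` topspace T"
proof (rule antisym)
  show "topspace (quotient_topology T f) \<subseteq> f ` topspace T"
    using openin_topspace openin_quotient_topology by metis
  have "{x \<in> topspace T. f x \<in> f ` topspace T} = topspace T"
    by auto
  then have "openin (quotient_topology T f) (f ` topspace T)"
    by (simp add: openin_quotient_topology)
  then show "f ` topspace T \<subseteq> topspace (quotient_topology T f)"
    by (rule openin_subset)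
qed

lemma quotient_map_quotient_topology: "quotient_map T (quotient_topology T f) f"
  by (auto simp: quotient_map_def topspace_quotient_topology openin_quotient_topology)

abbreviation Mod_topology :: "('a, 'm) monoid_scheme \<Rightarrow> 'a topology \<Rightarrow> 'a set \<Rightarrow> 'a set topology" where
  "Mod_topology G T N \<equiv> quotient_topology T (\<lambda>x. N #>\<^bsub>G\<^esub> x)"

section \<open>The Zassenhaus filtration\<close>

text \<open>
  As usual for profinite groups, powers and commutators of subgroups are closed subgroups.  The
  product of the closed normal subgroups \<open>S\<^sub>\<lceil>\<^sub>n\<^sub>/\<^sub>p\<^sub>\<rceil>\<^sup>p\<close> and \<open>[S\<^sub>i, S\<^sub>j]\<close> is the closed subgroup
  generated by the generators of all of them.  The guard \<open>p \<le> 1\<close> only serves termination.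
\<close>

function zassenhaus :: "nat \<Rightarrow> ('a, 'm) monoid_scheme \<Rightarrow> 'a topology \<Rightarrow> nat \<Rightarrow> 'a set" where
  "zassenhaus p G T n =
     (if n \<le> 1 \<or> p \<le> 1 then carrier G
      else closed_subgroup_generated G T
        ((\<lambda>x. x [^]\<^bsub>G\<^esub> p) ` zassenhaus p G T (nat \<lceil>real n / real p\<rceil>) \<union>
         (\<Union>i\<in>{1..<n}. (\<Union>x\<in>zassenhaus p G T i. (\<lambda>y. inv\<^bsub>G\<^esub> x \<otimes>\<^bsub>G\<^esub> inv\<^bsub>G\<^esub> y \<otimes>\<^bsub>G\<^esub> x \<otimes>\<^bsub>G\<^esub> y) `
            zassenhaus p G T (n - i)))))"
  by pat_completeness auto
termination
proof (relation "Wellfounded.measure (\<lambda>(p, G, T, n). n)", goal_cases)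
  case (2 p G T n)
  then have "real n * 2 \<le> real n * real p" and "2 \<le> n"
    by (auto intro!: mult_left_mono)
  then have "real n / real p \<le> real n / 2"
    using 2 by (auto simp: field_simps)
  then have "real n / real p \<le> real n - 1"
    using \<open>2 \<le> n\<close> by linarith
  then have "\<lceil>real n / real p\<rceil> \<le> int n - 1"
    by linarith
  then show ?case
    using \<open>2 \<le> n\<close> by auto
qed auto

declare zassenhaus.simps [simp del]

section \<open>Continuous cohomology with coefficients in $\mathbb{Z}/p$\<close>

text \<open>
  \<open>\<int>/p\<close> is \<^const>\<open>integer_mod_group\<close>, with elements the residues \<open>0, \<dots>, p - 1\<close>.
  \<open>C\<^sup>1\<close> and \<open>C\<^sup>2\<close> are \<^term>\<open>cochain_group p T\<close> and
  \<^term>\<open>cochain_group p (prod_topology T T)\<close>; cochains are extensional, so that their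
  equality is equality of functions on the group.
\<close>

definition cochain_group :: "nat \<Rightarrow> 'x topology \<Rightarrow> ('x \<Rightarrow> int) monoid" where
  "cochain_group p T =
     \<lparr>carrier = {c \<in> extensional (topspace T).
         continuous_map T (discrete_topology (carrier (integer_mod_group p))) c},
      mult = (\<lambda>c d. \<lambda>x\<in>topspace T. c x \<otimes>\<^bsub>integer_mod_group p\<^esub> d x),
      one = (\<lambda>x\<in>topspace T. \<one>\<^bsub>integer_mod_group p\<^esub>)\<rparr>"

definition cobd :: "nat \<Rightarrow> ('a, 'm) monoid_scheme \<Rightarrow> ('a \<Rightarrow> int) \<Rightarrow> 'a \<times> 'a \<Rightarrow> int" where
  "cobd p G c = (\<lambda>(x, y)\<in>carrier G \<times> carrier G. (c x + c y - c (x \<otimes>\<^bsub>G\<^esub> y)) mod int p)"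

definition cocycles1 :: "nat \<Rightarrow> ('a, 'm) monoid_scheme \<Rightarrow> 'a topology \<Rightarrow> ('a \<Rightarrow> int) set" where
  "cocycles1 p G T =
     {c \<in> carrier (cochain_group p T). cobd p G c = (\<lambda>_\<in>carrier G \<times> carrier G. 0)}"

definition cocycles2 ::
    "nat \<Rightarrow> ('a, 'm) monoid_scheme \<Rightarrow> 'a topology \<Rightarrow> ('a \<times> 'a \<Rightarrow> int) monoid" where
  "cocycles2 p G T = (cochain_group p (prod_topology T T))
     \<lparr>carrier := {c \<in> carrier (cochain_group p (prod_topology T T)).
        \<forall>x\<in>carrier G. \<forall>y\<in>carrier G. \<forall>z\<in>carrier G.
          (c (y, z) - c (x \<otimes>\<^bsub>G\<^esub> y, z) + c (x, y \<otimes>\<^bsub>G\<^esub> z) - c (x, y)) mod int p = 0}\<rparr>"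

definition coboundaries2 ::
    "nat \<Rightarrow> ('a, 'm) monoid_scheme \<Rightarrow> 'a topology \<Rightarrow> ('a \<times> 'a \<Rightarrow> int) set" where
  "coboundaries2 p G T = cobd p G ` carrier (cochain_group p T)"

definition H2 ::
    "nat \<Rightarrow> ('a, 'm) monoid_scheme \<Rightarrow> 'a topology \<Rightarrow> ('a \<times> 'a \<Rightarrow> int) set monoid" where
  "H2 p G T = cocycles2 p G T Mod coboundaries2 p G T"

definition H2_class ::
    "nat \<Rightarrow> ('a, 'm) monoid_scheme \<Rightarrow> 'a topology \<Rightarrow> ('a \<times> 'a \<Rightarrow> int) \<Rightarrow> ('a \<times> 'a \<Rightarrow> int) set" where
  "H2_class p G T z = coboundaries2 p G T #>\<^bsub>cocycles2 p G T\<^esub> z"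

abbreviation H2_Mod ::
    "nat \<Rightarrow> ('a, 'm) monoid_scheme \<Rightarrow> 'a topology \<Rightarrow> 'a set \<Rightarrow> ('a set \<times> 'a set \<Rightarrow> int) set monoid" where
  "H2_Mod p G T N \<equiv> H2 p (G Mod N) (Mod_topology G T N)"

text \<open>
  \<open>H\<^sup>1(N)\<^sup>G\<close> for a normal subgroup \<open>N\<close> of \<open>G\<close>.  As the action on the coefficients is trivial,
  \<open>B\<^sup>1 = 0\<close> and \<open>H\<^sup>1 = Z\<^sup>1\<close>.
\<close>

definition H1_invariants ::
    "nat \<Rightarrow> ('a, 'm) monoid_scheme \<Rightarrow> 'a topology \<Rightarrow> 'a set \<Rightarrow> ('a \<Rightarrow> int) monoid" where
  "H1_invariants p G T N = (cochain_group p (subtopology T N))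
     \<lparr>carrier := {c \<in> cocycles1 p (G\<lparr>carrier := N\<rparr>) (subtopology T N).
        \<forall>g\<in>carrier G. \<forall>x\<in>N. c (inv\<^bsub>G\<^esub> g \<otimes>\<^bsub>G\<^esub> x \<otimes>\<^bsub>G\<^esub> g) = c x}\<rparr>"

text \<open>
  The inflation \<open>H\<^sup>2(G/M) \<rightarrow> H\<^sup>2(G/N)\<close> for normal subgroups \<open>N \<subseteq> M\<close>.  The projection
  \<open>G/N \<rightarrow> G/M\<close> maps a coset \<open>A\<close> to \<open>MA\<close>; the cocycles inflated from those in a class \<open>\<alpha>\<close> form a
  subset of one class of \<open>H\<^sup>2(G/N)\<close>, and multiplying with the coboundaries gives all of that class.
\<close>

definition inflation2 ::
    "nat \<Rightarrow> ('a, 'm) monoid_scheme \<Rightarrow> 'a topology \<Rightarrow> 'a set \<Rightarrow> 'a set \<Rightarrow>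
     ('a set \<times> 'a set \<Rightarrow> int) set \<Rightarrow> ('a set \<times> 'a set \<Rightarrow> int) set" where
  "inflation2 p G T M N \<alpha> =
     coboundaries2 p (G Mod N) (Mod_topology G T N)
     <#>\<^bsub>cocycles2 p (G Mod N) (Mod_topology G T N)\<^esub>
     (\<lambda>z. \<lambda>(A, B)\<in>carrier (G Mod N) \<times> carrier (G Mod N). z (M <#>\<^bsub>G\<^esub> A, M <#>\<^bsub>G\<^esub> B)) ` \<alpha>"

text \<open>
  The transgression \<open>H\<^sup>1(N)\<^sup>G \<rightarrow> H\<^sup>2(G/N)\<close>: extend \<open>\<psi>\<close> to a continuous cochain \<open>y\<close> of \<open>G\<close> whose
  coboundary is the inflation of a cocycle \<open>z\<close> of \<open>G/N\<close>; the image of \<open>\<psi>\<close> is the class of \<open>z\<close>.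
\<close>

definition transgression ::
    "nat \<Rightarrow> ('a, 'm) monoid_scheme \<Rightarrow> 'a topology \<Rightarrow> 'a set \<Rightarrow> ('a \<Rightarrow> int) \<Rightarrow>
     ('a set \<times> 'a set \<Rightarrow> int) set" where
  "transgression p G T N \<psi> =
     (THE \<alpha>. \<exists>y \<in> carrier (cochain_group p T).
             \<exists>z \<in> carrier (cocycles2 p (G Mod N) (Mod_topology G T N)).
        (\<forall>x\<in>N. y x = \<psi> x) \<and>
        (\<forall>x\<in>carrier G. \<forall>x'\<in>carrier G. cobd p G y (x, x') = z (N #>\<^bsub>G\<^esub> x, N #>\<^bsub>G\<^esub> x')) \<and>
        \<alpha> = H2_class p (G Mod N) (Mod_topology G T N) z)"

section \<open>Massey products\<close>

text \<open>The cochain $-\sum_{r=i}^{j-1} c_{ir} \cup c_{r+1,j}$.\<close>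

definition cup_sum ::
    "nat \<Rightarrow> ('a, 'm) monoid_scheme \<Rightarrow> (nat \<Rightarrow> nat \<Rightarrow> 'a \<Rightarrow> int) \<Rightarrow> nat \<Rightarrow> nat \<Rightarrow> 'a \<times> 'a \<Rightarrow> int" where
  "cup_sum p G c i j =
     (\<lambda>(x, y)\<in>carrier G \<times> carrier G. (- (\<Sum>r = i..<j. c i r x * c (r + 1) j y)) mod int p)"

definition defining_system ::
    "nat \<Rightarrow> nat \<Rightarrow> ('a, 'm) monoid_scheme \<Rightarrow> 'a topology \<Rightarrow> (nat \<Rightarrow> nat \<Rightarrow> 'a \<Rightarrow> int) \<Rightarrow> bool" where
  "defining_system p n G T c \<longleftrightarrow>
     (\<forall>i j. 1 \<le> i \<and> i \<le> j \<and> j \<le> n \<and> (i, j) \<noteq> (1, n) \<longrightarrow>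
        c i j \<in> carrier (cochain_group p T) \<and> cobd p G (c i j) = cup_sum p G c i j)"

definition massey_products ::
    "nat \<Rightarrow> nat \<Rightarrow> ('a, 'm) monoid_scheme \<Rightarrow> 'a topology \<Rightarrow> ('a \<times> 'a \<Rightarrow> int) set set" where
  "massey_products p n G T =
     {H2_class p G T (cup_sum p G c 1 n) |c. defining_system p n G T c}"

definition H2_Massey ::
    "nat \<Rightarrow> nat \<Rightarrow> ('a, 'm) monoid_scheme \<Rightarrow> 'a topology \<Rightarrow> ('a \<times> 'a \<Rightarrow> int) set monoid" where
  "H2_Massey p n G T =
     (H2 p G T)\<lparr>carrier := generate (H2 p G T) (massey_products p n G T)\<rparr>"

abbreviation H2_Massey_Mod ::
    "nat \<Rightarrow> nat \<Rightarrow> ('a, 'm) monoid_scheme \<Rightarrow> 'a topology \<Rightarrow> 'a set \<Rightarrow>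
     ('a set \<times> 'a set \<Rightarrow> int) set monoid" where
  "H2_Massey_Mod p n G T N \<equiv> H2_Massey p n (G Mod N) (Mod_topology G T N)"

section \<open>Pairings\<close>

definition bilinear_pairing ::
    "('a, 'm) monoid_scheme \<Rightarrow> ('b, 'k) monoid_scheme \<Rightarrow> ('c, 'l) monoid_scheme \<Rightarrow>
     ('a \<Rightarrow> 'b \<Rightarrow> 'c) \<Rightarrow> bool" where
  "bilinear_pairing A B C f \<longleftrightarrow>
     (\<forall>a\<in>carrier A. f a \<in> hom B C) \<and> (\<forall>b\<in>carrier B. (\<lambda>a. f a b) \<in> hom A C)"

definition nondegenerate_pairing ::
    "('a, 'm) monoid_scheme \<Rightarrow> ('b, 'k) monoid_scheme \<Rightarrow> ('c, 'l) monoid_scheme \<Rightarrow>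
     ('a \<Rightarrow> 'b \<Rightarrow> 'c) \<Rightarrow> bool" where
  "nondegenerate_pairing A B C f \<longleftrightarrow>
     (\<forall>a\<in>carrier A. (\<forall>b\<in>carrier B. f a b = \<one>\<^bsub>C\<^esub>) \<longrightarrow> a = \<one>\<^bsub>A\<^esub>) \<and>
     (\<forall>b\<in>carrier B. (\<forall>a\<in>carrier A. f a b = \<one>\<^bsub>C\<^esub>) \<longrightarrow> b = \<one>\<^bsub>B\<^esub>)"

end

(*
  An invariant homomorphism psi on S_n is transgressed to the class of a cocycle z if it extends to a
  cochain y of S whose coboundary is the inflation of z; the inflation of this class to S/N' is trivial
  for a closed normal subgroup N' of S_n if and only if psi vanishes on N'.  Hence everything follows
  once the classes generated by n-fold Massey products are identified with the transgressions of
  those psi that vanish on S_(n+1).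

  Massey products have this property, since a defining system lifts to a unipotent representation of
  the free group S, and polynomial functions of degree < m are constant on S_m.  Conversely, a psi that
  vanishes on S_(n+1) extends to a polynomial function f of degree at most n on S (the
  Jennings-Lazard theorem in dual form; f is extended step by step along a chain of subgroups with
  quotients of order p).  Taylor expansion along the Magnus coefficients eps_w of S gives
  f(t) = sum_w eps_w(t) (Delta_w f)(1), where eps_w vanishes on S_n if 0 < |w| < n, while
  for |w| = n the restriction of eps_w to S_n transgresses to a Massey product.
*)
theory Submission
  imports Defs "HOL-Algebra.Weak_Morphisms"
begin

text \<open>Degrees are measured on integer valued functions modulo p, so that the group algebra and
  its completion never appear: the value of the linear extension of f at a product of factors h - 1
  is an iterated difference. Two kinds of weights are in play. The extension argument uses those of
  the Zassenhaus filtration, because a character of S_n that is trivial on S_(n+1) has degree at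
  most n for them, and a step of order p respects them: the group ring of the bigger group is free
  over that of the smaller one on 1, g - 1, ..., (g - 1)^(p-1), and (g - 1)^p is g^p - 1 modulo p,
  where g^p has weight p w if g has weight w. Only at the end are these weights forgotten, leaving
  an ordinary polynomial function to which the Magnus expansion applies. The chain of subgroups has
  to be finite, so all of this takes place modulo an open normal subgroup W, which also leaves only
  finitely many basis elements as letters. The left kernel of the pairing is a separate matter: it
  requires enough characters of S_n, which exist because S_n / S_(n+1) is elementary abelian and
  central in S / S_(n+1).\<close>

section \<open>Polynomial functions on filtered groups\<close>

text \<open>The action of h - 1 on functions by right translation. Values are integers read modulo p
  but not reduced, so linear identities between iterated differences hold exactly.\<close>

definition rdiff :: "('a, 'm) monoid_scheme \<Rightarrow> 'a \<Rightarrow> ('a \<Rightarrow> int) \<Rightarrow> 'a \<Rightarrow> int" where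
  "rdiff G h f = (\<lambda>x. f (x \<otimes>\<^bsub>G\<^esub> h) - f x)"

definition ldiff :: "('a, 'm) monoid_scheme \<Rightarrow> 'a \<Rightarrow> ('a \<Rightarrow> int) \<Rightarrow> 'a \<Rightarrow> int" where
  "ldiff G g f = (\<lambda>x. f (g \<otimes>\<^bsub>G\<^esub> x) - f x)"

lemma rdiff_apply: "rdiff G h f x = f (x \<otimes>\<^bsub>G\<^esub> h) - f x"
  by (simp add: rdiff_def)

lemma ldiff_apply: "ldiff G g f x = f (g \<otimes>\<^bsub>G\<^esub> x) - f x"
  by (simp add: ldiff_def)

text \<open>
  \<open>f\<close> has degree less than \<open>k\<close> modulo \<open>p\<close>, where the elements of \<open>\<Phi> v\<close> have weight \<open>v\<close> and
  the domain is \<open>\<Phi> 0\<close>.  Equivalently, the linear extension of \<open>f\<close> to the group ring kills the ideal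
  spanned by the products \<open>(h\<^sub>1 - 1) \<cdots> (h\<^sub>m - 1)\<close> of total weight at least \<open>k\<close>.
\<close>

function deg_less ::
    "nat \<Rightarrow> ('a, 'm) monoid_scheme \<Rightarrow> (nat \<Rightarrow> 'a set) \<Rightarrow> nat \<Rightarrow> ('a \<Rightarrow> int) \<Rightarrow> bool" where
  "deg_less p G \<Phi> k f =
     (if k = 0 then \<forall>x\<in>\<Phi> 0. int p dvd f x
      else \<forall>v\<in>{1..}. \<forall>h\<in>\<Phi> v. deg_less p G \<Phi> (k - v) (rdiff G h f))"
  by pat_completeness auto
termination
  by (relation "Wellfounded.measure (\<lambda>(p, G, \<Phi>, k, f). k)") auto

declare deg_less.simps [simp del]

context group
begin

lemma mult_inv_cancel: "x \<in> carrier G \<Longrightarrow> y \<in> carrier G \<Longrightarrow> x \<otimes> (inv x \<otimes> y) = y"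
  by (simp add: m_assoc[symmetric])

lemma inv_mult_cancel: "x \<in> carrier G \<Longrightarrow> y \<in> carrier G \<Longrightarrow> inv x \<otimes> (x \<otimes> y) = y"
  by (simp add: m_assoc[symmetric])

lemmas group_simps = m_assoc inv_mult_group mult_inv_cancel inv_mult_cancel

end

text \<open>Only level 0, the domain, has to be a subgroup; this admits
  \<open>lower_filtration\<close>, whose levels above 1 are empty. Since level 1 is the domain too,
  every difference lowers a positive degree bound by at least 1, which makes degrees invariant under
  translation.\<close>

locale filtration = group G for G (structure) +
  fixes \<Phi> :: "nat \<Rightarrow> 'a set" and p :: nat
  assumes subgroup_0: "subgroup (\<Phi> 0) G"
    and one_eq_0: "\<Phi> 1 = \<Phi> 0"
    and subset_0: "\<Phi> v \<subseteq> \<Phi> 0"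
begin

abbreviation "K \<equiv> deg_less p G \<Phi>"

lemma carrier_0: "x \<in> \<Phi> 0 \<Longrightarrow> x \<in> carrier G"
  using subgroup.subset[OF subgroup_0] by blast

lemma mult_0: "x \<in> \<Phi> 0 \<Longrightarrow> h \<in> \<Phi> v \<Longrightarrow> x \<otimes> h \<in> \<Phi> 0"
  using subgroup.m_closed[OF subgroup_0] subset_0 by blast

lemma K_0: "K 0 f \<longleftrightarrow> (\<forall>x\<in>\<Phi> 0. int p dvd f x)"
  by (subst deg_less.simps) simp

lemma K_pos: "k > 0 \<Longrightarrow> K k f \<longleftrightarrow> (\<forall>v\<ge>1. \<forall>h\<in>\<Phi> v. K (k - v) (rdiff G h f))"
  by (subst deg_less.simps) auto

lemma K_zero: "(\<And>x. x \<in> \<Phi> 0 \<Longrightarrow> int p dvd f x) \<Longrightarrow> K k f"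
proof (induction k arbitrary: f rule: less_induct)
  case (less k)
  show ?case
  proof (cases "k = 0")
    case False
    show ?thesis unfolding K_pos[OF False[unfolded neq0_conv]]
      using False by (auto intro!: less.IH dvd_diff less.prems simp: rdiff_def mult_0)
  qed (use less.prems in \<open>simp add: K_0\<close>)
qed

lemma K_add: "K k f \<Longrightarrow> K k g \<Longrightarrow> K k (\<lambda>x. f x + g x)"
proof (induction k arbitrary: f g rule: less_induct)
  case (less k)
  show ?case
  proof (cases "k = 0")
    case False
    have "rdiff G h (\<lambda>x. f x + g x) = (\<lambda>x. rdiff G h f x + rdiff G h g x)" for h
      by (auto simp: rdiff_def)
    then show ?thesis
      using less False by (simp add: K_pos)
  qed (use less.prems in \<open>simp add: K_0\<close>)
qed

lemma K_scale: "K k f \<Longrightarrow> K k (\<lambda>x. c * f x)"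
proof (induction k arbitrary: f rule: less_induct)
  case (less k)
  show ?case
  proof (cases "k = 0")
    case False
    have "rdiff G h (\<lambda>x. c * f x) = (\<lambda>x. c * rdiff G h f x)" for h
      by (auto simp: rdiff_def algebra_simps)
    then show ?thesis
      using less False by (simp add: K_pos)
  qed (use less.prems in \<open>simp add: K_0\<close>)
qed

lemma K_diff: "K k f \<Longrightarrow> K k g \<Longrightarrow> K k (\<lambda>x. f x - g x)"
  using K_add[of k f "\<lambda>x. - 1 * g x"] K_scale[of k g "- 1"] by simp

lemma K_sum: "finite A \<Longrightarrow> (\<And>i. i \<in> A \<Longrightarrow> K k (f i)) \<Longrightarrow> K k (\<lambda>x. \<Sum>i\<in>A. f i x)"
  by (induction A rule: finite_induct) (auto intro: K_zero K_add)

lemma K_cong_mod: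
  assumes "K k f" and "\<And>x. x \<in> \<Phi> 0 \<Longrightarrow> int p dvd f x - g x"
  shows "K k g"
  using K_diff[OF assms(1) K_zero[of "\<lambda>x. f x - g x"]] assms(2) by simp

lemma K_cong: "K k f \<Longrightarrow> (\<And>x. x \<in> \<Phi> 0 \<Longrightarrow> f x = g x) \<Longrightarrow> K k g"
  by (rule K_cong_mod) auto

lemma K_Suc: "K k f \<Longrightarrow> K (Suc k) f"
proof (induction k arbitrary: f rule: less_induct)
  case (less k)
  show ?case
  proof (cases "k = 0")
    case True
    then show ?thesis using less.prems by (auto simp: K_0 intro: K_zero)
  next
    case False
    have "K (Suc k - v) (rdiff G h f)" if "v \<ge> 1" "h \<in> \<Phi> v" for v h
    proof -
      have *: "K (k - v) (rdiff G h f)"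
        using that less.prems False by (auto simp: K_pos)
      show ?thesis
      proof (cases "v \<le> k")
        case True
        then show ?thesis using less.IH[OF _ *] that False by (simp add: Suc_diff_le)
      next
        \<comment> \<open>For \<open>v > k\<close> both \<open>k - v\<close> and
          \<open>Suc k - v\<close> are 0 by truncation.\<close>
        case False
        then show ?thesis using * by simp
      qed
    qed
    then show ?thesis by (simp add: K_pos)
  qed
qed

lemma K_mono: "K k f \<Longrightarrow> k \<le> l \<Longrightarrow> K l f"
  by (induction l) (auto intro: K_Suc simp: le_Suc_eq)

lemma K_const: "k > 0 \<Longrightarrow> K k (\<lambda>_. c)"
  by (auto simp: K_pos rdiff_def intro: K_zero)

text \<open>Translation by y adds the difference by y, whose degree is smaller because y has weight
  1.\<close>

lemma K_right:
  assumes "K k f" and "y \<in> \<Phi> 0"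
  shows "K k (\<lambda>x. f (x \<otimes> y))"
proof (cases "k = 0")
  case True
  then show ?thesis using assms by (auto simp: K_0 mult_0)
next
  case False
  then have "K (k - 1) (rdiff G y f)"
    using assms one_eq_0 by (auto simp: K_pos)
  then have "K k (rdiff G y f)"
    by (rule K_mono) simp
  from K_add[OF this assms(1)] show ?thesis
    by (simp add: rdiff_def)
qed

text \<open>The recursion of \<open>deg_less\<close> speaks of positive k and v. For k = 0 or v = 0
  no drop is claimed, and translation invariance suffices.\<close>

lemma K_rdiff:
  assumes "K k f" and "h \<in> \<Phi> v"
  shows "K (k - v) (rdiff G h f)"
proof (cases "k = 0 \<or> v = 0")
  case True
  have "K k (rdiff G h f)"
    unfolding rdiff_def using K_diff[OF K_right[OF assms(1)] assms(1)] assms(2) subset_0 by blast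
  then show ?thesis using True by (auto intro: K_mono)
next
  case False
  then show ?thesis using assms by (auto simp: K_pos)
qed

text \<open>Left translations commute with right differences, so the induction passes to the
  differences of f.\<close>

lemma K_left:
  assumes "K k f" and "y \<in> \<Phi> 0"
  shows "K k (\<lambda>x. f (y \<otimes> x))"
  using assms(1)
proof (induction k arbitrary: f rule: less_induct)
  case (less k)
  show ?case
  proof (cases "k = 0")
    case True
    then show ?thesis using less.prems assms(2) by (auto simp: K_0 mult_0)
  next
    case False
    have "K (k - v) (rdiff G h (\<lambda>x. f (y \<otimes> x)))" if "v \<ge> 1" "h \<in> \<Phi> v" for v h
    proof (rule K_cong)
      show "K (k - v) (\<lambda>x. rdiff G h f (y \<otimes> x))"
        using less.IH[OF _ K_rdiff[OF less.prems that(2)]] that False by simp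
      show "rdiff G h f (y \<otimes> x) = rdiff G h (\<lambda>x. f (y \<otimes> x)) x" if "x \<in> \<Phi> 0" for x
        using that assms(2) subset_0[THEN subsetD, OF \<open>h \<in> \<Phi> v\<close>]
        by (simp add: rdiff_def m_assoc carrier_0)
    qed
    then show ?thesis using False by (simp add: K_pos)
  qed
qed

end

text \<open>Smaller levels mean fewer differences to test. In this way a bound for the Zassenhaus
  weights becomes a bound for the ordinary degree.\<close>

lemma deg_less_subfiltration:
  assumes "filtration G \<Phi>" "filtration G \<Psi>" and "\<And>v. \<Psi> v \<subseteq> \<Phi> v"
    and "deg_less p G \<Phi> k f"
  shows "deg_less p G \<Psi> k f"
  using assms(4)
proof (induction k arbitrary: f rule: less_induct)
  case (less k)
  interpret F: filtration G \<Phi> p by (rule assms(1))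
  interpret E: filtration G \<Psi> p by (rule assms(2))
  show ?case
  proof (cases "k = 0")
    case True
    then show ?thesis using less.prems assms(3) by (auto simp: F.K_0 E.K_0)
  next
    case False
    then show ?thesis
      using less assms(3) F.K_rdiff[OF less.prems] by (auto simp: E.K_pos subset_iff)
  qed
qed

text \<open>A restricted filtration (an N_p-series) with a level 0 added; the commutator rule at
  level 0 expresses normality of the levels. It covers the Zassenhaus filtration and its images
  modulo open normal subgroups.\<close>

locale np_filtration = group G for G (structure) +
  fixes \<Phi> :: "nat \<Rightarrow> 'a set" and p :: nat
  assumes Phi_subgroup: "subgroup (\<Phi> v) G"
    and Phi_0: "\<Phi> 0 = carrier G" and Phi_1: "\<Phi> 1 = carrier G"
    and Phi_Suc: "\<Phi> (Suc v) \<subseteq> \<Phi> v"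
    and Phi_comm: "x \<in> \<Phi> v \<Longrightarrow> y \<in> \<Phi> w \<Longrightarrow> inv x \<otimes> inv y \<otimes> x \<otimes> y \<in> \<Phi> (v + w)"
    and Phi_pow: "x \<in> \<Phi> v \<Longrightarrow> x [^] p \<in> \<Phi> (p * v)"
    and p_prime: "prime p"
begin

lemma Phi_carrier: "x \<in> \<Phi> v \<Longrightarrow> x \<in> carrier G"
  using subgroup.subset[OF Phi_subgroup] by blast

lemma Phi_mono: "v \<le> w \<Longrightarrow> \<Phi> w \<subseteq> \<Phi> v"
  by (rule lift_Suc_antimono_le[of \<Phi>]) (rule Phi_Suc)

lemma conj_eq_mult_comm:
  "x \<in> carrier G \<Longrightarrow> g \<in> carrier G \<Longrightarrow> inv g \<otimes> x \<otimes> g = x \<otimes> (inv x \<otimes> inv g \<otimes> x \<otimes> g)"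
  by (simp add: group_simps)

lemma Phi_conj: "x \<in> \<Phi> v \<Longrightarrow> g \<in> carrier G \<Longrightarrow> inv g \<otimes> x \<otimes> g \<in> \<Phi> v"
  using Phi_comm[of x v g 0] conj_eq_mult_comm[of x g] subgroup.m_closed[OF Phi_subgroup]
  by (simp add: Phi_0 Phi_carrier)

lemma restrict_filtration: "subgroup H G \<Longrightarrow> filtration G (\<lambda>v. H \<inter> \<Phi> v)"
  using subgroup.subset[of H G] Phi_carrier
  by (intro filtration.intro filtration_axioms.intro is_group) (auto simp: Phi_0 Phi_1[simplified] Int_absorb2)

abbreviation "KH H \<equiv> deg_less p G (\<lambda>v. H \<inter> \<Phi> v)"

text \<open>A difference by h of the conjugated function is the conjugate of a difference by
  \<open>inv g \<otimes> h \<otimes> g\<close>, which has the same weight.\<close>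

lemma KH_conj:
  assumes H: "subgroup H G" and g: "g \<in> carrier G" and gH: "\<And>h. h \<in> H \<Longrightarrow> inv g \<otimes> h \<otimes> g \<in> H"
    and "KH H k f"
  shows "KH H k (\<lambda>x. f (inv g \<otimes> x \<otimes> g))"
  using assms(4)
proof (induction k arbitrary: f rule: less_induct)
  case (less k)
  interpret F: filtration G "\<lambda>v. H \<inter> \<Phi> v" p by (rule restrict_filtration[OF H])
  note Hc = subgroup.mem_carrier[OF H]
  show ?case
  proof (cases "k = 0")
    case True
    then show ?thesis using less.prems gH g by (auto simp: F.K_0 Phi_0)
  next
    case False
    have "KH H (k - v) (rdiff G h (\<lambda>x. f (inv g \<otimes> x \<otimes> g)))" if "v \<ge> 1" "h \<in> H \<inter> \<Phi> v" for v h
    proof (rule F.K_cong)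
      have h': "inv g \<otimes> h \<otimes> g \<in> H \<inter> \<Phi> v"
        using that gH Phi_conj g by auto
      show "KH H (k - v) (\<lambda>x. rdiff G (inv g \<otimes> h \<otimes> g) f (inv g \<otimes> x \<otimes> g))"
        using less.IH[OF _ F.K_rdiff[OF less.prems h']] that False by simp
      show "rdiff G (inv g \<otimes> h \<otimes> g) f (inv g \<otimes> x \<otimes> g) = rdiff G h (\<lambda>x. f (inv g \<otimes> x \<otimes> g)) x"
        if "x \<in> H \<inter> \<Phi> 0" for x
      proof -
        show ?thesis
          using that \<open>h \<in> H \<inter> \<Phi> v\<close> g Hc by (simp add: rdiff_def group_simps)
      qed
    qed
    then show ?thesis using False by (simp add: F.K_pos)
  qed
qed

text \<open>\<open>inv g \<otimes> x \<otimes> g\<close> is x times the commutator of x and g, whose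
  weight exceeds that of x by w. Thus conjugation by g changes f by a function of degree lower by w,
  even when g lies outside H.\<close>

lemma KH_conj_diff:
  assumes H: "subgroup H G" and g: "g \<in> \<Phi> w" and gH: "\<And>h. h \<in> H \<Longrightarrow> inv g \<otimes> h \<otimes> g \<in> H"
    and "KH H k f"
  shows "KH H (k - w) (\<lambda>x. f (inv g \<otimes> x \<otimes> g) - f x)"
  using assms(4)
proof (induction k arbitrary: f rule: less_induct)
  case (less k)
  interpret F: filtration G "\<lambda>v. H \<inter> \<Phi> v" p by (rule restrict_filtration[OF H])
  note Hc = subgroup.mem_carrier[OF H]
  have gc: "g \<in> carrier G" using g Phi_carrier by blast
  have comm_H: "inv h \<otimes> inv g \<otimes> h \<otimes> g \<in> H \<inter> \<Phi> (v + w)" if "h \<in> H \<inter> \<Phi> v" for h v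
  proof -
    have "inv h \<otimes> (inv g \<otimes> h \<otimes> g) \<in> H"
      using that by (auto intro!: subgroup.m_closed[OF H] subgroup.m_inv_closed[OF H] gH)
    then show ?thesis
      using that g Phi_comm[of h v g w] Hc gc by (simp add: m_assoc)
  qed
  show ?case
  proof (cases "k - w = 0")
    case True
    \<comment> \<open>Here x counts as an element of weight 0, so its commutator with g has weight
      w.\<close>
    have "int p dvd f (inv g \<otimes> x \<otimes> g) - f x" if x: "x \<in> H" for x
    proof -
      have "x \<in> H \<inter> \<Phi> 0" using x Hc Phi_0 by auto
      then have "KH H (k - w) (rdiff G (inv x \<otimes> inv g \<otimes> x \<otimes> g) f)"
        using F.K_rdiff[OF less.prems comm_H[of x 0]] by simp
      then have "int p dvd rdiff G (inv x \<otimes> inv g \<otimes> x \<otimes> g) f x"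
        using True \<open>x \<in> H \<inter> \<Phi> 0\<close> by (auto simp: F.K_0)
      then show ?thesis
        using conj_eq_mult_comm[OF Hc[OF x] gc] by (simp add: rdiff_def)
    qed
    then show ?thesis using True by (simp add: F.K_0)
  next
    case False
    have "KH H (k - w - v) (rdiff G h (\<lambda>x. f (inv g \<otimes> x \<otimes> g) - f x))"
      if v: "v \<ge> 1" and h: "h \<in> H \<inter> \<Phi> v" for v h
    proof (rule F.K_cong)
      let ?c = "inv h \<otimes> inv g \<otimes> h \<otimes> g"
      have "KH H (k - v - w) (\<lambda>x. rdiff G h f (inv g \<otimes> x \<otimes> g) - rdiff G h f x)"
        using less.IH[OF _ F.K_rdiff[OF less.prems h]] v False by simp
      then have 1: "KH H (k - w - v) (\<lambda>x. rdiff G h f (inv g \<otimes> x \<otimes> g) - rdiff G h f x)"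
        by (simp add: add.commute)
      have h0: "h \<in> H \<inter> \<Phi> 0" using h Hc Phi_0 by auto
      have "KH H (k - (v + w)) (rdiff G ?c f)"
        by (rule F.K_rdiff[OF less.prems comm_H[OF h]])
      from F.K_right[OF this h0] have "KH H (k - (v + w)) (\<lambda>x. rdiff G ?c f (x \<otimes> h))" .
      from KH_conj[OF H gc gH this]
      have 2: "KH H (k - w - v) (\<lambda>x. rdiff G ?c f (inv g \<otimes> x \<otimes> g \<otimes> h))"
        by (simp add: add.commute)
      show "KH H (k - w - v) (\<lambda>x. (rdiff G h f (inv g \<otimes> x \<otimes> g) - rdiff G h f x)
          + rdiff G ?c f (inv g \<otimes> x \<otimes> g \<otimes> h))"
        by (rule F.K_add[OF 1 2])
      fix x assume x: "x \<in> H \<inter> \<Phi> 0"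
      \<comment> \<open>The commutator turns h into its conjugate:
        \<open>h \<otimes> ?c = inv g \<otimes> h \<otimes> g\<close>.\<close>
      have "inv g \<otimes> x \<otimes> g \<otimes> h \<otimes> ?c = inv g \<otimes> (x \<otimes> h) \<otimes> g"
        using x h gc Hc by (simp add: group_simps)
      then show "(rdiff G h f (inv g \<otimes> x \<otimes> g) - rdiff G h f x)
          + rdiff G ?c f (inv g \<otimes> x \<otimes> g \<otimes> h) = rdiff G h (\<lambda>x. f (inv g \<otimes> x \<otimes> g) - f x) x"
        by (simp add: rdiff_def)
    qed
    then show ?thesis using False by (simp add: F.K_pos)
  qed
qed

text \<open>Left differences commute with right ones, which carries the induction; in degree 0,
  \<open>c \<otimes> x = x \<otimes> (inv x \<otimes> c \<otimes> x)\<close> replaces the left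
  difference by a right one of the same weight.\<close>

lemma KH_ldiff:
  assumes H: "subgroup H G" and c: "c \<in> H \<inter> \<Phi> w" and "KH H k f"
  shows "KH H (k - w) (ldiff G c f)"
  using assms(3)
proof (induction k arbitrary: f rule: less_induct)
  case (less k)
  interpret F: filtration G "\<lambda>v. H \<inter> \<Phi> v" p by (rule restrict_filtration[OF H])
  note Hc = subgroup.mem_carrier[OF H]
  have cc: "c \<in> carrier G" using c Hc by blast
  show ?case
  proof (cases "k - w = 0")
    case True
    have "int p dvd ldiff G c f x" if x: "x \<in> H" for x
    proof -
      have "inv x \<otimes> c \<otimes> x \<in> H \<inter> \<Phi> w"
        using x c Hc Phi_conj by (auto intro!: subgroup.m_closed[OF H] subgroup.m_inv_closed[OF H])
      then have "KH H (k - w) (rdiff G (inv x \<otimes> c \<otimes> x) f)"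
        using F.K_rdiff[OF less.prems] by simp
      then have "int p dvd rdiff G (inv x \<otimes> c \<otimes> x) f x"
        using True x Hc Phi_0 by (auto simp: F.K_0)
      then show ?thesis
        using x Hc cc by (simp add: rdiff_def ldiff_def group_simps)
    qed
    then show ?thesis using True by (simp add: F.K_0)
  next
    case False
    have "KH H (k - w - v) (rdiff G h (ldiff G c f))" if v: "v \<ge> 1" and h: "h \<in> H \<inter> \<Phi> v" for v h
    proof (rule F.K_cong)
      have "KH H (k - v - w) (ldiff G c (rdiff G h f))"
        using less.IH[OF _ F.K_rdiff[OF less.prems h]] v False by simp
      then show "KH H (k - w - v) (ldiff G c (rdiff G h f))"
        by (simp add: add.commute)
      show "ldiff G c (rdiff G h f) x = rdiff G h (ldiff G c f) x" if "x \<in> H \<inter> \<Phi> 0" for x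
        using that cc Hc h by (simp add: rdiff_def ldiff_def m_assoc)
    qed
    then show ?thesis using False by (simp add: F.K_pos)
  qed
qed

end

section \<open>Powers of differences modulo p\<close>

lemma prime_dvd_pow_minus_1: "prime p \<Longrightarrow> int p dvd (- 1) ^ p + 1"
proof -
  assume "prime p"
  then have "p = 2 \<or> odd p"
    using prime_odd_nat[of p] prime_ge_2_nat[of p] by linarith
  then show ?thesis by auto
qed

context group
begin

text \<open>The binomial expansion of (g - 1)^a in the group ring, evaluated on F.\<close>

lemma ldiff_pow_binomial:
  assumes "g \<in> carrier G" "x \<in> carrier G"
  shows "(ldiff G g ^^ a) F x = (\<Sum>i\<le>a. (- 1) ^ (a - i) * int (a choose i) * F (g [^] i \<otimes> x))"
  using assms(2)
proof (induction a arbitrary: x)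
  case 0
  then show ?case by simp
next
  case (Suc a)
  let ?s = "\<lambda>a i. (- 1) ^ (a - i) * int (a choose i) :: int" and ?F = "\<lambda>i :: nat. F (g [^] i \<otimes> x)"
  have "g [^] i \<otimes> (g \<otimes> x) = g [^] Suc i \<otimes> x" for i :: nat
    using assms Suc.prems by (simp add: m_assoc)
  moreover have "(ldiff G g ^^ Suc a) F x = (ldiff G g ^^ a) F (g \<otimes> x) - (ldiff G g ^^ a) F x"
    by (simp add: ldiff_apply)
  ultimately have "(ldiff G g ^^ Suc a) F x = (\<Sum>i\<le>a. ?s a i * ?F (Suc i)) - (\<Sum>i\<le>a. ?s a i * ?F i)"
    using Suc.IH[of x] Suc.IH[of "g \<otimes> x"] Suc.prems assms by simp
  also have "(\<Sum>i\<le>a. ?s a i * ?F i) = ?s a 0 * ?F 0 + (\<Sum>i<a. ?s a (Suc i) * ?F (Suc i))"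
    by (cases a) (simp_all only: sum.atMost_Suc_shift lessThan_Suc_atMost, simp_all)
  \<comment> \<open>Pascal's rule; the second sum has been shifted so that both run over the powers
    \<open>g [^] Suc i\<close>.\<close>
  also have "(\<Sum>i\<le>a. ?s a i * ?F (Suc i)) - \<dots> =
      ?s (Suc a) 0 * ?F 0 + (\<Sum>i\<le>a. ?s (Suc a) (Suc i) * ?F (Suc i))"
  proof -
    have "(\<Sum>i<a. ?s a (Suc i) * ?F (Suc i)) = (\<Sum>i\<le>a. - ((- 1) ^ (a - i) * int (a choose Suc i)) * ?F (Suc i))"
    proof -
      have "(- 1 :: int) ^ (a - Suc i) = - ((- 1) ^ (a - i))" if "i < a" for i
        using that by (auto dest!: less_imp_Suc_add)
      then have "(\<Sum>i<a. ?s a (Suc i) * ?F (Suc i)) =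
          (\<Sum>i<a. - ((- 1) ^ (a - i) * int (a choose Suc i)) * ?F (Suc i))"
        by (intro sum.cong) auto
      then show ?thesis
        by (simp flip: lessThan_Suc_atMost)
    qed
    then show ?thesis
      by (simp add: sum_subtractf sum.distrib sum_negf algebra_simps)
  qed
  also have "\<dots> = (\<Sum>i\<le>Suc a. ?s (Suc a) i * ?F i)"
    by (simp only: sum.atMost_Suc_shift)
  finally show ?case .
qed

text \<open>Modulo p the inner binomial coefficients vanish, so (g - 1)^p is g^p - 1. The constant
  term (-1)^p is congruent to -1 for p = 2 as well.\<close>

lemma ldiff_pow_prime:
  assumes "g \<in> carrier G" "x \<in> carrier G" "prime p"
  shows "int p dvd (ldiff G g ^^ p) F x - (F (g [^] p \<otimes> x) - F x)"
proof -
  have p0: "p > 0" using assms(3) prime_gt_0_nat by blast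
  let ?t = "\<lambda>i. (- 1) ^ (p - i) * int (p choose i) * F (g [^] i \<otimes> x)"
  have "{..p} = insert 0 (insert p {0<..<p})"
    using p0 by auto
  then have "(ldiff G g ^^ p) F x = ?t 0 + ?t p + (\<Sum>i\<in>{0<..<p}. ?t i)"
    using p0 ldiff_pow_binomial[OF assms(1,2), of p F] by simp
  then have "(ldiff G g ^^ p) F x - (F (g [^] p \<otimes> x) - F x) =
      ((- 1) ^ p + 1) * F x + (\<Sum>i\<in>{0<..<p}. ?t i)"
    using assms by (simp add: algebra_simps)
  moreover have "int p dvd (\<Sum>i\<in>{0<..<p}. ?t i)"
    using dvd_choose_prime[of _ p] assms(3) by (intro dvd_sum dvd_mult2 dvd_mult) auto
  ultimately show ?thesis
    using prime_dvd_pow_minus_1[OF assms(3)] by simp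
qed

end

text \<open>H and L lie in one layer between \<open>\<Phi> (Suc w)\<close> and
  \<open>\<Phi> w\<close>. As 2w and pw are at least w + 1, commutators of H with g and the power
  \<open>g [^] p\<close> fall into H, and H has index 1 or p in L.\<close>

locale filtration_step = np_filtration G \<Phi> p for G (structure) and \<Phi> p +
  fixes H L :: "'a set" and g :: 'a and w :: nat
  assumes H: "subgroup H G" and L: "subgroup L G" and H_sub_L: "H \<subseteq> L"
    and g: "g \<in> L" and w: "w \<ge> 1" and L_sub: "L \<subseteq> \<Phi> w" and sub_H: "\<Phi> (Suc w) \<subseteq> H"
    and L_cases: "\<And>x. x \<in> L \<Longrightarrow> \<exists>a<p. \<exists>h\<in>H. x = g [^] a \<otimes> h"
begin

sublocale KH: filtration G "\<lambda>v. H \<inter> \<Phi> v" p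
  by (rule restrict_filtration[OF H])

sublocale KL: filtration G "\<lambda>v. L \<inter> \<Phi> v" p
  by (rule restrict_filtration[OF L])

lemma H_carrier: "h \<in> H \<Longrightarrow> h \<in> carrier G"
  using subgroup.mem_carrier[OF H] .

lemma g_carrier: "g \<in> carrier G"
  using subgroup.mem_carrier[OF L g] .

lemma g_conj: "h \<in> H \<Longrightarrow> inv g \<otimes> h \<otimes> g \<in> H"
proof -
  assume h: "h \<in> H"
  have "inv h \<otimes> inv g \<otimes> h \<otimes> g \<in> \<Phi> (w + w)"
    using Phi_comm h g H_sub_L L_sub by blast
  moreover have "\<Phi> (w + w) \<subseteq> \<Phi> (Suc w)"
    using w by (intro Phi_mono) simp
  ultimately show ?thesis
    using h sub_H conj_eq_mult_comm[of h g] H_carrier g_carrier subgroup.m_closed[OF H] by auto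
qed

lemma g_pow_p: "g [^] p \<in> H \<inter> \<Phi> (p * w)"
proof -
  have "g [^] p \<in> \<Phi> (p * w)"
    using Phi_pow g L_sub by blast
  moreover have "\<Phi> (p * w) \<subseteq> \<Phi> (Suc w)"
  proof (rule Phi_mono)
    have "2 * w \<le> p * w" using prime_ge_2_nat[OF p_prime] by (rule mult_le_mono1)
    then show "Suc w \<le> p * w" using w by linarith
  qed
  ultimately show ?thesis using sub_H by auto
qed

text \<open>
  \<open>Q k F\<close> is the condition that \<open>F\<close> has degree less than \<open>k\<close> on \<open>L\<close>, read off from the decomposition of
  the group ring of \<open>L\<close> as the direct sum of the \<open>(g - 1)\<^sup>a \<int>[H]\<close>, \<open>0 \<le> a < p\<close>.
\<close>

definition Q :: "nat \<Rightarrow> ('a \<Rightarrow> int) \<Rightarrow> bool" where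
  "Q k F \<longleftrightarrow> (\<forall>a<p. KH H (k - a * w) ((ldiff G g ^^ a) F))"

lemma ldiff_pow_add:
  "(ldiff G g ^^ a) (\<lambda>x. F x + F' x) = (\<lambda>x. (ldiff G g ^^ a) F x + (ldiff G g ^^ a) F' x)"
  by (induction a) (auto simp: ldiff_def)

lemma ldiff_pow_cong:
  assumes "\<And>x. x \<in> carrier G \<Longrightarrow> F x = F' x" and "x \<in> carrier G"
  shows "(ldiff G g ^^ a) F x = (ldiff G g ^^ a) F' x"
  using assms(2) by (induction a arbitrary: x) (auto simp: ldiff_apply g_carrier assms(1))

lemma ldiff_pow_rdiff:
  assumes "h \<in> carrier G" and "x \<in> carrier G"
  shows "(ldiff G g ^^ a) (rdiff G h F) x = rdiff G h ((ldiff G g ^^ a) F) x"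
  using assms(2)
proof (induction a arbitrary: x)
  case (Suc a)
  have "(ldiff G g ^^ Suc a) (rdiff G h F) x
      = (ldiff G g ^^ a) (rdiff G h F) (g \<otimes> x) - (ldiff G g ^^ a) (rdiff G h F) x"
    by (simp add: ldiff_apply)
  also have "\<dots> = rdiff G h ((ldiff G g ^^ a) F) (g \<otimes> x) - rdiff G h ((ldiff G g ^^ a) F) x"
    using Suc g_carrier by simp
  also have "\<dots> = rdiff G h ((ldiff G g ^^ Suc a) F) x"
    using Suc.prems assms(1) g_carrier by (simp add: rdiff_apply ldiff_apply m_assoc)
  finally show ?case .
qed simp

lemma Q_cong: "Q k F \<Longrightarrow> (\<And>x. x \<in> carrier G \<Longrightarrow> F x = F' x) \<Longrightarrow> Q k F'"
  unfolding Q_def using KH.K_cong ldiff_pow_cong[of F F'] KH.carrier_0 by metis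

lemma Q_add: "Q k F \<Longrightarrow> Q k F' \<Longrightarrow> Q k (\<lambda>x. F x + F' x)"
  unfolding Q_def ldiff_pow_add by (auto intro: KH.K_add)

lemma Q_mono: "Q k F \<Longrightarrow> k \<le> l \<Longrightarrow> Q l F"
  unfolding Q_def
proof (intro allI impI)
  fix a assume "\<forall>a<p. KH H (k - a * w) ((ldiff G g ^^ a) F)" "k \<le> l" "a < p"
  then show "KH H (l - a * w) ((ldiff G g ^^ a) F)"
    using KH.K_mono[of "k - a * w" "(ldiff G g ^^ a) F" "l - a * w"] by (simp add: diff_le_mono)
qed

text \<open>Right differences by elements of H commute with left differences by g, so each component
  can be treated separately.\<close>

lemma Q_rdiff_H:
  assumes "Q k F" and h: "h \<in> H \<inter> \<Phi> v"
  shows "Q (k - v) (rdiff G h F)"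
  unfolding Q_def
proof (intro allI impI)
  fix a assume "a < p"
  have "KH H (k - v - a * w) (rdiff G h ((ldiff G g ^^ a) F))"
    using KH.K_rdiff[OF _ h, of "k - a * w"] assms(1) \<open>a < p\<close>
    by (simp add: Q_def add.commute)
  then show "KH H (k - v - a * w) ((ldiff G g ^^ a) (rdiff G h F))"
    by (rule KH.K_cong) (use h H_carrier in \<open>auto simp: ldiff_pow_rdiff\<close>)
qed

text \<open>On H, the identity x g = g (inv g x g) expresses the component of index a of the right
  difference by g through the component of index a + 1 at the conjugate of x and the change of the
  component of index a under conjugation.\<close>

lemma Q_rdiff_g:
  assumes "Q k F"
  shows "Q (k - w) (rdiff G g F)"
  unfolding Q_def
proof (intro allI impI)
  fix a assume a: "a < p"
  let ?F = "\<lambda>a. (ldiff G g ^^ a) F"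
  have gw: "g \<in> \<Phi> w" using g L_sub by blast
  have Fa: "KH H (k - a * w) (?F a)" using assms a by (simp add: Q_def)
  have 1: "KH H (k - w - a * w) (\<lambda>x. ?F a (inv g \<otimes> x \<otimes> g) - ?F a x)"
    using KH_conj_diff[OF H gw g_conj Fa] by (simp add: add.commute)
  have "KH H (k - w - a * w) (?F (Suc a))"
  proof (cases "Suc a < p")
    case True
    then have "KH H (k - Suc a * w) (?F (Suc a))"
      using assms unfolding Q_def by blast
    then show ?thesis by simp
  next
    \<comment> \<open>The component of index p is not covered by \<open>Q\<close>. It is congruent
      to the left difference by \<open>g [^] p\<close>, an element of H of weight
      \<open>p * w\<close>.\<close>
    case False
    then have p: "p = Suc a" using a by simp
    have "KH H (k - p * w) (ldiff G (g [^] p) F)"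
      using KH_ldiff[OF H g_pow_p] assms prime_gt_0_nat[OF p_prime] by (auto simp: Q_def)
    then have "KH H (k - p * w) (?F p)"
    proof (rule KH.K_cong_mod)
      fix x assume "x \<in> H \<inter> \<Phi> 0"
      then have "int p dvd ?F p x - ldiff G (g [^] p) F x"
        using ldiff_pow_prime[OF g_carrier _ p_prime] H_carrier by (auto simp: ldiff_apply)
      then show "int p dvd ldiff G (g [^] p) F x - ?F p x"
        by (simp add: dvd_diff_commute)
    qed
    then show ?thesis using p by (metis diff_diff_left mult_Suc)
  qed
  then have 2: "KH H (k - w - a * w) (\<lambda>x. ?F (Suc a) (inv g \<otimes> x \<otimes> g))"
    using KH_conj[OF H g_carrier g_conj] by blast
  show "KH H (k - w - a * w) ((ldiff G g ^^ a) (rdiff G g F))"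
  proof (rule KH.K_cong[OF KH.K_add[OF 1 2]])
    fix x assume "x \<in> H \<inter> \<Phi> 0"
    then have x: "x \<in> carrier G" using H_carrier by blast
    have "g \<otimes> (inv g \<otimes> x \<otimes> g) = x \<otimes> g"
      using x g_carrier by (simp add: group_simps)
    then have "?F (Suc a) (inv g \<otimes> x \<otimes> g) = ?F a (x \<otimes> g) - ?F a (inv g \<otimes> x \<otimes> g)"
      by (simp add: ldiff_apply)
    then show "?F a (inv g \<otimes> x \<otimes> g) - ?F a x + ?F (Suc a) (inv g \<otimes> x \<otimes> g)
        = (ldiff G g ^^ a) (rdiff G g F) x"
      using x g_carrier by (simp add: ldiff_pow_rdiff rdiff_apply)
  qed
qed

text \<open>In the group ring, x y - 1 = (x - 1)(y - 1) + (y - 1) + (x - 1).\<close>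

lemma Q_rdiff_mult:
  assumes "x \<in> carrier G" "y \<in> carrier G"
    and x: "\<And>k F. Q k F \<Longrightarrow> Q (k - w) (rdiff G x F)" and y: "\<And>k F. Q k F \<Longrightarrow> Q (k - w) (rdiff G y F)"
    and F: "Q k F"
  shows "Q (k - w) (rdiff G (x \<otimes> y) F)"
proof (rule Q_cong)
  have "Q (k - w) (rdiff G x (rdiff G y F))"
    using Q_mono[OF x[OF y[OF F]]] by simp
  then show "Q (k - w) (\<lambda>z. rdiff G x (rdiff G y F) z + rdiff G y F z + rdiff G x F z)"
    using x[OF F] y[OF F] by (intro Q_add)
  show "rdiff G x (rdiff G y F) z + rdiff G y F z + rdiff G x F z = rdiff G (x \<otimes> y) F z"
    if "z \<in> carrier G" for z
    using that assms(1,2) by (simp add: rdiff_apply m_assoc)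
qed

lemma Q_rdiff_L:
  assumes "x \<in> L" and "Q k F"
  shows "Q (k - w) (rdiff G x F)"
proof -
  have pow: "Q (k - w) (rdiff G (g [^] (a :: nat)) F)" if "Q k F" for a k F
    using that
  proof (induction a arbitrary: k F)
    case 0
    have "Q (k - w) (rdiff G \<one> F)"
      using Q_mono[OF Q_rdiff_H[OF 0, of \<one> k]] subgroup.one_closed[OF H]
        subgroup.one_closed[OF Phi_subgroup] by simp
    then show ?case by simp
  next
    case (Suc a)
    then show ?case
      using Q_rdiff_mult[OF _ g_carrier Suc.IH Q_rdiff_g, of k F] g_carrier by simp
  qed
  obtain a h where h: "h \<in> H" "x = g [^] (a :: nat) \<otimes> h"
    using L_cases assms(1) by blast
  have "Q (k - w) (rdiff G h F)" if "Q k F" for k F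
    using Q_rdiff_H[OF that, of h w] h(1) H_sub_L L_sub by auto
  then show ?thesis
    unfolding h(2) using g_carrier h(1) H_carrier assms(2) by (intro Q_rdiff_mult pow) auto
qed

lemma Q_imp_KL: "Q k F \<Longrightarrow> KH L k F"
proof (induction k arbitrary: F rule: less_induct)
  case (less k)
  show ?case
  proof (cases "k = 0")
    case True
    \<comment> \<open>F at \<open>g [^] i \<otimes> h\<close> is a combination of differences of
      order at most i at h; the bound on \<open>a + i\<close> keeps all orders below p, where
      \<open>Q\<close> applies.\<close>
    have *: "int p dvd (ldiff G g ^^ a) F (g [^] i \<otimes> h)" if "h \<in> H" "a + i < p" for a i :: nat and h
      using that(2)
    proof (induction i arbitrary: a)
      case 0
      then show ?case
        using less.prems that(1) True H_carrier by (auto simp: Q_def KH.K_0 Phi_0)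
    next
      case (Suc i)
      have "g [^] Suc i \<otimes> h = g \<otimes> (g [^] i \<otimes> h)"
        using that(1) g_carrier H_carrier nat_pow_Suc2[of g i] by (simp add: m_assoc)
      then have "(ldiff G g ^^ a) F (g [^] Suc i \<otimes> h)
          = (ldiff G g ^^ Suc a) F (g [^] i \<otimes> h) + (ldiff G g ^^ a) F (g [^] i \<otimes> h)"
        by (simp add: ldiff_apply)
      then show ?case using Suc.IH[of a] Suc.IH[of "Suc a"] Suc.prems by simp
    qed
    have "int p dvd F x" if "x \<in> L" for x
      using L_cases[OF that] *[of _ 0] by auto
    then show ?thesis using True by (simp add: KL.K_0)
  next
    case False
    have "KH L (k - v) (rdiff G h F)" if "v \<ge> 1" "h \<in> L \<inter> \<Phi> v" for v h
    proof (rule less.IH)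
      show "k - v < k" using that(1) False by simp
      show "Q (k - v) (rdiff G h F)"
      \<comment> \<open>Elements of weight at most w are only known to lie in L, where the degree
        drops by w; those of larger weight lie in H.\<close>
      proof (cases "v \<le> w")
        case True
        then show ?thesis
          using Q_mono[OF Q_rdiff_L[OF _ less.prems]] that(2) by simp
      next
        case False
        then have "\<Phi> v \<subseteq> H" using Phi_mono[of "Suc w" v] sub_H by auto
        then show ?thesis using Q_rdiff_H[OF less.prems] that(2) by blast
      qed
    qed
    then show ?thesis using False by (simp add: KL.K_pos)
  qed
qed

text \<open>
  Take \<open>F (g\<^sup>a h) = f h\<close> for \<open>0 \<le> a < p\<close>: then the left differences \<open>(g - 1)\<^sup>a F\<close> with \<open>0 < a < p\<close>
  vanish on \<open>H\<close>.
\<close>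

lemma extend:
  assumes "g \<notin> H" and "KH H k f"
  shows "\<exists>F. KH L k F \<and> (\<forall>h\<in>H. F h = f h)"
proof -
  define ex where "ex x = (LEAST a :: nat. inv (g [^] a) \<otimes> x \<in> H)" for x :: 'a
  define F where "F x = f (inv (g [^] ex x) \<otimes> x)" for x
  \<comment> \<open>d is invertible modulo p and \<open>g [^] p\<close> lies in H, so
    \<open>g [^] d\<close> in H would force g into H. Hence exponents below p are unique.\<close>
  have not_pow: "g [^] d \<notin> H" if "0 < d" "d < p" for d :: nat
  proof
    assume d: "g [^] d \<in> H"
    have "coprime d p"
      using that p_prime by (metis coprime_commute nat_dvd_not_less prime_imp_coprime)
    then obtain u v :: int where uv: "u * int d + v * int p = 1"
      using bezout_int[of "int d" "int p"] by auto
    have "g [^] (int d * u + int p * v) \<in> H"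
    proof -
      have "(g [^] d) [^] u \<in> H" "(g [^] p) [^] v \<in> H"
        using d g_pow_p H by (auto intro: subgroup_int_pow_closed)
      then have "g [^] (int d * u) \<otimes> g [^] (int p * v) \<in> H"
        using subgroup.m_closed[OF H] g_carrier by (simp add: int_pow_pow[symmetric] int_pow_int)
      then show ?thesis using g_carrier by (simp add: int_pow_mult)
    qed
    then have "g \<in> H" using uv g_carrier by (simp add: mult.commute)
    then show False using assms(1) by simp
  qed
  have ex: "ex (g [^] i \<otimes> h) = i" if "i < p" "h \<in> H" for i h
    unfolding ex_def
  proof (rule Least_equality)
    show "inv (g [^] i) \<otimes> (g [^] i \<otimes> h) \<in> H"
      using that g_carrier H_carrier by (simp add: inv_mult_cancel)
    fix a :: nat assume a: "inv (g [^] a) \<otimes> (g [^] i \<otimes> h) \<in> H"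
    show "i \<le> a"
    proof (rule ccontr)
      assume "\<not> i \<le> a"
      then have "g [^] i = g [^] a \<otimes> g [^] (i - a)"
        using g_carrier by (simp add: nat_pow_mult)
      then have "g [^] (i - a) \<otimes> h \<in> H"
        using a g_carrier that(2) H_carrier by (simp add: m_assoc inv_mult_cancel)
      then have "g [^] (i - a) \<otimes> h \<otimes> inv h \<in> H"
        using that(2) subgroup.m_closed[OF H] subgroup.m_inv_closed[OF H] by blast
      then have "g [^] (i - a) \<in> H"
        using g_carrier that(2) H_carrier by (simp add: m_assoc)
      then show False
        using not_pow[of "i - a"] \<open>\<not> i \<le> a\<close> that(1) by simp
    qed
  qed
  have F: "F (g [^] i \<otimes> h) = f h" if "i < p" "h \<in> H" for i h
    using ex[OF that] that g_carrier H_carrier by (simp add: F_def inv_mult_cancel)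
  have p0: "0 < p" using p_prime prime_gt_0_nat by blast
  have FH: "F h = f h" if "h \<in> H" for h
    using F[OF p0 that] H_carrier[OF that] by simp
  have zero: "(ldiff G g ^^ Suc a) F (g [^] i \<otimes> h) = 0" if "Suc a + i < p" "h \<in> H" for a i :: nat and h
    using that(1)
  proof (induction a arbitrary: i)
    case 0
    have "g \<otimes> (g [^] i \<otimes> h) = g [^] Suc i \<otimes> h"
      using that(2) g_carrier H_carrier nat_pow_Suc2[of g i] by (simp add: m_assoc)
    then show ?case using F[of "Suc i" h] F[of i h] that 0 by (simp add: ldiff_apply)
  next
    case (Suc a)
    have "g \<otimes> (g [^] i \<otimes> h) = g [^] Suc i \<otimes> h"
      using that(2) g_carrier H_carrier nat_pow_Suc2[of g i] by (simp add: m_assoc)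
    then have "(ldiff G g ^^ Suc (Suc a)) F (g [^] i \<otimes> h) =
        (ldiff G g ^^ Suc a) F (g [^] Suc i \<otimes> h) - (ldiff G g ^^ Suc a) F (g [^] i \<otimes> h)"
      by (simp add: ldiff_apply)
    then show ?case using Suc.IH[of i] Suc.IH[of "Suc i"] Suc.prems by (simp del: funpow.simps)
  qed
  have "Q k F"
    unfolding Q_def
  proof (intro allI impI)
    fix a assume a: "a < p"
    show "KH H (k - a * w) ((ldiff G g ^^ a) F)"
    proof (cases a)
      case 0
      then show ?thesis using KH.K_cong[OF assms(2), of F] FH by simp
    next
      case (Suc b)
      have "(ldiff G g ^^ a) F h = 0" if "h \<in> H" for h
        using zero[of b 0 h] that a Suc H_carrier by simp
      then show ?thesis by (intro KH.K_zero) auto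
    qed
  qed
  then show ?thesis using Q_imp_KL FH by blast
qed

end

section \<open>Climbing from the n-th level to the whole group\<close>

lemma (in group) finite_supergroups:
  assumes U: "subgroup U G" and fin: "finite (rcosets U)"
  shows "finite {H. subgroup H G \<and> U \<subseteq> H}"
proof (rule finite_subset)
  show "{H. subgroup H G \<and> U \<subseteq> H} \<subseteq> Union ` Pow (rcosets U)"
  proof clarify
    fix H assume H: "subgroup H G" "U \<subseteq> H"
    have "H = \<Union>((\<lambda>x. U #> x) ` H)"
    proof
      show "H \<subseteq> \<Union>((\<lambda>x. U #> x) ` H)"
        using rcos_self[OF _ U] subgroup.mem_carrier[OF H(1)] by blast
      show "\<Union>((\<lambda>x. U #> x) ` H) \<subseteq> H"
        using H subgroup.m_closed[OF H(1)] by (auto simp: r_coset_def)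
    qed
    moreover have "(\<lambda>x. U #> x) ` H \<in> Pow (rcosets U)"
      using subgroup.mem_carrier[OF H(1)] by (auto simp: RCOSETS_def)
    ultimately show "H \<in> Union ` Pow (rcosets U)" by blast
  qed
  show "finite (Union ` Pow (rcosets U))"
    using fin by simp
qed

context np_filtration
begin

text \<open>L consists of the products of powers of g with elements of H. It is a group since
  commutators of \<open>\<Phi> w\<close> lie in \<open>\<Phi> (w + w)\<close> and hence in H, and
  exponents reduce below p because \<open>g [^] p\<close> lies in H.\<close>

lemma cyclic_extension:
  assumes H: "subgroup H G" and w: "w \<ge> 1" "\<Phi> (Suc w) \<subseteq> H" "H \<subseteq> \<Phi> w" and g: "g \<in> \<Phi> w"
  obtains L where "subgroup L G" "H \<subseteq> L" "L \<subseteq> \<Phi> w" "g \<in> L"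
    "\<And>x. x \<in> L \<Longrightarrow> \<exists>a<p. \<exists>h\<in>H. x = g [^] (a :: nat) \<otimes> h"
proof -
  have gc: "g \<in> carrier G" using g Phi_carrier by blast
  note Hc = subgroup.mem_carrier[OF H] and Hm = subgroup.m_closed[OF H] and Hi = subgroup.m_inv_closed[OF H]
  have conj: "inv x \<otimes> h \<otimes> x \<in> H" if "h \<in> H" "x \<in> \<Phi> w" for x h
  proof -
    have "inv h \<otimes> inv x \<otimes> h \<otimes> x \<in> \<Phi> (w + w)"
      using Phi_comm that w(3) by blast
    moreover have "\<Phi> (w + w) \<subseteq> \<Phi> (Suc w)"
      using w(1) by (intro Phi_mono) simp
    ultimately show ?thesis
      using that w(2) conj_eq_mult_comm[of h x] Hc Phi_carrier Hm by auto
  qed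
  have gp: "g [^] p \<in> H"
  proof -
    have "2 * w \<le> p * w" using prime_ge_2_nat[OF p_prime] by (rule mult_le_mono1)
    then have "\<Phi> (p * w) \<subseteq> \<Phi> (Suc w)" using w(1) by (intro Phi_mono) linarith
    then show ?thesis using Phi_pow[OF g] w(2) by blast
  qed
  have gi: "g [^] (i :: int) \<in> \<Phi> w" for i
    using g Phi_subgroup by (rule subgroup_int_pow_closed[rotated])
  define L where "L = {g [^] (i :: int) \<otimes> h | i h. h \<in> H}"
  have HL: "h \<in> L" if "h \<in> H" for h
    unfolding L_def using that Hc by (intro CollectI exI[of _ 0] exI[of _ h]) simp
  have "g [^] (1::int) \<otimes> \<one> \<in> L"
    unfolding L_def using subgroup.one_closed[OF H] by blast
  then have gL: "g \<in> L" using gc by simp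
  have "subgroup L G"
  proof (rule subgroupI)
    show "L \<subseteq> carrier G" using Hc gc by (auto simp: L_def)
    show "L \<noteq> {}" using gL by blast
  next
    fix x assume "x \<in> L"
    then obtain i h where x: "h \<in> H" "x = g [^] (i :: int) \<otimes> h" by (auto simp: L_def)
    have "inv (g [^] (- i)) \<otimes> inv h \<otimes> g [^] (- i) \<in> H"
      using conj[OF Hi[OF x(1)] gi] .
    moreover have "inv x = g [^] (- i) \<otimes> (inv (g [^] (- i)) \<otimes> inv h \<otimes> g [^] (- i))"
      using x Hc gc by (simp add: group_simps int_pow_neg)
    ultimately show "inv x \<in> L" unfolding L_def by blast
  next
    fix x y assume "x \<in> L" "y \<in> L"
    then obtain i h j h' where x: "h \<in> H" "x = g [^] (i :: int) \<otimes> h"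
      and y: "h' \<in> H" "y = g [^] (j :: int) \<otimes> h'" by (auto simp: L_def)
    have "inv (g [^] j) \<otimes> h \<otimes> g [^] j \<otimes> h' \<in> H"
      using Hm[OF conj[OF x(1) gi] y(1)] .
    moreover have "x \<otimes> y = g [^] (i + j) \<otimes> (inv (g [^] j) \<otimes> h \<otimes> g [^] j \<otimes> h')"
      using x y Hc gc by (simp add: group_simps int_pow_mult)
    ultimately show "x \<otimes> y \<in> L" unfolding L_def by blast
  qed
  moreover have "L \<subseteq> \<Phi> w"
    using gi w(3) subgroup.m_closed[OF Phi_subgroup] by (auto simp: L_def)
  moreover have "\<exists>a<p. \<exists>h\<in>H. x = g [^] (a :: nat) \<otimes> h" if xL: "x \<in> L" for x
  proof -
    obtain i h where x: "h \<in> H" "x = g [^] (i :: int) \<otimes> h" using xL by (auto simp: L_def)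
    define a where "a = nat (i mod int p)"
    have p0: "p > 0" using p_prime prime_gt_0_nat by blast
    have i: "i = int a + int p * (i div int p)"
      using p0 by (simp add: a_def)
    have "(g [^] p) [^] (i div int p) \<in> H"
      using gp H by (rule subgroup_int_pow_closed[rotated])
    then have "(g [^] p) [^] (i div int p) \<otimes> h \<in> H" using x(1) Hm by blast
    moreover have "g [^] i = g [^] a \<otimes> (g [^] p) [^] (i div int p)"
      using gc by (subst i) (simp add: int_pow_mult int_pow_int flip: int_pow_pow)
    then have "x = g [^] a \<otimes> ((g [^] p) [^] (i div int p) \<otimes> h)"
      using x gc Hc by (simp add: m_assoc)
    moreover have "a < p" using p0 by (simp add: a_def nat_less_iff)
    ultimately show ?thesis by blast
  qed
  ultimately show thesis using that HL gL by blast
qed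

text \<open>The difference of \<open>\<psi>\<close> by h is the constant \<open>\<psi> h\<close>,
  and it vanishes modulo p for h of weight above n; so \<open>\<psi>\<close> has degree at most n on
  \<open>\<Phi> n\<close>. In each layer a maximal subgroup with an extension of degree at most n
  must be the top of the layer, as otherwise one more element can be adjoined.\<close>

lemma extend_hom_to_polynomial:
  assumes n: "n \<ge> 1" and fin: "finite (rcosets (\<Phi> n))"
    and hom: "\<And>x y. x \<in> \<Phi> n \<Longrightarrow> y \<in> \<Phi> n \<Longrightarrow> int p dvd \<psi> (x \<otimes> y) - \<psi> x - \<psi> y"
    and triv: "\<And>x. x \<in> \<Phi> (Suc n) \<Longrightarrow> int p dvd \<psi> x"
  shows "\<exists>f. deg_less p G \<Phi> (Suc n) f \<and> (\<forall>x\<in>\<Phi> n. f x = \<psi> x)"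
proof -
  \<comment> \<open>Only the values on \<open>\<Phi> n\<close> are prescribed, so extensions to
    different subgroups need not fit together.\<close>
  define P where "P H \<longleftrightarrow> (\<exists>f. KH H (Suc n) f \<and> (\<forall>x\<in>\<Phi> n. f x = \<psi> x))" for H
  have "P (\<Phi> w)" if "1 \<le> w" "w \<le> n" for w
    using that(2,1)
  proof (induction w rule: inc_induct)
    case base
    interpret F: filtration G "\<lambda>v. \<Phi> n \<inter> \<Phi> v" p by (rule restrict_filtration[OF Phi_subgroup])
    have "KH (\<Phi> n) (Suc n - v) (rdiff G h \<psi>)" if v: "v \<ge> 1" and h: "h \<in> \<Phi> n \<inter> \<Phi> v" for v h
    proof (rule F.K_cong_mod)
      have "int p dvd \<psi> h" if "n < v"
        using triv h Phi_mono[of "Suc n" v] that by auto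
      then show "KH (\<Phi> n) (Suc n - v) (\<lambda>_. \<psi> h)"
        by (cases "v \<le> n") (auto intro: F.K_const F.K_zero)
      show "int p dvd \<psi> h - rdiff G h \<psi> x" if "x \<in> \<Phi> n \<inter> \<Phi> 0" for x
        using hom[of x h] that h by (simp add: rdiff_def dvd_diff_commute algebra_simps)
    qed
    then show ?case by (auto simp: P_def F.K_pos)
  next
    case (step w)
    \<comment> \<open>These subgroups contain \<open>\<Phi> n\<close>, which has finite index, so
      they are finite in number and one of them is maximal.\<close>
    define \<H> where "\<H> = {H. subgroup H G \<and> \<Phi> (Suc w) \<subseteq> H \<and> H \<subseteq> \<Phi> w \<and> P H}"
    have "\<Phi> n \<subseteq> \<Phi> (Suc w)" using step by (intro Phi_mono) simp
    then have "\<H> \<subseteq> {H. subgroup H G \<and> \<Phi> n \<subseteq> H}" by (auto simp: \<H>_def)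
    then have "finite \<H>"
      using finite_supergroups[OF Phi_subgroup fin] by (rule finite_subset)
    moreover have "\<Phi> (Suc w) \<in> \<H>"
      using step Phi_subgroup Phi_Suc by (auto simp: \<H>_def)
    ultimately obtain H where max: "H \<in> \<H>" "\<And>H'. H' \<in> \<H> \<Longrightarrow> H \<subseteq> H' \<Longrightarrow> H = H'"
      using finite_has_maximal[of \<H>] by blast
    have "\<Phi> w \<subseteq> H"
    proof
      fix g assume g: "g \<in> \<Phi> w"
      show "g \<in> H"
      proof (rule ccontr)
        assume gH: "g \<notin> H"
        obtain L where L: "subgroup L G" "H \<subseteq> L" "L \<subseteq> \<Phi> w" "g \<in> L"
          "\<And>x. x \<in> L \<Longrightarrow> \<exists>a<p. \<exists>h\<in>H. x = g [^] (a :: nat) \<otimes> h"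
          using cyclic_extension[OF _ _ _ _ g] max(1) step by (auto simp: \<H>_def)
        interpret filtration_step G \<Phi> p H L g w
          using L max(1) step
          by (intro filtration_step.intro filtration_step_axioms.intro np_filtration_axioms)
            (auto simp: \<H>_def)
        obtain f where "KH H (Suc n) f" "\<forall>x\<in>\<Phi> n. f x = \<psi> x"
          using max(1) by (auto simp: \<H>_def P_def)
        moreover have "\<Phi> n \<subseteq> H"
          using \<open>\<Phi> n \<subseteq> \<Phi> (Suc w)\<close> max(1) by (auto simp: \<H>_def)
        ultimately have "P L"
          using extend[OF gH] unfolding P_def by (metis subsetD)
        then have "L \<in> \<H>"
          using \<open>subgroup L G\<close> \<open>H \<subseteq> L\<close> \<open>L \<subseteq> \<Phi> w\<close> max(1) by (auto simp: \<H>_def)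
        then show False using max(2) \<open>H \<subseteq> L\<close> \<open>g \<in> L\<close> gH by blast
      qed
    qed
    then have "H = \<Phi> w" using max(1) by (auto simp: \<H>_def)
    then show ?case using max(1) by (auto simp: \<H>_def)
  qed
  from this[of 1] n have "P (carrier G)" by (simp add: Phi_1[simplified])
  moreover have "(\<lambda>v. carrier G \<inter> \<Phi> v) = \<Phi>"
    using Phi_carrier by blast
  ultimately show ?thesis by (simp add: P_def)
qed

end

section \<open>Topological and profinite groups\<close>

locale top_group = group G for G (structure) +
  fixes T :: "'a topology"
  assumes topological: "topological_group G T"
begin

lemma topspace_eq: "topspace T = carrier G"
  using topological by (simp add: topological_group_def)

lemma continuous_mult:
  assumes "continuous_map X T f" "continuous_map X T g"
  shows "continuous_map X T (\<lambda>x. f x \<otimes> g x)"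
  using continuous_map_compose[OF continuous_map_pairedI[OF assms], of T "\<lambda>(x, y). x \<otimes> y"] topological
  by (simp add: topological_group_def o_def)

lemma continuous_inv:
  assumes "continuous_map X T f"
  shows "continuous_map X T (\<lambda>x. inv (f x))"
  using continuous_map_compose[OF assms, of T "\<lambda>x. inv x"] topological
  by (simp add: topological_group_def o_def)

lemma continuous_const: "a \<in> carrier G \<Longrightarrow> continuous_map X T (\<lambda>_. a)"
  by (simp add: topspace_eq)

lemmas continuous_group = continuous_mult continuous_inv continuous_const continuous_map_id[unfolded id_def]

lemma openin_translate:
  assumes "openin T U" and "a \<in> carrier G" and "b \<in> carrier G"
  shows "openin T {x \<in> carrier G. a \<otimes> x \<otimes> b \<in> U}"
  using openin_continuous_map_preimage[OF _ assms(1), of T "\<lambda>x. a \<otimes> x \<otimes> b"] assms(2,3)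
  by (simp add: continuous_group topspace_eq)

lemma open_subgroupI:
  assumes H: "subgroup H G" and U: "openin T U" "\<one> \<in> U" "U \<subseteq> H"
  shows "openin T H"
proof (subst openin_subopen, rule ballI)
  fix h assume h: "h \<in> H"
  then have hc: "h \<in> carrier G" using subgroup.mem_carrier[OF H] by blast
  let ?V = "{x \<in> carrier G. inv h \<otimes> x \<otimes> \<one> \<in> U}"
  have "?V \<subseteq> H"
  proof clarify
    fix x assume x: "x \<in> carrier G" "inv h \<otimes> x \<otimes> \<one> \<in> U"
    then have "h \<otimes> (inv h \<otimes> x) \<in> H"
      using U(3) h hc subgroup.m_closed[OF H] by auto
    then show "x \<in> H" using x hc by (simp add: mult_inv_cancel)
  qed
  moreover have "openin T ?V" using U(1) hc by (intro openin_translate) auto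
  moreover have "h \<in> ?V" using hc U(2) by simp
  ultimately show "\<exists>V. openin T V \<and> h \<in> V \<and> V \<subseteq> H" by blast
qed

lemma open_subgroup_closed:
  assumes H: "subgroup H G" and "openin T H"
  shows "closedin T H"
proof -
  have "openin T (carrier G - H)"
  proof (subst openin_subopen, rule ballI)
    fix x assume x: "x \<in> carrier G - H"
    let ?V = "{y \<in> carrier G. inv x \<otimes> y \<otimes> \<one> \<in> H}"
    have "?V \<subseteq> carrier G - H"
    proof clarify
      fix y assume y: "y \<in> carrier G" "inv x \<otimes> y \<otimes> \<one> \<in> H" "y \<in> H"
      have "y \<otimes> inv (inv x \<otimes> y) \<in> H"
        using subgroup.m_closed[OF H] subgroup.m_inv_closed[OF H] x y by simp
      then show False using x y by (simp add: group_simps)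
    qed
    moreover have "openin T ?V" using assms(2) x by (intro openin_translate) auto
    moreover have "x \<in> ?V" using x subgroup.one_closed[OF H] by simp
    ultimately show "\<exists>V. openin T V \<and> x \<in> V \<and> V \<subseteq> carrier G - H" by blast
  qed
  then show ?thesis
    using subgroup.subset[OF H] by (simp add: closedin_def topspace_eq)
qed

lemma closure_subgroup:
  assumes H: "subgroup H G"
  shows "subgroup (T closure_of H) G"
proof (rule subgroupI)
  have sub: "H \<subseteq> T closure_of H"
    using subgroup.subset[OF H] by (intro closure_of_subset) (simp add: topspace_eq)
  show c: "T closure_of H \<subseteq> carrier G"
    using closure_of_subset_topspace topspace_eq by metis
  show "T closure_of H \<noteq> {}" using sub subgroup.one_closed[OF H] by blast
  fix x assume x: "x \<in> T closure_of H"
  have "(\<lambda>x. inv x) ` (T closure_of H) \<subseteq> T closure_of ((\<lambda>x. inv x) ` H)"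
    by (rule continuous_map_image_closure_subset[where X = T]) (simp add: continuous_group)
  moreover have "T closure_of ((\<lambda>x. inv x) ` H) \<subseteq> T closure_of H"
    using subgroup.m_inv_closed[OF H] by (intro closure_of_mono) blast
  ultimately show "inv x \<in> T closure_of H" using x by blast
  fix y assume y: "y \<in> T closure_of H"
  have "(\<lambda>(x, y). x \<otimes> y) ` (prod_topology T T closure_of (H \<times> H))
      \<subseteq> T closure_of ((\<lambda>(x, y). x \<otimes> y) ` (H \<times> H))"
    using topological
    by (intro continuous_map_image_closure_subset) (simp add: topological_group_def)
  moreover have "T closure_of ((\<lambda>(x, y). x \<otimes> y) ` (H \<times> H)) \<subseteq> T closure_of H"
    using subgroup.m_closed[OF H] by (intro closure_of_mono) auto
  ultimately show "x \<otimes> y \<in> T closure_of H" using x y by (auto simp: closure_of_Times)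
qed

lemma closed_subgroup_generated_subgroup:
  "A \<subseteq> carrier G \<Longrightarrow> subgroup (closed_subgroup_generated G T A) G"
  unfolding closed_subgroup_generated_def by (intro closure_subgroup generate_is_subgroup)

lemma closedin_closed_subgroup_generated: "closedin T (closed_subgroup_generated G T A)"
  unfolding closed_subgroup_generated_def by simp

lemma closed_subgroup_generated_incl:
  assumes "A \<subseteq> carrier G" "x \<in> A"
  shows "x \<in> closed_subgroup_generated G T A"
proof -
  have "generate G A \<subseteq> T closure_of generate G A"
    using generate_incl[OF assms(1)] by (intro closure_of_subset) (simp add: topspace_eq)
  then show ?thesis
    using generate.incl[OF assms(2)] unfolding closed_subgroup_generated_def by blast
qed

lemma closed_subgroup_generated_minimal:
  assumes "subgroup H G" "closedin T H" "A \<subseteq> H"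
  shows "closed_subgroup_generated G T A \<subseteq> H"
  unfolding closed_subgroup_generated_def
  using generate_subgroup_incl[OF assms(3,1)] assms(2) by (rule closure_of_minimal)

end

section \<open>Open normal subgroups of profinite groups\<close>

locale profinite = top_group G T for G (structure) and T +
  assumes profinite: "profinite_group G T"
begin

lemma compact: "compact_space T" and Hausdorff: "Hausdorff_space T"
  using profinite by (auto simp: profinite_group_def)

text \<open>The elements that may be inserted anywhere without changing F form a normal subgroup.
  The tube lemma makes it open: inserting \<open>\<one>\<close> changes nothing on the compact space
  of all other arguments. Z holds a further argument of F, such as the second one of a
  2-cochain.\<close>

lemma open_normal_invariance:
  assumes F: "continuous_map (prod_topology T Z) (discrete_topology D) F" and Z: "compact_space Z"
  obtains W where "W \<lhd> G" "openin T W"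
    "\<And>g x y z. g \<in> W \<Longrightarrow> x \<in> carrier G \<Longrightarrow> y \<in> carrier G \<Longrightarrow> z \<in> topspace Z
      \<Longrightarrow> F (x \<otimes> g \<otimes> y, z) = F (x \<otimes> y, z)"
proof -
  define W where "W = {g \<in> carrier G. \<forall>x\<in>carrier G. \<forall>y\<in>carrier G. \<forall>z\<in>topspace Z.
      F (x \<otimes> g \<otimes> y, z) = F (x \<otimes> y, z)}"
  have W: "subgroup W G"
  proof (rule subgroupI)
    show "W \<subseteq> carrier G" by (auto simp: W_def)
    have "\<one> \<in> W" by (auto simp: W_def)
    then show "W \<noteq> {}" by blast
  next
    fix g assume g: "g \<in> W"
    then have gc: "g \<in> carrier G" by (simp add: W_def)
    have "F (x \<otimes> inv g \<otimes> y, z) = F (x \<otimes> y, z)"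
      if "x \<in> carrier G" "y \<in> carrier G" "z \<in> topspace Z" for x y z
    proof -
      have "F (x \<otimes> inv g \<otimes> g \<otimes> y, z) = F (x \<otimes> inv g \<otimes> y, z)"
        using g gc that by (simp add: W_def)
      then show ?thesis using gc that by (simp add: group_simps)
    qed
    then show "inv g \<in> W" using gc by (auto simp: W_def)
  next
    fix g h assume gh: "g \<in> W" "h \<in> W"
    then have c: "g \<in> carrier G" "h \<in> carrier G" by (auto simp: W_def)
    have "F (x \<otimes> (g \<otimes> h) \<otimes> y, z) = F (x \<otimes> y, z)"
      if "x \<in> carrier G" "y \<in> carrier G" "z \<in> topspace Z" for x y z
    proof -
      have "F (x \<otimes> g \<otimes> (h \<otimes> y), z) = F (x \<otimes> (h \<otimes> y), z)"
        using gh(1) c that by (simp add: W_def)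
      also have "x \<otimes> (h \<otimes> y) = x \<otimes> h \<otimes> y" using c that by (simp add: m_assoc)
      also have "F (x \<otimes> h \<otimes> y, z) = F (x \<otimes> y, z)"
        using gh(2) c that by (simp add: W_def)
      finally show ?thesis using c that by (simp add: m_assoc)
    qed
    then show "g \<otimes> h \<in> W" using c by (auto simp: W_def)
  qed
  have "W \<lhd> G"
  proof (rule normal_invI[OF W])
    fix a g assume a: "a \<in> carrier G" and g: "g \<in> W"
    then have gc: "g \<in> carrier G" by (simp add: W_def)
    have "F (x \<otimes> (a \<otimes> g \<otimes> inv a) \<otimes> y, z) = F (x \<otimes> y, z)"
      if "x \<in> carrier G" "y \<in> carrier G" "z \<in> topspace Z" for x y z
    proof -
      have "F ((x \<otimes> a) \<otimes> g \<otimes> (inv a \<otimes> y), z) = F (x \<otimes> a \<otimes> (inv a \<otimes> y), z)"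
        using g a that by (simp add: W_def)
      then show ?thesis using a gc that by (simp add: group_simps)
    qed
    then show "a \<otimes> g \<otimes> inv a \<in> W" using a gc by (auto simp: W_def)
  qed
  moreover have "openin T W"
  proof -
    let ?P = "prod_topology (prod_topology T T) Z"
    define h1 h2 where "h1 = (\<lambda>(((x, y), z), g). F (x \<otimes> g \<otimes> y, z))"
      and "h2 = (\<lambda>(((x, y), z), g :: 'a). F (x \<otimes> y, z))"
    have 1: "continuous_map (prod_topology ?P T) ?P fst" "continuous_map ?P (prod_topology T T) fst"
      by (rule continuous_map_fst)+
    have "continuous_map ?P Z snd" by (rule continuous_map_snd)
    note 2 = continuous_map_compose[OF 1] continuous_map_compose[OF 1(1) this]
    have proj: "continuous_map (prod_topology ?P T) T (\<lambda>q. fst (fst (fst q)))"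
      "continuous_map (prod_topology ?P T) T (\<lambda>q. snd (fst (fst q)))"
      "continuous_map (prod_topology ?P T) Z (\<lambda>q. snd (fst q))"
      "continuous_map (prod_topology ?P T) T (\<lambda>q. snd q)"
      using continuous_map_compose[OF 2(1) continuous_map_fst]
        continuous_map_compose[OF 2(1) continuous_map_snd] 2(2) continuous_map_snd
      by (simp_all add: o_def)
    have "continuous_map (prod_topology ?P T) (discrete_topology D)
        (F \<circ> (\<lambda>q. (fst (fst (fst q)) \<otimes> snd q \<otimes> snd (fst (fst q)), snd (fst q))))"
      by (intro continuous_map_compose[OF _ F] continuous_map_pairedI continuous_mult proj)
    moreover have "continuous_map (prod_topology ?P T) (discrete_topology D)
        (F \<circ> (\<lambda>q. (fst (fst (fst q)) \<otimes> snd (fst (fst q)), snd (fst q))))"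
      by (intro continuous_map_compose[OF _ F] continuous_map_pairedI continuous_mult proj)
    ultimately have "continuous_map (prod_topology ?P T)
        (prod_topology (discrete_topology D) (discrete_topology D)) (\<lambda>q. (h1 q, h2 q))"
      by (intro continuous_map_pairedI) (simp_all add: o_def h1_def h2_def case_prod_beta)
    \<comment> \<open>F takes discrete values, so the set where the two values agree is
      open.\<close>
    then have "openin (prod_topology ?P T)
        {q \<in> topspace (prod_topology ?P T). (h1 q, h2 q) \<in> {(d, d) | d. d \<in> D}}"
      by (rule openin_continuous_map_preimage)
        (auto simp flip: prod_topology_discrete_topology)
    then have op: "openin (prod_topology ?P T)
        {q \<in> topspace (prod_topology ?P T). h1 q = h2 q \<and> h1 q \<in> D}" (is "openin _ ?Q")
      by (rule back_subst[where P = "openin _"]) auto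
    have FD: "F q \<in> D" if "q \<in> carrier G \<times> topspace Z" for q
      using continuous_map_image_subset_topspace[OF F] that by (auto simp: topspace_eq)
    have "compactin ?P (topspace ?P)"
      unfolding compact_space_def[symmetric] compact_space_prod_topology using compact Z by simp
    moreover have "topspace ?P \<times> {\<one>} \<subseteq> ?Q"
      using FD by (auto simp: h1_def h2_def topspace_eq)
    moreover have "\<one> \<in> topspace T" by (simp add: topspace_eq)
    ultimately obtain U V where V: "openin T V" "\<one> \<in> V" and UV: "topspace ?P \<subseteq> U" "U \<times> V \<subseteq> ?Q"
      using tube_lemma_left[OF op, of "topspace ?P" \<one>] by auto
    have VQ: "topspace ?P \<times> V \<subseteq> ?Q" using UV by blast
    have "V \<subseteq> W"
    proof
      fix g assume g: "g \<in> V"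
      have "F (x \<otimes> g \<otimes> y, z) = F (x \<otimes> y, z)"
        if "x \<in> carrier G" "y \<in> carrier G" "z \<in> topspace Z" for x y z
      proof -
        have "(((x, y), z), g) \<in> ?Q" using VQ g that topspace_eq by auto
        then show ?thesis by (simp add: h1_def h2_def)
      qed
      then show "g \<in> W"
        using g openin_subset[OF V(1)] topspace_eq by (auto simp: W_def)
    qed
    then show ?thesis using open_subgroupI[OF W V(1,2)] by blast
  qed
  ultimately show thesis using that by (auto simp: W_def)
qed

text \<open>Compactness and total disconnectedness provide a clopen set C that contains
  \<open>\<one>\<close> and lies in U, by the cut wire fence theorem; a normal subgroup whose
  elements leave membership in C unchanged lies in C.\<close>

lemma open_normal_subset:
  assumes U: "openin T U" "\<one> \<in> U"
  obtains W where "W \<lhd> G" "openin T W" "W \<subseteq> U"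
proof -
  have "separated_between T {\<one>} (topspace T - U)"
  proof (rule cut_wire_fence_theorem_gen)
    show "disjnt C {\<one>} \<or> disjnt C (topspace T - U)" if "connectedin T C" for C
      using that profinite U(2) unfolding profinite_group_def disjnt_def by blast
    show "closedin T (topspace T - U)" using U(1) by blast
  qed (use compact Hausdorff topspace_eq in auto)
  then obtain C D where C: "openin T C" "openin T D" "C \<union> D = topspace T" "disjnt C D" "\<one> \<in> C"
    "topspace T - U \<subseteq> D"
    by (auto simp: separated_between_def)
  have "continuous_map T (discrete_topology UNIV) (\<lambda>x. x \<in> C)"
  proof -
    have "C = {x \<in> topspace T. x \<in> C}" "D = {x \<in> topspace T. x \<notin> C}"
      using C(3,4) by (auto simp: disjnt_iff)
    then have "openin T {x \<in> topspace T. x \<in> C}" "openin T {x \<in> topspace T. x \<notin> C}"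
      using C(1,2) by simp_all
    moreover have "{x \<in> topspace T. (x \<in> C) \<in> B} =
        (if True \<in> B then {x \<in> topspace T. x \<in> C} else {}) \<union>
        (if False \<in> B then {x \<in> topspace T. x \<notin> C} else {})" for B
      by (auto split: if_splits) (metis (full_types))+
    ultimately have "openin T {x \<in> topspace T. (x \<in> C) \<in> B}" for B
      by auto
    then show ?thesis by (simp add: continuous_map_def)
  qed
  from continuous_map_compose[OF continuous_map_fst this]
  have cont: "continuous_map (prod_topology T T) (discrete_topology UNIV) (\<lambda>q. fst q \<in> C)"
    unfolding o_def .
  obtain W where W: "W \<lhd> G" "openin T W"
    and inv: "\<And>g x y z. g \<in> W \<Longrightarrow> x \<in> carrier G \<Longrightarrow> y \<in> carrier G \<Longrightarrow> z \<in> topspace T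
      \<Longrightarrow> (fst (x \<otimes> g \<otimes> y, z) \<in> C) = (fst (x \<otimes> y, z) \<in> C)"
    using open_normal_invariance[OF cont compact] by metis
  have "W \<subseteq> U"
  proof
    fix g assume g: "g \<in> W"
    then have gc: "g \<in> carrier G" using openin_subset[OF W(2)] topspace_eq by blast
    have "g \<in> C" using inv[OF g, of \<one> \<one> \<one>] gc C(5) topspace_eq by simp
    then show "g \<in> U" using C(4,6) gc topspace_eq by (auto simp: disjnt_iff)
  qed
  then show thesis using that W by simp
qed

lemma finite_rcosets:
  assumes W: "subgroup W G" and op: "openin T W"
  shows "finite (rcosets W)"
proof -
  have "openin T (W #> x)" if x: "x \<in> carrier G" for x
  proof -
    have "W #> x = {y \<in> carrier G. \<one> \<otimes> y \<otimes> inv x \<in> W}"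
    proof (intro equalityI subsetI)
      fix y assume "y \<in> W #> x"
      then show "y \<in> {y \<in> carrier G. \<one> \<otimes> y \<otimes> inv x \<in> W}"
        using x subgroup.mem_carrier[OF W] by (auto simp: r_coset_def group_simps)
    next
      fix y assume y: "y \<in> {y \<in> carrier G. \<one> \<otimes> y \<otimes> inv x \<in> W}"
      then have "y = y \<otimes> inv x \<otimes> x" using x by (simp add: group_simps)
      then show "y \<in> W #> x" using y unfolding r_coset_def by force
    qed
    then show ?thesis using openin_translate[OF op one_closed inv_closed[OF x]] by simp
  qed
  then have "\<forall>U\<in>rcosets W. openin T U" by (auto simp: RCOSETS_def)
  moreover have "topspace T \<subseteq> \<Union>(rcosets W)"
    using rcosets_part_G[OF W] topspace_eq by simp
  ultimately obtain \<F> where \<F>: "finite \<F>" "\<F> \<subseteq> rcosets W" "topspace T \<subseteq> \<Union>\<F>"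
    using compact by (auto simp: compact_space_alt)
  have "rcosets W \<subseteq> \<F>"
  proof
    fix A assume A: "A \<in> rcosets W"
    then obtain x where x: "x \<in> A" "x \<in> carrier G"
      using rcos_self[OF _ W] by (auto simp: RCOSETS_def)
    then obtain B where B: "B \<in> \<F>" "x \<in> B" using \<F>(3) topspace_eq by blast
    then have "A = B" using rcos_disjoint[OF W] A x \<F>(2) unfolding pairwise_def disjnt_iff by blast
    then show "A \<in> \<F>" using B by simp
  qed
  then show ?thesis using \<F>(1) by (rule finite_subset)
qed

end

text \<open>Every element has weight 1 and none a higher one, so that \<open>deg_less\<close>
  becomes the ordinary degree: f has degree less than k iff all its k-fold differences vanish modulo
  p.\<close>

definition lower_filtration :: "('a, 'm) monoid_scheme \<Rightarrow> nat \<Rightarrow> 'a set" where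
  "lower_filtration G v = (if v \<le> 1 then carrier G else {})"

section \<open>Elements that lower the degree\<close>

context group
begin

lemma filtration_lower: "filtration G (lower_filtration G)"
  by (intro filtration.intro filtration_axioms.intro is_group)
    (auto simp: lower_filtration_def subgroup_self)

text \<open>Inversion exchanges right and left differences, so the binomial argument for (g - 1)^p
  carries over.\<close>

lemma rdiff_pow_eq_ldiff_pow:
  assumes "x \<in> carrier G" "z \<in> carrier G"
  shows "(rdiff G x ^^ a) F z = (ldiff G (inv x) ^^ a) (\<lambda>y. F (inv y)) (inv z)"
  using assms(2)
proof (induction a arbitrary: z)
  case 0
  then show ?case by simp
next
  case (Suc a)
  have "(rdiff G x ^^ Suc a) F z = (rdiff G x ^^ a) F (z \<otimes> x) - (rdiff G x ^^ a) F z"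
    by (simp add: rdiff_apply)
  also have "\<dots> = (ldiff G (inv x) ^^ a) (\<lambda>y. F (inv y)) (inv x \<otimes> inv z)
      - (ldiff G (inv x) ^^ a) (\<lambda>y. F (inv y)) (inv z)"
    using Suc.IH[of z] Suc.IH[of "z \<otimes> x"] Suc.prems assms by (simp add: inv_mult_group)
  also have "\<dots> = (ldiff G (inv x) ^^ Suc a) (\<lambda>y. F (inv y)) (inv z)"
    by (simp add: ldiff_apply)
  finally show ?case .
qed

lemma rdiff_pow_prime:
  assumes "x \<in> carrier G" "z \<in> carrier G" "prime p"
  shows "int p dvd (rdiff G x ^^ p) F z - rdiff G (x [^] p) F z"
  using ldiff_pow_prime[of "inv x" "inv z" p "\<lambda>y. F (inv y)"] assms
  by (simp add: rdiff_pow_eq_ldiff_pow rdiff_apply inv_mult_group nat_pow_inv)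

end

text \<open>
  The elements that lower the degree of all functions in \<open>\<F>\<close> by \<open>a\<close> satisfy the defining closure
  properties of the Zassenhaus filtration, as \<open>(x - 1)\<^sup>p \<equiv> x\<^sup>p - 1\<close> modulo \<open>p\<close>.
\<close>

locale difference_filtration = group G for G (structure) +
  fixes p :: nat and \<F> :: "('a \<Rightarrow> int) set"
  assumes p: "prime p"
    and \<F>_rdiff: "f \<in> \<F> \<Longrightarrow> y \<in> carrier G \<Longrightarrow> rdiff G y f \<in> \<F>"
begin

sublocale filtration G "lower_filtration G" p
  by (rule filtration_lower)

definition D :: "nat \<Rightarrow> 'a set" where
  "D a = {x \<in> carrier G. \<forall>f\<in>\<F>. \<forall>m. K m f \<longrightarrow> K (m - a) (rdiff G x f)}"

lemma lower_0: "lower_filtration G 0 = carrier G" "lower_filtration G 1 = carrier G"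
  by (simp_all add: lower_filtration_def)

lemma D_carrier: "x \<in> D a \<Longrightarrow> x \<in> carrier G"
  by (simp add: D_def)

lemma D_rdiff: "x \<in> D a \<Longrightarrow> f \<in> \<F> \<Longrightarrow> K m f \<Longrightarrow> K (m - a) (rdiff G x f)"
  by (simp add: D_def)

lemma D_1: "D 1 = carrier G"
  using K_rdiff[of _ _ _ 1] lower_0 by (auto simp: D_def)

lemma D_antimono: "a \<le> b \<Longrightarrow> D b \<subseteq> D a"
  unfolding D_def using K_mono diff_le_mono2 by blast

lemma D_subgroup: "subgroup (D a) G"
proof (rule subgroupI)
  show "D a \<subseteq> carrier G" using D_carrier by blast
  have "\<one> \<in> D a"
    by (auto simp: D_def rdiff_def lower_0 intro!: K_zero)
  then show "D a \<noteq> {}" by blast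
next
  fix x assume x: "x \<in> D a"
  then have xc: "x \<in> carrier G" by (rule D_carrier)
  have "K (m - a) (rdiff G (inv x) f)" if "f \<in> \<F>" "K m f" for f m
  proof (rule K_cong)
    show "K (m - a) (\<lambda>z. - 1 * rdiff G x f (z \<otimes> inv x))"
      using K_scale[OF K_right[OF D_rdiff[OF x that]], of "inv x" "- 1"] xc lower_0 by simp
    show "- 1 * rdiff G x f (z \<otimes> inv x) = rdiff G (inv x) f z" if "z \<in> lower_filtration G 0" for z
      using that xc lower_0 by (simp add: rdiff_apply group_simps)
  qed
  then show "inv x \<in> D a" using xc by (auto simp: D_def)
next
  fix x y assume x: "x \<in> D a" and y: "y \<in> D a"
  then have c: "x \<in> carrier G" "y \<in> carrier G" by (auto dest: D_carrier)
  have "K (m - a) (rdiff G (x \<otimes> y) f)" if f: "f \<in> \<F>" "K m f" for f m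
  proof (rule K_cong)
    have "K (m - a - a) (rdiff G x (rdiff G y f))"
      using D_rdiff[OF x \<F>_rdiff D_rdiff[OF y f]] f c by simp
    then have "K (m - a) (rdiff G x (rdiff G y f))"
      by (rule K_mono) simp
    then show "K (m - a) (\<lambda>z. rdiff G x (rdiff G y f) z + rdiff G y f z + rdiff G x f z)"
      using D_rdiff[OF x f] D_rdiff[OF y f] by (intro K_add)
    show "rdiff G x (rdiff G y f) z + rdiff G y f z + rdiff G x f z = rdiff G (x \<otimes> y) f z"
      if "z \<in> lower_filtration G 0" for z
      using that c lower_0 by (simp add: rdiff_apply m_assoc)
  qed
  then show "x \<otimes> y \<in> D a" using c by (auto simp: D_def)
qed

text \<open>In the group ring, [x, y] - 1 = (y x)^(-1) ((x - 1)(y - 1) - (y - 1)(x - 1)), and both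
  products lower the degree by a + b. The family \<open>\<F>\<close> is closed under differences, so
  the two steps can be composed.\<close>

lemma D_comm:
  assumes x: "x \<in> D a" and y: "y \<in> D b"
  shows "inv x \<otimes> inv y \<otimes> x \<otimes> y \<in> D (a + b)"
proof -
  let ?c = "inv x \<otimes> inv y \<otimes> x \<otimes> y"
  have c: "x \<in> carrier G" "y \<in> carrier G" using x y by (auto dest: D_carrier)
  have "K (m - (a + b)) (rdiff G ?c f)" if f: "f \<in> \<F>" "K m f" for f m
  proof (rule K_cong)
    let ?d = "\<lambda>z. rdiff G x (rdiff G y f) z - rdiff G y (rdiff G x f) z"
    have "K (m - (a + b)) ?d"
      using D_rdiff[OF x \<F>_rdiff D_rdiff[OF y f]] D_rdiff[OF y \<F>_rdiff D_rdiff[OF x f]] f c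
      by (intro K_diff) (simp_all add: add.commute)
    then show "K (m - (a + b)) (\<lambda>z. ?d (z \<otimes> inv (y \<otimes> x)))"
      by (rule K_right) (use c lower_0 in simp)
    show "?d (z \<otimes> inv (y \<otimes> x)) = rdiff G ?c f z" if "z \<in> lower_filtration G 0" for z
      using that c lower_0 by (simp add: rdiff_apply group_simps)
  qed
  then show ?thesis using c by (auto simp: D_def)
qed

lemma D_pow:
  assumes x: "x \<in> D a" and "b \<le> p * a"
  shows "x [^] p \<in> D b"
proof -
  have c: "x \<in> carrier G" using x by (rule D_carrier)
  have "K (m - p * a) (rdiff G (x [^] p) f)" if f: "f \<in> \<F>" "K m f" for f m
  proof (rule K_cong_mod)
    have "K (m - i * a) ((rdiff G x ^^ i) f) \<and> (rdiff G x ^^ i) f \<in> \<F>" for i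
    proof (induction i)
      case (Suc i)
      then show ?case
        using D_rdiff[OF x, of "(rdiff G x ^^ i) f" "m - i * a"] \<F>_rdiff c by (simp add: add.commute)
    qed (use f in simp)
    then show "K (m - p * a) ((rdiff G x ^^ p) f)" by blast
    show "int p dvd (rdiff G x ^^ p) f z - rdiff G (x [^] p) f z" if "z \<in> lower_filtration G 0" for z
      using that c lower_0 p by (simp add: rdiff_pow_prime)
  qed
  then have "x [^] p \<in> D (p * a)" using c by (auto simp: D_def)
  then show ?thesis using D_antimono[OF assms(2)] by blast
qed

end

section \<open>Reduction modulo a normal subgroup\<close>

lemma (in group) subgroup_mod:
  assumes "W \<lhd> G" and M: "subgroup M G"
  shows "subgroup {x \<in> carrier G. \<exists>s\<in>M. W #> x = W #> s} G" (is "subgroup ?P G")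
proof -
  interpret W: normal W G by (rule assms(1))
  interpret h: group_hom G "G Mod W" "\<lambda>x. W #> x"
    using W.r_coset_hom_Mod W.factorgroup_is_group is_group
    by (simp add: group_hom_def group_hom_axioms_def)
  show ?thesis
  proof (rule subgroupI)
    show "?P \<noteq> {}"
      using subgroup.one_closed[OF M] by blast
    fix x assume "x \<in> ?P"
    then obtain s where x: "x \<in> carrier G" "s \<in> M" "W #> x = W #> s" by blast
    have "W #> inv x = W #> inv s"
      using x subgroup.mem_carrier[OF M] h.hom_inv by metis
    then show "inv x \<in> ?P"
      using x subgroup.m_inv_closed[OF M] by blast
    fix y assume "y \<in> ?P"
    then obtain t where y: "y \<in> carrier G" "t \<in> M" "W #> y = W #> t" by blast
    have "W #> (x \<otimes> y) = W #> (s \<otimes> t)"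
      using x y subgroup.mem_carrier[OF M] h.hom_mult by metis
    then show "x \<otimes> y \<in> ?P"
      using x y subgroup.m_closed[OF M] by blast
  qed auto
qed

text \<open>The image of the filtration in G / W, pulled back to G. Its levels contain W, so in a
  profinite group they are open and of finite index once W is open, while all functions still live
  on G.\<close>

lemma (in np_filtration) np_filtration_mod:
  assumes "W \<lhd> G"
  shows "np_filtration G (\<lambda>v. {x \<in> carrier G. \<exists>s\<in>\<Phi> v. W #> x = W #> s}) p"
proof -
  interpret W: normal W G by (rule assms)
  have hom: "group_hom G (G Mod W) (\<lambda>x. W #> x)"
    using W.r_coset_hom_Mod W.factorgroup_is_group is_group
    by (simp add: group_hom_def group_hom_axioms_def)
  interpret h: group_hom G "G Mod W" "\<lambda>x. W #> x" by (rule hom)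
  note hs = h.hom_mult[simplified] h.hom_inv h.hom_nat_pow
  show ?thesis
  proof (intro np_filtration.intro np_filtration_axioms.intro is_group)
    fix v
    show "subgroup {x \<in> carrier G. \<exists>s\<in>\<Phi> v. W #> x = W #> s} G"
      using assms Phi_subgroup by (rule subgroup_mod)
    show "{x \<in> carrier G. \<exists>s\<in>\<Phi> (Suc v). W #> x = W #> s} \<subseteq> {x \<in> carrier G. \<exists>s\<in>\<Phi> v. W #> x = W #> s}"
      using Phi_Suc by blast
    fix x assume "x \<in> {x \<in> carrier G. \<exists>s\<in>\<Phi> v. W #> x = W #> s}"
    then obtain s where x: "x \<in> carrier G" "s \<in> \<Phi> v" "W #> x = W #> s" by blast
    then have s: "s \<in> carrier G" using Phi_carrier by blast
    have "W #> x [^] p = W #> s [^] p"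
      using h.hom_nat_pow x s by metis
    then show "x [^] p \<in> {x \<in> carrier G. \<exists>s\<in>\<Phi> (p * v). W #> x = W #> s}"
      using Phi_pow[OF x(2)] x(1) by blast
    fix y w assume "y \<in> {x \<in> carrier G. \<exists>s\<in>\<Phi> w. W #> x = W #> s}"
    then obtain t where y: "y \<in> carrier G" "t \<in> \<Phi> w" "W #> y = W #> t" by blast
    then have t: "t \<in> carrier G" using Phi_carrier by blast
    have "W #> (inv x \<otimes> inv y \<otimes> x \<otimes> y) = W #> (inv s \<otimes> inv t \<otimes> s \<otimes> t)"
      using x(1,3) y(1,3) s t h.hom_mult h.hom_inv by simp
    then show "inv x \<otimes> inv y \<otimes> x \<otimes> y \<in> {x \<in> carrier G. \<exists>s\<in>\<Phi> (v + w). W #> x = W #> s}"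
      using Phi_comm[OF x(2) y(2)] x(1) y(1) by blast
  qed (auto simp: Phi_0 Phi_1[simplified] p_prime)
qed

text \<open>Modulo p, \<open>\<psi>\<close> depends on s only up to \<open>W \<inter> M\<close>, so
  it passes to the image of M in G / W; \<open>\<psi>'\<close> is the pullback, defined through a
  choice of representatives.\<close>

lemma (in group) hom_factor_mod:
  assumes "W \<lhd> G" and M: "subgroup M G"
    and hom: "\<And>x y. x \<in> M \<Longrightarrow> y \<in> M \<Longrightarrow> int p dvd \<psi> (x \<otimes> y) - \<psi> x - \<psi> y"
    and inv: "\<And>x. x \<in> W \<inter> M \<Longrightarrow> int p dvd \<psi> x"
  shows "\<exists>\<psi>'. \<forall>x. \<forall>s\<in>M. W #> x = W #> s \<longrightarrow> int p dvd \<psi>' x - \<psi> s"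
proof -
  interpret W: normal W G by (rule assms(1))
  define \<psi>' where "\<psi>' x = \<psi> (SOME s. s \<in> M \<and> W #> x = W #> s)" for x
  have eq: "int p dvd \<psi>' x - \<psi> s" if s: "s \<in> M" "W #> x = W #> s" for x s
  proof -
    define t where "t = (SOME s. s \<in> M \<and> W #> x = W #> s)"
    have t: "t \<in> M \<and> W #> x = W #> t"
      unfolding t_def by (rule someI[of _ s]) (use s in simp)
    have c: "s \<in> carrier G" "t \<in> carrier G"
      using s t subgroup.mem_carrier[OF M] by auto
    have "t \<otimes> inv s \<in> W"
      using t s c W.rcos_module_imp[OF is_group c(1), of t] rcos_self[OF c(2) W.subgroup_axioms] by simp
    moreover have "t \<otimes> inv s \<in> M"
      using t s by (auto intro: subgroup.m_closed[OF M] subgroup.m_inv_closed[OF M])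
    ultimately have "int p dvd \<psi> (t \<otimes> inv s)" "int p dvd \<psi> (t \<otimes> inv s \<otimes> s) - \<psi> (t \<otimes> inv s) - \<psi> s"
      using inv hom s by auto
    then have "int p dvd \<psi> (t \<otimes> inv s) + (\<psi> (t \<otimes> inv s \<otimes> s) - \<psi> (t \<otimes> inv s) - \<psi> s)"
      by (rule dvd_add)
    then show ?thesis using c by (simp add: \<psi>'_def t_def[symmetric] group_simps)
  qed
  then show ?thesis by blast
qed

text \<open>Moving w past y replaces it by a conjugate, which is again in W.\<close>

lemma (in group) rdiff_invariant_mod:
  assumes "W \<lhd> G"
    and inv: "\<And>x w. x \<in> carrier G \<Longrightarrow> w \<in> W \<Longrightarrow> int p dvd f (x \<otimes> w) - f x"
    and y: "y \<in> carrier G" and x: "x \<in> carrier G" and w: "w \<in> W"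
  shows "int p dvd rdiff G y f (x \<otimes> w) - rdiff G y f x"
proof -
  interpret W: normal W G by (rule assms(1))
  have "x \<otimes> w \<otimes> y = x \<otimes> y \<otimes> (inv y \<otimes> w \<otimes> y)"
    using x y W.mem_carrier[OF w] by (simp add: group_simps)
  moreover have "int p dvd f (x \<otimes> y \<otimes> (inv y \<otimes> w \<otimes> y)) - f (x \<otimes> y)"
    using inv x y W.inv_op_closed1[OF y w] by simp
  moreover have "int p dvd f (x \<otimes> w) - f x" using inv x w by simp
  ultimately have "int p dvd (f (x \<otimes> w \<otimes> y) - f (x \<otimes> y)) - (f (x \<otimes> w) - f x)"
    using dvd_diff by metis
  then show ?thesis by (simp add: rdiff_apply algebra_simps)
qed

section \<open>The Zassenhaus filtration\<close>

lemma nat_ceiling_divide: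
  assumes "n \<ge> 2" "p \<ge> 2"
  shows "1 \<le> nat \<lceil>real n / real p\<rceil>" "nat \<lceil>real n / real p\<rceil> < n"
    "n \<le> p * nat \<lceil>real n / real p\<rceil>" "\<And>i. n \<le> p * i \<Longrightarrow> nat \<lceil>real n / real p\<rceil> \<le> i"
proof -
  show *: "nat \<lceil>real n / real p\<rceil> \<le> i" if "n \<le> p * i" for i
  proof -
    have "real n \<le> real p * real i" using that by (metis of_nat_le_iff of_nat_mult)
    then have "real n / real p \<le> real i" using assms by (simp add: field_simps)
    then show ?thesis by (simp add: ceiling_le_iff)
  qed
  have "2 * (n - 1) \<le> p * (n - 1)" using assms by simp
  then have "n \<le> p * (n - 1)" using assms by linarith
  then show "nat \<lceil>real n / real p\<rceil> < n" using *[of "n - 1"] assms by linarith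
  have "real n / real p \<le> real (nat \<lceil>real n / real p\<rceil>)"
    by (rule real_nat_ceiling_ge)
  then have "real n \<le> real p * real (nat \<lceil>real n / real p\<rceil>)"
    using assms by (simp only: pos_divide_le_eq mult.commute of_nat_0_less_iff)
  then show le: "n \<le> p * nat \<lceil>real n / real p\<rceil>"
    by (metis of_nat_le_iff of_nat_mult)
  show "1 \<le> nat \<lceil>real n / real p\<rceil>"
    using le assms by (cases "nat \<lceil>real n / real p\<rceil>") auto
qed

locale profinite_prime = profinite G T for G (structure) and T +
  fixes p :: nat
  assumes p: "prime p"
begin

abbreviation "Z \<equiv> zassenhaus p G T"

lemma p2: "p \<ge> 2" using p by (rule prime_ge_2_nat)

lemma Z_le_1: "n \<le> 1 \<Longrightarrow> Z n = carrier G"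
  by (subst zassenhaus.simps) simp

definition Z_gens :: "nat \<Rightarrow> 'a set" where
  "Z_gens n = (\<lambda>x. x [^] p) ` Z (nat \<lceil>real n / real p\<rceil>) \<union>
     (\<Union>i\<in>{1..<n}. \<Union>x\<in>Z i. (\<lambda>y. inv x \<otimes> inv y \<otimes> x \<otimes> y) ` Z (n - i))"

lemma Z_ge_2: "n \<ge> 2 \<Longrightarrow> Z n = closed_subgroup_generated G T (Z_gens n)"
  unfolding Z_gens_def using p2 by (subst zassenhaus.simps) simp

lemma Z_subset: "Z n \<subseteq> carrier G"
proof (cases "n \<le> 1")
  case False
  then show ?thesis
    using Z_ge_2[of n] closure_of_subset_topspace[of T] topspace_eq
    by (simp add: closed_subgroup_generated_def)
qed (simp add: Z_le_1)

lemma Z_carrier: "x \<in> Z n \<Longrightarrow> x \<in> carrier G"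
  using Z_subset by blast

lemma Z_gens_subset: "Z_gens n \<subseteq> carrier G"
  using Z_carrier by (auto simp: Z_gens_def)

lemma Z_subgroup: "subgroup (Z n) G"
  using closed_subgroup_generated_subgroup[OF Z_gens_subset] Z_ge_2 Z_le_1 subgroup_self
  by (cases "n \<le> 1") auto

lemma Z_closed: "closedin T (Z n)"
  using closedin_closed_subgroup_generated Z_ge_2 Z_le_1 closedin_topspace[of T] topspace_eq
  by (cases "n \<le> 1") auto

lemma Z_gens_in: "n \<ge> 2 \<Longrightarrow> x \<in> Z_gens n \<Longrightarrow> x \<in> Z n"
  using closed_subgroup_generated_incl[OF Z_gens_subset] Z_ge_2 by simp

text \<open>Each generator of a level is a power or a commutator from earlier levels, so any closed
  filtration obeying the same two rules contains Z. For a filtration given by conditions on degrees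
  it thus suffices to check these rules.\<close>

lemma Z_minimal:
  assumes "\<And>k. subgroup (D k) G" "\<And>k. closedin T (D k)" and "D 1 = carrier G"
    and comm: "\<And>x y i j. x \<in> D i \<Longrightarrow> y \<in> D j \<Longrightarrow> inv x \<otimes> inv y \<otimes> x \<otimes> y \<in> D (i + j)"
    and pow: "\<And>x i k. x \<in> D i \<Longrightarrow> k \<le> p * i \<Longrightarrow> x [^] p \<in> D k"
    and "k \<ge> 1"
  shows "Z k \<subseteq> D k"
  using \<open>k \<ge> 1\<close>
proof (induction k rule: less_induct)
  case (less k)
  show ?case
  proof (cases "k \<le> 1")
    case True
    then have "k = 1" using less.prems by simp
    then show ?thesis using assms(3) Z_subset by simp
  next
    case False
    then have k: "k \<ge> 2" by simp
    note c = nat_ceiling_divide[OF k p2]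
    have "Z_gens k \<subseteq> D k"
      unfolding Z_gens_def
    proof (intro Un_least UN_least image_subsetI)
      fix x assume "x \<in> Z (nat \<lceil>real k / real p\<rceil>)"
      then show "x [^] p \<in> D k"
        using less.IH[OF c(2) c(1)] pow c(3) by blast
    next
      fix i x y assume i: "i \<in> {1..<k}" and "x \<in> Z i" "y \<in> Z (k - i)"
      then have "x \<in> D i" "y \<in> D (k - i)" using less.IH[of i] less.IH[of "k - i"] by (auto simp: Suc_le_eq)
      then show "inv x \<otimes> inv y \<otimes> x \<otimes> y \<in> D k" using comm[of x i y "k - i"] i by simp
    qed
    then show ?thesis
      unfolding Z_ge_2[OF k] using assms(1,2) by (intro closed_subgroup_generated_minimal)
  qed
qed

text \<open>Generators of level n + 1 are generators of level n: the ceiling grows by at most one,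
  and in a commutator one of the two indices can be lowered, the first if it exceeds 1 and the
  second otherwise.\<close>

lemma Z_Suc: "Z (Suc n) \<subseteq> Z n"
proof (induction n rule: less_induct)
  case (less n)
  show ?case
  proof (cases "n \<le> 1")
    case True
    then show ?thesis using Z_le_1 Z_subset by simp
  next
    case False
    then have n: "n \<ge> 2" "Suc n \<ge> 2" by auto
    note c = nat_ceiling_divide[OF n(1) p2] and c' = nat_ceiling_divide[OF n(2) p2]
    have pow: "Z (nat \<lceil>real (Suc n) / real p\<rceil>) \<subseteq> Z (nat \<lceil>real n / real p\<rceil>)"
    proof -
      have "Suc n \<le> p * Suc (nat \<lceil>real n / real p\<rceil>)" using c(3) p2 by simp
      then have "nat \<lceil>real (Suc n) / real p\<rceil> \<le> Suc (nat \<lceil>real n / real p\<rceil>)"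
        by (rule c'(4))
      moreover have "nat \<lceil>real n / real p\<rceil> \<le> nat \<lceil>real (Suc n) / real p\<rceil>"
        using c'(3) by (intro c(4)) simp
      ultimately consider "nat \<lceil>real (Suc n) / real p\<rceil> = nat \<lceil>real n / real p\<rceil>"
        | "nat \<lceil>real (Suc n) / real p\<rceil> = Suc (nat \<lceil>real n / real p\<rceil>)" by linarith
      then show ?thesis by cases (use less.IH[OF c(2)] in auto)
    qed
    have "Z_gens (Suc n) \<subseteq> Z_gens n"
      unfolding Z_gens_def[of "Suc n"]
    proof (intro Un_least UN_least image_subsetI)
      fix x assume "x \<in> Z (nat \<lceil>real (Suc n) / real p\<rceil>)"
      then show "x [^] p \<in> Z_gens n" using pow by (auto simp: Z_gens_def)
    next
      fix i x y assume i: "i \<in> {1..<Suc n}" and x: "x \<in> Z i" and y: "y \<in> Z (Suc n - i)"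
      show "inv x \<otimes> inv y \<otimes> x \<otimes> y \<in> Z_gens n"
      proof (cases "i = 1")
        case True
        then have "y \<in> Z (n - 1)" using y less.IH[of "n - 1"] n by auto
        then show ?thesis using True x n unfolding Z_gens_def by force
      next
        case False
        with i obtain j where j: "i = Suc j" "j < n" "j \<ge> 1" by (cases i) auto
        then have "x \<in> Z (i - 1)" "n - (i - 1) = Suc n - i" "i - 1 \<in> {1..<n}"
          using x less.IH[OF j(2)] by auto
        then show ?thesis using y unfolding Z_gens_def by force
      qed
    qed
    then have "Z_gens (Suc n) \<subseteq> Z n" using Z_gens_in[OF n(1)] by blast
    then show ?thesis
      unfolding Z_ge_2[OF n(2)] using Z_subgroup Z_closed by (intro closed_subgroup_generated_minimal)
  qed
qed

lemma Z_pow: "x \<in> Z i \<Longrightarrow> x [^] p \<in> Z (p * i)"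
proof (cases "i = 0")
  case False
  assume x: "x \<in> Z i"
  have "p * 1 \<le> p * i" using False by (intro mult_le_mono) auto
  then have n: "p * i \<ge> 2" using p2 by linarith
  have "real (p * i) / real p = real i" using p2 by simp
  then have "nat \<lceil>real (p * i) / real p\<rceil> = i" by (simp only: ceiling_of_nat nat_int)
  then show ?thesis using x by (intro Z_gens_in[OF n]) (auto simp: Z_gens_def)
qed (simp add: Z_le_1)

lemma Z_comm_pos: "x \<in> Z i \<Longrightarrow> y \<in> Z j \<Longrightarrow> i \<ge> 1 \<Longrightarrow> j \<ge> 1 \<Longrightarrow> inv x \<otimes> inv y \<otimes> x \<otimes> y \<in> Z (i + j)"
  by (rule Z_gens_in) (force simp: Z_gens_def)+

text \<open>Level 0 equals level 1, so an index 0 may be raised to 1, at the price of the inclusion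
  \<open>Z_Suc\<close>.\<close>

lemma Z_comm: "x \<in> Z i \<Longrightarrow> y \<in> Z j \<Longrightarrow> inv x \<otimes> inv y \<otimes> x \<otimes> y \<in> Z (i + j)"
proof -
  assume x: "x \<in> Z i" and y: "y \<in> Z j"
  have 0: "Z 0 = Z 1" by (simp add: Z_le_1)
  consider "i = 0" "j = 0" | "i = 0" "j \<ge> 1" | "i \<ge> 1" "j = 0" | "i \<ge> 1" "j \<ge> 1" by linarith
  then show ?thesis
  proof cases
    case 1
    then show ?thesis using x y by (simp add: Z_le_1)
  next
    case 2
    then show ?thesis using Z_comm_pos[of x 1 y j] x y 0 Z_Suc[of j] by auto
  next
    case 3
    then show ?thesis using Z_comm_pos[of x i y 1] x y 0 Z_Suc[of i] by auto
  qed (use Z_comm_pos x y in blast)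
qed

sublocale Z: np_filtration G Z p
  using Z_subgroup Z_Suc Z_comm Z_pow p
  by (intro np_filtration.intro np_filtration_axioms.intro is_group) (auto simp: Z_le_1)

lemma Z_normal: "Z n \<lhd> G"
proof (rule normal_invI[OF Z_subgroup])
  fix x h assume "x \<in> carrier G" "h \<in> Z n"
  then show "x \<otimes> h \<otimes> inv x \<in> Z n" using Z.Phi_conj[of h n "inv x"] by simp
qed

text \<open>The elements \<open>D a\<close> that lower the degree of all W-invariant functions by a
  obey the rules of \<open>Z_minimal\<close>; hence s lies in \<open>D m\<close>, and its difference
  has degree less than 0, that is, vanishes modulo p. Invariance under W puts W into every
  \<open>D a\<close>, which makes it open and so closed.\<close>

lemma low_degree_const:
  assumes W: "W \<lhd> G" "openin T W"
    and inv: "\<And>x w. x \<in> carrier G \<Longrightarrow> w \<in> W \<Longrightarrow> int p dvd f (x \<otimes> w) - f x"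
    and deg: "deg_less p G (lower_filtration G) m f" and m: "m \<ge> 1"
    and x: "x \<in> carrier G" and s: "s \<in> Z m"
  shows "int p dvd f (x \<otimes> s) - f x"
proof -
  define \<F> where "\<F> = {f. \<forall>x\<in>carrier G. \<forall>w\<in>W. int p dvd f (x \<otimes> w) - f x}"
  interpret W: normal W G by (rule W)
  interpret difference_filtration G p \<F>
  proof (intro difference_filtration.intro difference_filtration_axioms.intro is_group p)
    fix f y assume f: "f \<in> \<F>" and y: "y \<in> carrier G"
    have "int p dvd rdiff G y f (x \<otimes> w) - rdiff G y f x" if "x \<in> carrier G" "w \<in> W" for x w
      using rdiff_invariant_mod[OF W(1) _ y that] f by (auto simp: \<F>_def)
    then show "rdiff G y f \<in> \<F>" by (auto simp: \<F>_def)
  qed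
  have WD: "W \<subseteq> D a" for a
  proof
    fix w assume w: "w \<in> W"
    then show "w \<in> D a"
      using W.mem_carrier[OF w] lower_0 unfolding D_def
      by (auto simp: \<F>_def rdiff_apply intro!: K_zero)
  qed
  have "openin T (D a)" for a
    using WD W.one_closed W(2) by (intro open_subgroupI[OF D_subgroup]) auto
  then have "closedin T (D a)" for a
    by (rule open_subgroup_closed[OF D_subgroup])
  then have "Z m \<subseteq> D m"
    using D_subgroup D_1 D_comm D_pow m by (intro Z_minimal)
  moreover have "f \<in> \<F>" using inv by (auto simp: \<F>_def)
  ultimately have "K (m - m) (rdiff G s f)" using D_rdiff s deg by blast
  then show ?thesis using x lower_0 by (simp add: K_0 rdiff_apply)
qed

text \<open>The extension argument requires finite index, so Z is replaced by \<open>\<Phi>\<close>,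
  its image in G / W pulled back to G, and \<open>\<psi>\<close> by the induced function. Afterwards
  the weights are forgotten.\<close>

lemma zassenhaus_hom_extends:
  assumes n: "n \<ge> 1" and W: "W \<lhd> G" "openin T W"
    and hom: "\<And>x y. x \<in> Z n \<Longrightarrow> y \<in> Z n \<Longrightarrow> int p dvd \<psi> (x \<otimes> y) - \<psi> x - \<psi> y"
    and triv: "\<And>x. x \<in> Z (Suc n) \<Longrightarrow> int p dvd \<psi> x"
    and inv: "\<And>x. x \<in> W \<inter> Z n \<Longrightarrow> int p dvd \<psi> x"
  shows "\<exists>f. deg_less p G (lower_filtration G) (Suc n) f \<and>
    (\<forall>x\<in>carrier G. \<forall>w\<in>W. int p dvd f (x \<otimes> w) - f x) \<and> (\<forall>x\<in>Z n. int p dvd f x - \<psi> x)"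
proof -
  interpret W: normal W G by (rule W)
  define \<Phi> where "\<Phi> v = {x \<in> carrier G. \<exists>s\<in>Z v. W #> x = W #> s}" for v
  interpret \<Phi>: np_filtration G \<Phi> p
    unfolding \<Phi>_def by (rule Z.np_filtration_mod[OF W(1)])
  obtain \<psi>' where eq: "\<And>x s. s \<in> Z n \<Longrightarrow> W #> x = W #> s \<Longrightarrow> int p dvd \<psi>' x - \<psi> s"
    using hom_factor_mod[OF W(1) Z_subgroup[of n], of p \<psi>] hom inv by blast
  have W\<Phi>: "W \<subseteq> \<Phi> v" for v
  proof
    fix w assume w: "w \<in> W"
    have "W #> w = W #> \<one>" using w W.rcos_const by (simp add: W.subset)
    then show "w \<in> \<Phi> v"
      using W.mem_carrier[OF w] subgroup.one_closed[OF Z_subgroup] unfolding \<Phi>_def by blast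
  qed
  have "openin T (\<Phi> n)"
    using W\<Phi> W.one_closed W(2) by (intro open_subgroupI[OF \<Phi>.Phi_subgroup]) auto
  then have fin: "finite (rcosets (\<Phi> n))"
    by (rule finite_rcosets[OF \<Phi>.Phi_subgroup])
  have "\<exists>f. deg_less p G \<Phi> (Suc n) f \<and> (\<forall>x\<in>\<Phi> n. f x = \<psi>' x)"
  proof (rule \<Phi>.extend_hom_to_polynomial[OF n fin])
    fix x y assume "x \<in> \<Phi> n" "y \<in> \<Phi> n"
    then obtain s t where s: "s \<in> Z n" "W #> x = W #> s" and t: "t \<in> Z n" "W #> y = W #> t"
      and c: "x \<in> carrier G" "y \<in> carrier G"
      by (auto simp: \<Phi>_def)
    have "W #> (x \<otimes> y) = W #> (s \<otimes> t)"
      using s c W.rcos_sum[of x y] W.rcos_sum[of s t] t Z_carrier[OF s(1)] Z_carrier[OF t(1)] by simp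
    then have "int p dvd \<psi>' (x \<otimes> y) - \<psi> (s \<otimes> t)"
      by (rule eq[OF subgroup.m_closed[OF Z_subgroup s(1) t(1)]])
    from dvd_diff[OF dvd_diff[OF dvd_add[OF this hom[OF s(1) t(1)]] eq[OF s]] eq[OF t]]
    show "int p dvd \<psi>' (x \<otimes> y) - \<psi>' x - \<psi>' y" by (simp add: algebra_simps)
  next
    fix x assume "x \<in> \<Phi> (Suc n)"
    then obtain s where s: "s \<in> Z (Suc n)" "W #> x = W #> s" by (auto simp: \<Phi>_def)
    then have "int p dvd \<psi>' x - \<psi> s" using eq Z_Suc by blast
    from dvd_add[OF this triv[OF s(1)]] show "int p dvd \<psi>' x" by simp
  qed
  then obtain f where f: "deg_less p G \<Phi> (Suc n) f" "\<And>x. x \<in> \<Phi> n \<Longrightarrow> f x = \<psi>' x" by blast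
  have fil: "filtration G \<Phi>"
    using \<Phi>.Phi_subgroup \<Phi>.Phi_0 \<Phi>.Phi_1 \<Phi>.Phi_carrier
    by (intro filtration.intro filtration_axioms.intro is_group) (auto simp: subgroup_self)
  have "deg_less p G (lower_filtration G) (Suc n) f"
    by (rule deg_less_subfiltration[OF fil filtration_lower _ f(1)])
      (auto simp: lower_filtration_def \<Phi>.Phi_0 \<Phi>.Phi_1[simplified] le_Suc_eq)
  moreover have "int p dvd f (x \<otimes> w) - f x" if "x \<in> carrier G" "w \<in> W" for x w
  proof -
    interpret F: filtration G \<Phi> p by (rule fil)
    \<comment> \<open>W lies in every level; as elements of weight n + 1 its members bring the
      degree below 0.\<close>
    have "deg_less p G \<Phi> (Suc n - Suc n) (rdiff G w f)"
      using F.K_rdiff[OF f(1)] that(2) W\<Phi> by blast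
    then show ?thesis using that by (simp add: F.K_0 \<Phi>.Phi_0 rdiff_apply)
  qed
  moreover have "int p dvd f x - \<psi> x" if "x \<in> Z n" for x
  proof -
    have "x \<in> \<Phi> n" using that Z_carrier unfolding \<Phi>_def by blast
    then show ?thesis using eq[OF that refl] f(2) by simp
  qed
  ultimately show ?thesis by blast
qed

end

section \<open>Locally constant functions and cochains\<close>

text \<open>Cochains are treated as integer valued locally constant functions compared modulo p;
  they are reduced to residues only where a cochain in the sense of the definitions is called
  for.\<close>

abbreviation loc_const :: "'x topology \<Rightarrow> ('x \<Rightarrow> 'y) \<Rightarrow> bool" where
  "loc_const X f \<equiv> continuous_map X (discrete_topology UNIV) f"

lemma continuous_map_discrete_iff:
  "continuous_map X (discrete_topology A) c \<longleftrightarrow> loc_const X c \<and> (\<forall>x\<in>topspace X. c x \<in> A)"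
proof -
  have "discrete_topology A = subtopology (discrete_topology UNIV) A" by simp
  then show ?thesis
    by (simp only: continuous_map_in_subtopology) (auto simp: image_subset_iff Pi_iff)
qed

lemma loc_const_comp: "loc_const X f \<Longrightarrow> loc_const X (\<lambda>x. h (f x))"
  using continuous_map_compose[of X "discrete_topology UNIV" f "discrete_topology UNIV" h]
  by (simp add: o_def)

lemma loc_const_comp2:
  assumes "loc_const X f" "loc_const X g"
  shows "loc_const X (\<lambda>x. h (f x) (g x))"
proof -
  have "loc_const X (\<lambda>x. (f x, g x))"
    using continuous_map_pairedI[OF assms] by (simp flip: prod_topology_discrete_topology)
  from loc_const_comp[OF this, of "\<lambda>q. h (fst q) (snd q)"] show ?thesis by simp
qed

lemma loc_const_add: "loc_const X f \<Longrightarrow> loc_const X g \<Longrightarrow> loc_const X (\<lambda>x. f x + g x :: int)"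
  by (rule loc_const_comp2)

lemma loc_const_diff: "loc_const X f \<Longrightarrow> loc_const X g \<Longrightarrow> loc_const X (\<lambda>x. f x - g x :: int)"
  by (rule loc_const_comp2)

lemma loc_const_mult: "loc_const X f \<Longrightarrow> loc_const X g \<Longrightarrow> loc_const X (\<lambda>x. f x * g x :: int)"
  by (rule loc_const_comp2)

lemma loc_const_uminus: "loc_const X f \<Longrightarrow> loc_const X (\<lambda>x. - f x :: int)"
  by (rule loc_const_comp)

lemma loc_const_const: "loc_const X (\<lambda>_. c)"
  by simp

lemma loc_const_sum:
  "finite A \<Longrightarrow> (\<And>i. i \<in> A \<Longrightarrow> loc_const X (f i)) \<Longrightarrow> loc_const X (\<lambda>x. \<Sum>i\<in>A. f i x :: int)"
  by (induction A rule: finite_induct) (auto intro: loc_const_add)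

lemma loc_const_pull: "loc_const Y f \<Longrightarrow> continuous_map X Y k \<Longrightarrow> loc_const X (\<lambda>x. f (k x))"
  using continuous_map_compose[of X Y k "discrete_topology UNIV" f] by (simp add: o_def)

lemma loc_const_cong: "(\<And>x. x \<in> topspace X \<Longrightarrow> f x = g x) \<Longrightarrow> loc_const X f \<Longrightarrow> loc_const X g"
  using continuous_map_eq by blast

lemma cochain_iff:
  assumes "p > 0"
  shows "c \<in> carrier (cochain_group p X) \<longleftrightarrow>
    c \<in> extensional (topspace X) \<and> loc_const X c \<and> (\<forall>x\<in>topspace X. 0 \<le> c x \<and> c x < int p)"
  using assms
  by (auto simp: cochain_group_def carrier_integer_mod_group continuous_map_discrete_iff[of X "{0..<int p}"])

lemma cochain_mult: "c \<otimes>\<^bsub>cochain_group p X\<^esub> d = (\<lambda>x\<in>topspace X. (c x + d x) mod int p)"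
  by (simp add: cochain_group_def)

lemma cochain_one: "\<one>\<^bsub>cochain_group p X\<^esub> = (\<lambda>x\<in>topspace X. 0)"
  by (simp add: cochain_group_def)

lemma cochain_mod:
  assumes "p > 0" "loc_const X f"
  shows "(\<lambda>x\<in>topspace X. f x mod int p) \<in> carrier (cochain_group p X)"
  using assms
  by (auto simp: cochain_iff intro: loc_const_cong[of X "\<lambda>x. f x mod int p"] loc_const_comp)

lemma cochain_eqI:
  assumes "p > 0" "c \<in> carrier (cochain_group p X)" "d \<in> carrier (cochain_group p X)"
    and "\<And>x. x \<in> topspace X \<Longrightarrow> int p dvd c x - d x"
  shows "c = d"
proof (rule extensionalityI[of _ "topspace X"])
  fix x assume x: "x \<in> topspace X"
  then have "c x mod int p = d x mod int p" using assms(4) by (simp add: mod_eq_dvd_iff)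
  moreover have "c x mod int p = c x" "d x mod int p = d x"
    using x assms(2,3) unfolding cochain_iff[OF assms(1)] by (auto intro: mod_pos_pos_trivial)
  ultimately show "c x = d x" by metis
next
  show "c \<in> extensional (topspace X)" "d \<in> extensional (topspace X)"
    using assms(2,3) unfolding cochain_iff[OF assms(1)] by blast+
qed

lemma cochain_comm_group:
  assumes p: "p > 0"
  shows "comm_group (cochain_group p X)"
proof (rule comm_groupI)
  fix c d assume "c \<in> carrier (cochain_group p X)" "d \<in> carrier (cochain_group p X)"
  then show "c \<otimes>\<^bsub>cochain_group p X\<^esub> d \<in> carrier (cochain_group p X)"
    unfolding cochain_mult using p by (intro cochain_mod loc_const_add) (simp_all add: cochain_iff)
next
  show "\<one>\<^bsub>cochain_group p X\<^esub> \<in> carrier (cochain_group p X)"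
    using cochain_mod[OF p, of X "\<lambda>_. 0"] by (simp add: cochain_one)
next
  fix c assume c: "c \<in> carrier (cochain_group p X)"
  show "\<one>\<^bsub>cochain_group p X\<^esub> \<otimes>\<^bsub>cochain_group p X\<^esub> c = c"
    using p c by (intro extensionalityI[of _ "topspace X"]) (auto simp: cochain_mult cochain_one cochain_iff)
  have "(\<lambda>x\<in>topspace X. (- c x) mod int p) \<in> carrier (cochain_group p X)"
    using c cochain_iff[OF p, of c X] by (intro cochain_mod[OF p] loc_const_uminus) blast
  moreover have "(\<lambda>x\<in>topspace X. (- c x) mod int p) \<otimes>\<^bsub>cochain_group p X\<^esub> c = \<one>\<^bsub>cochain_group p X\<^esub>"
    by (simp add: cochain_mult cochain_one restrict_def fun_eq_iff mod_add_left_eq)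
  ultimately show "\<exists>d\<in>carrier (cochain_group p X). d \<otimes>\<^bsub>cochain_group p X\<^esub> c = \<one>\<^bsub>cochain_group p X\<^esub>"
    by blast
qed (simp_all add: cochain_mult restrict_def fun_eq_iff mod_add_left_eq mod_add_right_eq add_ac)

lemma cochain_inv:
  assumes p: "p > 0" and c: "c \<in> carrier (cochain_group p X)"
  shows "inv\<^bsub>cochain_group p X\<^esub> c = (\<lambda>x\<in>topspace X. (- c x) mod int p)"
proof -
  interpret comm_group "cochain_group p X" by (rule cochain_comm_group[OF p])
  show ?thesis
  proof (rule inv_equality)
    show "(\<lambda>x\<in>topspace X. (- c x) mod int p) \<in> carrier (cochain_group p X)"
      using c cochain_iff[OF p, of c X] by (intro cochain_mod[OF p] loc_const_uminus) blast
    show "(\<lambda>x\<in>topspace X. (- c x) mod int p) \<otimes>\<^bsub>cochain_group p X\<^esub> c = \<one>\<^bsub>cochain_group p X\<^esub>"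
      by (simp add: cochain_mult cochain_one restrict_def fun_eq_iff mod_add_left_eq)
  qed (rule c)
qed

section \<open>Cocycles and classes in degree 2\<close>

locale cohomology = top_group G T for G (structure) and T +
  fixes p :: nat
  assumes p_pos: "p > 0"
begin

abbreviation "C1 \<equiv> cochain_group p T"
abbreviation "C2 \<equiv> cochain_group p (prod_topology T T)"
abbreviation "Z2 \<equiv> cocycles2 p G T"
abbreviation "B2 \<equiv> coboundaries2 p G T"
abbreviation "cls \<equiv> H2_class p G T"
abbreviation "H2G \<equiv> H2 p G T"

lemma topspace2: "topspace (prod_topology T T) = carrier G \<times> carrier G"
  by (simp add: topspace_eq)

lemma C1_iff: "c \<in> carrier C1 \<longleftrightarrow>
    c \<in> extensional (carrier G) \<and> loc_const T c \<and> (\<forall>x\<in>carrier G. 0 \<le> c x \<and> c x < int p)"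
  using cochain_iff[OF p_pos, of c T] by (simp add: topspace_eq)

lemma C2_iff: "z \<in> carrier C2 \<longleftrightarrow>
    z \<in> extensional (carrier G \<times> carrier G) \<and> loc_const (prod_topology T T) z \<and>
    (\<forall>x\<in>carrier G. \<forall>y\<in>carrier G. 0 \<le> z (x, y) \<and> z (x, y) < int p)"
  using cochain_iff[OF p_pos, of z "prod_topology T T"] by (auto simp: topspace_eq)

definition cocycle_eq :: "('a \<times> 'a \<Rightarrow> int) \<Rightarrow> bool" where
  "cocycle_eq z \<longleftrightarrow> (\<forall>x\<in>carrier G. \<forall>y\<in>carrier G. \<forall>w\<in>carrier G.
     int p dvd z (y, w) - z (x \<otimes> y, w) + z (x, y \<otimes> w) - z (x, y))"

lemma Z2_iff: "z \<in> carrier Z2 \<longleftrightarrow> z \<in> carrier C2 \<and> cocycle_eq z"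
  by (auto simp: cocycles2_def cocycle_eq_def mod_eq_0_iff_dvd)

lemma Z2_mult: "z \<otimes>\<^bsub>Z2\<^esub> z' = (\<lambda>q\<in>carrier G \<times> carrier G. (z q + z' q) mod int p)"
  by (simp add: cocycles2_def cochain_mult topspace_eq)

lemma cocycle_eqD: "cocycle_eq z \<Longrightarrow> x \<in> carrier G \<Longrightarrow> y \<in> carrier G \<Longrightarrow> w \<in> carrier G \<Longrightarrow>
    int p dvd z (y, w) - z (x \<otimes> y, w) + z (x, y \<otimes> w) - z (x, y)"
  by (simp add: cocycle_eq_def)

lemma cocycle_eq_cong_mod:
  assumes "cocycle_eq z" and "\<And>x y. x \<in> carrier G \<Longrightarrow> y \<in> carrier G \<Longrightarrow> int p dvd z' (x, y) - z (x, y)"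
  shows "cocycle_eq z'"
  unfolding cocycle_eq_def
proof (intro ballI)
  fix x y w assume c: "x \<in> carrier G" "y \<in> carrier G" "w \<in> carrier G"
  have "int p dvd (z' (y, w) - z (y, w)) - (z' (x \<otimes> y, w) - z (x \<otimes> y, w))
      + (z' (x, y \<otimes> w) - z (x, y \<otimes> w)) - (z' (x, y) - z (x, y))"
    by (rule dvd_diff[OF dvd_add[OF dvd_diff]]) (use assms(2) c in auto)
  from dvd_add[OF this cocycle_eqD[OF assms(1) c]]
  show "int p dvd z' (y, w) - z' (x \<otimes> y, w) + z' (x, y \<otimes> w) - z' (x, y)"
    by (simp add: algebra_simps)
qed

lemma cocycle_mod:
  assumes "loc_const (prod_topology T T) z" "cocycle_eq z"
  shows "(\<lambda>q\<in>carrier G \<times> carrier G. z q mod int p) \<in> carrier Z2"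
  using cochain_mod[OF p_pos assms(1)] cocycle_eq_cong_mod[OF assms(2)]
  by (auto simp: Z2_iff topspace_eq mod_eq_dvd_iff[symmetric])

lemma cocycle_eq_add: "cocycle_eq z \<Longrightarrow> cocycle_eq z' \<Longrightarrow> cocycle_eq (\<lambda>q. z q + z' q)"
  unfolding cocycle_eq_def
proof (intro ballI)
  fix x y w assume 1: "\<forall>x\<in>carrier G. \<forall>y\<in>carrier G. \<forall>w\<in>carrier G. int p dvd z (y, w) - z (x \<otimes> y, w) + z (x, y \<otimes> w) - z (x, y)"
    "\<forall>x\<in>carrier G. \<forall>y\<in>carrier G. \<forall>w\<in>carrier G. int p dvd z' (y, w) - z' (x \<otimes> y, w) + z' (x, y \<otimes> w) - z' (x, y)"
    and c: "x \<in> carrier G" "y \<in> carrier G" "w \<in> carrier G"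
  have "int p dvd (z (y, w) - z (x \<otimes> y, w) + z (x, y \<otimes> w) - z (x, y)) +
      (z' (y, w) - z' (x \<otimes> y, w) + z' (x, y \<otimes> w) - z' (x, y))"
    using 1 c by (intro dvd_add) auto
  then show "int p dvd z (y, w) + z' (y, w) - (z (x \<otimes> y, w) + z' (x \<otimes> y, w)) +
      (z (x, y \<otimes> w) + z' (x, y \<otimes> w)) - (z (x, y) + z' (x, y))"
    by (simp add: algebra_simps)
qed

lemma cocycle_eq_uminus: "cocycle_eq z \<Longrightarrow> cocycle_eq (\<lambda>q. - z q)"
  unfolding cocycle_eq_def
proof (intro ballI)
  fix x y w assume 1: "\<forall>x\<in>carrier G. \<forall>y\<in>carrier G. \<forall>w\<in>carrier G. int p dvd z (y, w) - z (x \<otimes> y, w) + z (x, y \<otimes> w) - z (x, y)"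
    and c: "x \<in> carrier G" "y \<in> carrier G" "w \<in> carrier G"
  have "int p dvd - (z (y, w) - z (x \<otimes> y, w) + z (x, y \<otimes> w) - z (x, y))"
    using 1 c by (subst dvd_minus_iff) blast
  then show "int p dvd - z (y, w) - - z (x \<otimes> y, w) + - z (x, y \<otimes> w) - - z (x, y)"
    by (simp add: algebra_simps)
qed

definition dd :: "('a \<Rightarrow> int) \<Rightarrow> 'a \<times> 'a \<Rightarrow> int" where
  "dd c = (\<lambda>(x, y). c x + c y - c (x \<otimes> y))"

lemma dd_apply: "dd c (x, y) = c x + c y - c (x \<otimes> y)"
  by (simp add: dd_def)

lemma cocycle_eq_dd: "cocycle_eq (dd c)"
  by (auto simp: cocycle_eq_def dd_apply m_assoc)

lemma loc_const_dd:
  assumes c: "loc_const T c"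
  shows "loc_const (prod_topology T T) (dd c)"
proof -
  have "continuous_map (prod_topology T T) T (\<lambda>q. fst q \<otimes> snd q)"
    by (intro continuous_mult continuous_map_fst continuous_map_snd)
  note 1 = loc_const_pull[OF c this] loc_const_pull[OF c continuous_map_fst]
    loc_const_pull[OF c continuous_map_snd]
  have "loc_const (prod_topology T T) (\<lambda>q. c (fst q) + c (snd q) - c (fst q \<otimes> snd q))"
    by (intro loc_const_diff loc_const_add 1)
  then show ?thesis by (simp add: dd_def case_prod_unfold)
qed

lemma cobd_eq: "cobd p G c = (\<lambda>q\<in>carrier G \<times> carrier G. dd c q mod int p)"
  by (auto simp: cobd_def dd_def fun_eq_iff)

text \<open>A locally constant function and its reduction modulo p have congruent coboundaries, so
  coboundaries can be recognised by an unreduced c.\<close>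

lemma B2_iff: "z \<in> B2 \<longleftrightarrow> z \<in> carrier Z2 \<and>
    (\<exists>c. loc_const T c \<and> (\<forall>x\<in>carrier G. \<forall>y\<in>carrier G. int p dvd z (x, y) - dd c (x, y)))"
proof
  assume "z \<in> B2"
  then obtain c where c: "c \<in> carrier C1" "z = cobd p G c" by (auto simp: coboundaries2_def)
  then have lc: "loc_const T c" by (simp add: C1_iff)
  have "z \<in> carrier Z2"
    unfolding c(2) cobd_eq by (intro cocycle_mod loc_const_dd cocycle_eq_dd lc)
  moreover have "\<forall>x\<in>carrier G. \<forall>y\<in>carrier G. int p dvd z (x, y) - dd c (x, y)"
    by (simp add: c(2) cobd_eq mod_eq_dvd_iff[symmetric])
  ultimately show "z \<in> carrier Z2 \<and> (\<exists>c. loc_const T c \<and>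
      (\<forall>x\<in>carrier G. \<forall>y\<in>carrier G. int p dvd z (x, y) - dd c (x, y)))"
    using lc by blast
next
  assume "z \<in> carrier Z2 \<and> (\<exists>c. loc_const T c \<and>
      (\<forall>x\<in>carrier G. \<forall>y\<in>carrier G. int p dvd z (x, y) - dd c (x, y)))"
  then obtain c where z: "z \<in> carrier C2" and c: "loc_const T c"
    "\<And>x y. x \<in> carrier G \<Longrightarrow> y \<in> carrier G \<Longrightarrow> int p dvd z (x, y) - dd c (x, y)"
    by (auto simp: Z2_iff)
  define c' where "c' = (\<lambda>x\<in>carrier G. c x mod int p)"
  have c': "c' \<in> carrier C1"
    using cochain_mod[OF p_pos c(1)] by (simp add: c'_def topspace_eq)
  have "z = cobd p G c'"
  proof (rule cochain_eqI[OF p_pos z])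
    show "cobd p G c' \<in> carrier C2"
      unfolding cobd_eq using cocycle_mod[OF loc_const_dd cocycle_eq_dd, of c'] c'
      by (simp add: Z2_iff C1_iff)
    fix q assume "q \<in> topspace (prod_topology T T)"
    then obtain x y where q: "q = (x, y)" "x \<in> carrier G" "y \<in> carrier G" using topspace2 by (metis mem_Sigma_iff surj_pair)
    have "z (x, y) mod int p = dd c (x, y) mod int p"
      using c(2)[OF q(2,3)] by (simp add: mod_eq_dvd_iff)
    also have "\<dots> = dd c' (x, y) mod int p"
      unfolding dd_apply using q by (intro mod_diff_cong mod_add_cong) (simp_all add: c'_def)
    finally show "int p dvd z q - cobd p G c' q"
      using q by (simp add: cobd_eq mod_eq_dvd_iff[symmetric])
  qed
  then show "z \<in> B2" using c' by (auto simp: coboundaries2_def)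
qed

lemma C2_group: "comm_group C2"
  by (rule cochain_comm_group[OF p_pos])

lemma Z2_subgroup: "subgroup (carrier Z2) C2"
proof -
  interpret C2: comm_group C2 by (rule C2_group)
  show ?thesis
  proof (rule C2.subgroupI)
    show "carrier Z2 \<subseteq> carrier C2" by (auto simp: Z2_iff)
    have "(\<lambda>q\<in>carrier G \<times> carrier G. 0 mod int p) \<in> carrier Z2"
      by (rule cocycle_mod) (auto simp: cocycle_eq_def)
    then show "carrier Z2 \<noteq> {}" by blast
    fix z assume z: "z \<in> carrier Z2"
    have "(\<lambda>q\<in>carrier G \<times> carrier G. (- z q) mod int p) \<in> carrier Z2"
      using z by (intro cocycle_mod cocycle_eq_uminus loc_const_uminus) (auto simp: Z2_iff C2_iff)
    then show "inv\<^bsub>C2\<^esub> z \<in> carrier Z2"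
      using z by (simp add: cochain_inv[OF p_pos] Z2_iff topspace_eq)
    fix z' assume z': "z' \<in> carrier Z2"
    have "(\<lambda>q\<in>carrier G \<times> carrier G. (z q + z' q) mod int p) \<in> carrier Z2"
      using z z' by (intro cocycle_mod cocycle_eq_add loc_const_add) (auto simp: Z2_iff C2_iff)
    then show "z \<otimes>\<^bsub>C2\<^esub> z' \<in> carrier Z2"
      by (simp add: cochain_mult topspace_eq)
  qed
qed

lemma Z2_eq: "Z2 = C2\<lparr>carrier := carrier Z2\<rparr>"
  by (simp add: cocycles2_def)

lemma Z2_group: "comm_group Z2"
proof -
  interpret C2: comm_group C2 by (rule C2_group)
  have "group (C2\<lparr>carrier := carrier Z2\<rparr>)"
    by (rule subgroup.subgroup_is_group[OF Z2_subgroup C2.is_group])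
  then have "group Z2" using Z2_eq by simp
  then show ?thesis
    by (rule group.group_comm_groupI) (auto simp: Z2_mult add.commute)
qed

lemma Z2_inv: "z \<in> carrier Z2 \<Longrightarrow> inv\<^bsub>Z2\<^esub> z = (\<lambda>q\<in>carrier G \<times> carrier G. (- z q) mod int p)"
  using group.m_inv_consistent[OF comm_group.axioms(2)[OF C2_group] Z2_subgroup] Z2_eq
    cochain_inv[OF p_pos, of z "prod_topology T T"]
  by (simp add: Z2_iff topspace_eq)

lemma B2_subgroup: "subgroup B2 Z2"
proof -
  interpret Z2: comm_group Z2 by (rule Z2_group)
  show ?thesis
  proof (rule Z2.subgroupI)
    show "B2 \<subseteq> carrier Z2" by (auto simp: B2_iff)
    have "cobd p G (\<lambda>x\<in>carrier G. 0 mod int p) \<in> B2"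
      unfolding coboundaries2_def
      using cochain_mod[OF p_pos, of T "\<lambda>_. 0"] by (simp add: topspace_eq)
    then show "B2 \<noteq> {}" by blast
    fix z assume z: "z \<in> B2"
    then obtain c where c: "loc_const T c"
      "\<And>x y. x \<in> carrier G \<Longrightarrow> y \<in> carrier G \<Longrightarrow> int p dvd z (x, y) - dd c (x, y)"
      and zZ: "z \<in> carrier Z2" by (auto simp: B2_iff)
    have 1: "int p dvd (inv\<^bsub>Z2\<^esub> z) (x, y) - dd (\<lambda>x. - c x) (x, y)" if "x \<in> carrier G" "y \<in> carrier G" for x y
    proof -
      have "int p dvd - (z (x, y) - dd c (x, y))" using c(2)[OF that] by (subst dvd_minus_iff)
      then have "int p dvd - z (x, y) - dd (\<lambda>x. - c x) (x, y)"
        by (simp add: dd_apply algebra_simps)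
      then show ?thesis
        using that zZ by (simp add: Z2_inv mod_eq_dvd_iff[symmetric] mod_simps)
    qed
    have "loc_const T (\<lambda>x. - c x)" using c(1) by (rule loc_const_comp)
    then show "inv\<^bsub>Z2\<^esub> z \<in> B2"
      using zZ 1 Z2.inv_closed unfolding B2_iff by blast
    fix z' assume z': "z' \<in> B2"
    then obtain c' where c': "loc_const T c'"
      "\<And>x y. x \<in> carrier G \<Longrightarrow> y \<in> carrier G \<Longrightarrow> int p dvd z' (x, y) - dd c' (x, y)"
      and zZ': "z' \<in> carrier Z2" by (auto simp: B2_iff)
    have 2: "int p dvd (z \<otimes>\<^bsub>Z2\<^esub> z') (x, y) - dd (\<lambda>x. c x + c' x) (x, y)"
      if "x \<in> carrier G" "y \<in> carrier G" for x y
    proof -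
      have "int p dvd (z (x, y) - dd c (x, y)) + (z' (x, y) - dd c' (x, y))"
        using c(2)[OF that] c'(2)[OF that] by (rule dvd_add)
      then have "int p dvd (z (x, y) + z' (x, y)) - dd (\<lambda>x. c x + c' x) (x, y)"
        by (simp add: dd_apply algebra_simps)
      then show ?thesis
        using that by (simp add: Z2_mult mod_eq_dvd_iff[symmetric] mod_simps)
    qed
    have "loc_const T (\<lambda>x. c x + c' x)" using c(1) c'(1) by (rule loc_const_comp2)
    then show "z \<otimes>\<^bsub>Z2\<^esub> z' \<in> B2"
      using 2 Z2.m_closed[OF zZ zZ'] unfolding B2_iff by blast
  qed
qed

lemma B2_normal: "B2 \<lhd> Z2"
  using B2_subgroup comm_group.normal_iff_subgroup[OF Z2_group] by simp

lemma H2_comm_group: "comm_group H2G"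
  unfolding H2_def by (rule comm_group.abelian_FactGroup[OF Z2_group B2_subgroup])

lemma carrier_H2: "carrier H2G = cls ` carrier Z2"
  by (simp add: H2_def carrier_FactGroup H2_class_def)

lemma one_H2: "\<one>\<^bsub>H2G\<^esub> = B2"
  by (simp add: H2_def)

lemma cls_hom: "cls \<in> hom Z2 H2G"
  unfolding H2_def H2_class_def using normal.r_coset_hom_Mod[OF B2_normal] .

lemma cls_in: "z \<in> carrier Z2 \<Longrightarrow> cls z \<in> carrier H2G"
  by (simp add: carrier_H2)

lemma cls_one_iff: "z \<in> carrier Z2 \<Longrightarrow> cls z = \<one>\<^bsub>H2G\<^esub> \<longleftrightarrow> z \<in> B2"
  unfolding one_H2 H2_class_def
  using group.coset_join1[OF comm_group.axioms(2)[OF Z2_group] _ _ B2_subgroup]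
    group.coset_join2[OF comm_group.axioms(2)[OF Z2_group] _ B2_subgroup]
    subgroup.subset[OF B2_subgroup] by metis

lemma cls_trivial_iff:
  assumes "z \<in> carrier Z2"
  shows "cls z = \<one>\<^bsub>H2G\<^esub> \<longleftrightarrow>
    (\<exists>c. loc_const T c \<and> (\<forall>x\<in>carrier G. \<forall>y\<in>carrier G. int p dvd z (x, y) - dd c (x, y)))"
  using cls_one_iff[OF assms] assms B2_iff by blast

lemma cls_eqI:
  assumes z: "z \<in> carrier Z2" and z': "z' \<in> carrier Z2" and c: "loc_const T c"
    and eq: "\<And>x y. x \<in> carrier G \<Longrightarrow> y \<in> carrier G \<Longrightarrow> int p dvd z (x, y) - z' (x, y) - dd c (x, y)"
  shows "cls z = cls z'"
proof -
  interpret Z2: comm_group Z2 by (rule Z2_group)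
  interpret H2: comm_group H2G by (rule H2_comm_group)
  interpret h: group_hom Z2 H2G cls
    using cls_hom by (simp add: group_hom_def group_hom_axioms_def Z2.is_group H2.is_group)
  have "cls (z \<otimes>\<^bsub>Z2\<^esub> inv\<^bsub>Z2\<^esub> z') = \<one>\<^bsub>H2G\<^esub>"
    unfolding cls_trivial_iff[OF Z2.m_closed[OF z Z2.inv_closed[OF z']]]
  proof (intro exI conjI ballI)
    fix x y assume "x \<in> carrier G" "y \<in> carrier G"
    then show "int p dvd (z \<otimes>\<^bsub>Z2\<^esub> inv\<^bsub>Z2\<^esub> z') (x, y) - dd c (x, y)"
      using eq by (simp add: Z2_mult Z2_inv[OF z'] mod_eq_dvd_iff[symmetric] mod_simps)
  qed (rule c)
  then have "cls z \<otimes>\<^bsub>H2G\<^esub> inv\<^bsub>H2G\<^esub> cls z' = \<one>\<^bsub>H2G\<^esub>"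
    using z z' h.hom_mult h.hom_inv by simp
  then have "inv\<^bsub>H2G\<^esub> (inv\<^bsub>H2G\<^esub> cls z') = cls z"
    using cls_in[OF z] cls_in[OF z'] by (intro H2.inv_equality) simp_all
  then show ?thesis using cls_in[OF z'] by simp
qed

lemma cls_mult: "z \<in> carrier Z2 \<Longrightarrow> z' \<in> carrier Z2 \<Longrightarrow> cls (z \<otimes>\<^bsub>Z2\<^esub> z') = cls z \<otimes>\<^bsub>H2G\<^esub> cls z'"
  using hom_mult[OF cls_hom] .

end

section \<open>Quotients and inflation\<close>

text \<open>Products of quotient maps are not quotient maps in general, but products of open maps
  are open. This allows continuity of functions of two cosets to be tested on pairs of
  elements.\<close>

lemma open_map_prod:
  assumes f: "open_map X X' f" and g: "open_map Y Y' g"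
  shows "open_map (prod_topology X Y) (prod_topology X' Y') (\<lambda>q. (f (fst q), g (snd q)))"
  unfolding open_map_def
proof (intro allI impI)
  fix U assume U: "openin (prod_topology X Y) U"
  show "openin (prod_topology X' Y') ((\<lambda>q. (f (fst q), g (snd q))) ` U)"
    unfolding openin_prod_topology_alt
  proof (intro allI impI)
    fix a b assume "(a, b) \<in> (\<lambda>q. (f (fst q), g (snd q))) ` U"
    then obtain x y where xy: "(x, y) \<in> U" "a = f x" "b = g y" by auto
    then obtain V W where VW: "openin X V" "openin Y W" "x \<in> V" "y \<in> W" "V \<times> W \<subseteq> U"
      using U unfolding openin_prod_topology_alt by metis
    have "f ` V \<times> g ` W \<subseteq> (\<lambda>q. (f (fst q), g (snd q))) ` U"
    proof clarify
      fix v w assume "v \<in> V" "w \<in> W"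
      then have "(v, w) \<in> U" using VW(5) by blast
      then show "(f v, g w) \<in> (\<lambda>q. (f (fst q), g (snd q))) ` U" by force
    qed
    moreover have "openin X' (f ` V)" "openin Y' (g ` W)"
      using f g VW by (auto simp: open_map_def)
    ultimately show "\<exists>U' V'. openin X' U' \<and> openin Y' V' \<and> a \<in> U' \<and> b \<in> V' \<and>
        U' \<times> V' \<subseteq> (\<lambda>q. (f (fst q), g (snd q))) ` U"
      using VW xy by blast
  qed
qed

lemma (in top_group) openin_mult_left:
  assumes "N \<subseteq> carrier G" "openin T U"
  shows "openin T {x \<in> carrier G. \<exists>n\<in>N. n \<otimes> x \<in> U}"
proof -
  have "{x \<in> carrier G. \<exists>n\<in>N. n \<otimes> x \<in> U} = (\<Union>n\<in>N. {x \<in> carrier G. n \<otimes> x \<otimes> \<one> \<in> U})"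
    using subsetD[OF assms(1)] by auto
  moreover have "openin T {x \<in> carrier G. n \<otimes> x \<otimes> \<one> \<in> U}" if "n \<in> N" for n
    using that assms by (intro openin_translate) auto
  ultimately show ?thesis by auto
qed

locale top_quotient = top_group G T + normal N G for G (structure) and T and N
begin

abbreviation "\<pi> x \<equiv> N #> x"
abbreviation "GN \<equiv> G Mod N"
abbreviation "TN \<equiv> Mod_topology G T N"

lemma topspace_TN: "topspace TN = carrier GN"
  by (simp add: topspace_quotient_topology carrier_FactGroup topspace_eq)

lemma carrier_GN: "A \<in> carrier GN \<longleftrightarrow> (\<exists>x\<in>carrier G. A = \<pi> x)"
  by (auto simp: carrier_FactGroup)

lemma pi_in: "x \<in> carrier G \<Longrightarrow> \<pi> x \<in> carrier GN"
  by (auto simp: carrier_FactGroup)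

lemma pi_mult: "x \<in> carrier G \<Longrightarrow> y \<in> carrier G \<Longrightarrow> \<pi> x \<otimes>\<^bsub>GN\<^esub> \<pi> y = \<pi> (x \<otimes> y)"
  by (simp add: rcos_sum)

lemma GN_group: "group GN"
  by (rule factorgroup_is_group)

lemma pi_inv: "x \<in> carrier G \<Longrightarrow> inv\<^bsub>GN\<^esub> (\<pi> x) = \<pi> (inv x)"
  using group_hom.hom_inv[of G GN \<pi>] r_coset_hom_Mod GN_group is_group
  by (simp add: group_hom_def group_hom_axioms_def)

lemma pi_eq_iff: "x \<in> carrier G \<Longrightarrow> y \<in> carrier G \<Longrightarrow> \<pi> x = \<pi> y \<longleftrightarrow> (\<exists>n\<in>N. y = n \<otimes> x)"
proof
  assume c: "x \<in> carrier G" "y \<in> carrier G" and "\<pi> x = \<pi> y"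
  then have "y \<in> \<pi> x" using rcos_self[OF c(2) subgroup_axioms] by simp
  then show "\<exists>n\<in>N. y = n \<otimes> x" by (auto simp: r_coset_def)
next
  assume c: "x \<in> carrier G" "y \<in> carrier G" and "\<exists>n\<in>N. y = n \<otimes> x"
  then have "y \<in> \<pi> x" by (auto simp: r_coset_def)
  then show "\<pi> x = \<pi> y" using repr_independence[OF _ c(1) subgroup_axioms] by simp
qed

lemma quotient_pi: "quotient_map T TN \<pi>"
  by (rule quotient_map_quotient_topology)

lemma continuous_pi: "continuous_map T TN \<pi>"
  using quotient_pi by (rule quotient_imp_continuous_map)

text \<open>The saturation of an open set U is the union of its translates by N.\<close>

lemma open_pi: "open_map T TN \<pi>"
  unfolding open_map_def
proof (intro allI impI)
  fix U assume U: "openin T U"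
  then have sub: "U \<subseteq> carrier G" using openin_subset topspace_eq by blast
  have "{x \<in> topspace T. \<pi> x \<in> \<pi> ` U} = {x \<in> carrier G. \<exists>n\<in>N. n \<otimes> x \<in> U}"
  proof -
    have "\<pi> x \<in> \<pi> ` U \<longleftrightarrow> (\<exists>n\<in>N. n \<otimes> x \<in> U)" if x: "x \<in> carrier G" for x
    proof
      assume "\<pi> x \<in> \<pi> ` U"
      then obtain u where u: "u \<in> U" "\<pi> x = \<pi> u" by blast
      then show "\<exists>n\<in>N. n \<otimes> x \<in> U" using pi_eq_iff[OF x, of u] sub by blast
    next
      assume "\<exists>n\<in>N. n \<otimes> x \<in> U"
      then obtain n where n: "n \<in> N" "n \<otimes> x \<in> U" by blast
      then have "\<pi> x = \<pi> (n \<otimes> x)" using pi_eq_iff[OF x, of "n \<otimes> x"] sub by blast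
      then show "\<pi> x \<in> \<pi> ` U" using n by blast
    qed
    then show ?thesis by (auto simp: topspace_eq)
  qed
  then have "openin T {x \<in> topspace T. \<pi> x \<in> \<pi> ` U}"
    using openin_mult_left[OF subset U] by simp
  moreover have "\<pi> ` U \<subseteq> \<pi> ` topspace T" using sub topspace_eq by blast
  ultimately show "openin TN (\<pi> ` U)" by (simp add: openin_quotient_topology)
qed

abbreviation "\<pi>2 q \<equiv> (\<pi> (fst q), \<pi> (snd q))"

lemma quotient_pi2: "quotient_map (prod_topology T T) (prod_topology TN TN) \<pi>2"
proof (rule continuous_open_imp_quotient_map)
  show "continuous_map (prod_topology T T) (prod_topology TN TN) \<pi>2"
    using continuous_map_compose[OF continuous_map_fst continuous_pi]
      continuous_map_compose[OF continuous_map_snd continuous_pi]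
    by (intro continuous_map_pairedI) (simp_all add: o_def)
  show "open_map (prod_topology T T) (prod_topology TN TN) \<pi>2"
    by (rule open_map_prod[OF open_pi open_pi])
  show "\<pi>2 ` topspace (prod_topology T T) = topspace (prod_topology TN TN)"
    by (force simp: topspace_TN carrier_FactGroup topspace_eq image_iff)
qed

lemma topological_GN: "topological_group GN TN"
  unfolding topological_group_def
proof (intro conjI)
  have "continuous_map (prod_topology T T) TN ((\<lambda>(A, B). A \<otimes>\<^bsub>GN\<^esub> B) \<circ> \<pi>2)"
  proof (rule continuous_map_eq)
    show "continuous_map (prod_topology T T) TN (\<lambda>q. \<pi> (fst q \<otimes> snd q))"
      using continuous_map_compose[OF continuous_mult[OF continuous_map_fst continuous_map_snd] continuous_pi]
      by (simp add: o_def)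
  qed (auto simp: topspace_eq rcos_sum)
  then show "continuous_map (prod_topology TN TN) TN (\<lambda>(A, B). A \<otimes>\<^bsub>GN\<^esub> B)"
    by (rule continuous_compose_quotient_map[OF quotient_pi2])
  have "continuous_map T TN ((\<lambda>A. inv\<^bsub>GN\<^esub> A) \<circ> \<pi>)"
  proof (rule continuous_map_eq)
    show "continuous_map T TN (\<lambda>x. \<pi> (inv x))"
      using continuous_map_compose[OF continuous_inv[OF continuous_map_id[unfolded id_def]] continuous_pi]
      by (simp add: o_def)
  qed (auto simp: topspace_eq pi_inv)
  then show "continuous_map TN TN (\<lambda>A. inv\<^bsub>GN\<^esub> A)"
    by (rule continuous_compose_quotient_map[OF quotient_pi])
qed (auto simp: GN_group topspace_TN)

lemma loc_const_pi_iff: "loc_const TN c \<longleftrightarrow> loc_const T (\<lambda>x. c (\<pi> x))"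
  using continuous_compose_quotient_map_eq[OF quotient_pi, of "discrete_topology UNIV" c] by (simp add: o_def)

lemma loc_const_pi2_iff: "loc_const (prod_topology TN TN) z \<longleftrightarrow> loc_const (prod_topology T T) (\<lambda>q. z (\<pi>2 q))"
  using continuous_compose_quotient_map_eq[OF quotient_pi2, of "discrete_topology UNIV" z] by (simp add: o_def)

definition rep :: "'a set \<Rightarrow> 'a" where
  "rep A = (SOME x. x \<in> carrier G \<and> A = \<pi> x)"

lemma rep: "x \<in> carrier G \<Longrightarrow> rep (\<pi> x) \<in> carrier G \<and> (\<exists>n\<in>N. rep (\<pi> x) = n \<otimes> x)"
proof -
  assume x: "x \<in> carrier G"
  then have "rep (\<pi> x) \<in> carrier G \<and> \<pi> x = \<pi> (rep (\<pi> x))"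
    unfolding rep_def using someI[of "\<lambda>y. y \<in> carrier G \<and> \<pi> x = \<pi> y" x] by simp
  then show ?thesis using pi_eq_iff[OF x] by blast
qed

lemma descend:
  assumes c: "loc_const T c" and inv: "\<And>n x. n \<in> N \<Longrightarrow> x \<in> carrier G \<Longrightarrow> c (n \<otimes> x) = c x"
  obtains c' where "loc_const TN c'" "\<And>x. x \<in> carrier G \<Longrightarrow> c' (\<pi> x) = c x"
proof
  show 1: "c (rep (\<pi> x)) = c x" if "x \<in> carrier G" for x
    using rep[OF that] inv that by auto
  show "loc_const TN (\<lambda>A. c (rep A))"
    unfolding loc_const_pi_iff using c by (rule loc_const_cong[rotated]) (simp add: 1 topspace_eq)
qed

lemma descend2:
  assumes c: "loc_const (prod_topology T T) c"
    and inv: "\<And>n m x y. n \<in> N \<Longrightarrow> m \<in> N \<Longrightarrow> x \<in> carrier G \<Longrightarrow> y \<in> carrier G \<Longrightarrow>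
      c (n \<otimes> x, m \<otimes> y) = c (x, y)"
  obtains c' where "loc_const (prod_topology TN TN) c'"
    "\<And>x y. x \<in> carrier G \<Longrightarrow> y \<in> carrier G \<Longrightarrow> c' (\<pi> x, \<pi> y) = c (x, y)"
proof
  let ?c = "\<lambda>q. c (rep (fst q), rep (snd q))"
  show 1: "?c (\<pi> x, \<pi> y) = c (x, y)" if "x \<in> carrier G" "y \<in> carrier G" for x y
    using rep[OF that(1)] rep[OF that(2)] inv that by auto
  show "loc_const (prod_topology TN TN) ?c"
    unfolding loc_const_pi2_iff using c
    by (rule loc_const_cong[rotated]) (use 1 in \<open>auto simp: topspace_eq\<close>)
qed

end

section \<open>Cohomology of a quotient, computed on the group\<close>

locale quotient_cohomology = cohomology G T p + normal N G for G (structure) and T and p and N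
begin

sublocale top_quotient G T N
  by unfold_locales

sublocale Q: cohomology GN TN p
  using topological_GN GN_group p_pos
  by (simp add: cohomology_def cohomology_axioms_def top_group_def top_group_axioms_def)

lemma Q_cocycle_eq_iff:
  "Q.cocycle_eq z \<longleftrightarrow> cocycle_eq (\<lambda>(x, y). z (\<pi> x, \<pi> y))"
  unfolding Q.cocycle_eq_def cocycle_eq_def
  by (auto simp: carrier_FactGroup rcos_sum)

text \<open>Cochains of G / N correspond to N-invariant cochains of G, so triviality over the
  quotient can be decided with functions on G.\<close>

lemma Q_cls_trivial_iff:
  assumes z: "z \<in> carrier Q.Z2"
  shows "Q.cls z = \<one>\<^bsub>Q.H2G\<^esub> \<longleftrightarrow>
    (\<exists>c. loc_const T c \<and> (\<forall>n\<in>N. \<forall>x\<in>carrier G. c (n \<otimes> x) = c x) \<and>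
      (\<forall>x\<in>carrier G. \<forall>y\<in>carrier G. int p dvd z (\<pi> x, \<pi> y) - dd c (x, y)))"
  unfolding Q.cls_trivial_iff[OF z]
proof
  assume "\<exists>c. loc_const TN c \<and> (\<forall>x\<in>carrier GN. \<forall>y\<in>carrier GN. int p dvd z (x, y) - Q.dd c (x, y))"
  then obtain c where c: "loc_const TN c"
    "\<And>A B. A \<in> carrier GN \<Longrightarrow> B \<in> carrier GN \<Longrightarrow> int p dvd z (A, B) - Q.dd c (A, B)" by blast
  have "\<pi> (n \<otimes> x) = \<pi> x" if "n \<in> N" "x \<in> carrier G" for n x
    using pi_eq_iff[of x "n \<otimes> x"] that mem_carrier by auto
  moreover have "int p dvd z (\<pi> x, \<pi> y) - dd (\<lambda>x. c (\<pi> x)) (x, y)" if "x \<in> carrier G" "y \<in> carrier G" for x y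
    using c(2)[OF pi_in[OF that(1)] pi_in[OF that(2)]] that by (simp add: dd_apply Q.dd_apply rcos_sum)
  ultimately show "\<exists>c. loc_const T c \<and> (\<forall>n\<in>N. \<forall>x\<in>carrier G. c (n \<otimes> x) = c x) \<and>
      (\<forall>x\<in>carrier G. \<forall>y\<in>carrier G. int p dvd z (\<pi> x, \<pi> y) - dd c (x, y))"
    using c(1) unfolding loc_const_pi_iff by (intro exI[of _ "\<lambda>x. c (\<pi> x)"]) auto
next
  assume "\<exists>c. loc_const T c \<and> (\<forall>n\<in>N. \<forall>x\<in>carrier G. c (n \<otimes> x) = c x) \<and>
      (\<forall>x\<in>carrier G. \<forall>y\<in>carrier G. int p dvd z (\<pi> x, \<pi> y) - dd c (x, y))"
  then obtain c where c: "loc_const T c" "\<And>n x. n \<in> N \<Longrightarrow> x \<in> carrier G \<Longrightarrow> c (n \<otimes> x) = c x"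
    "\<And>x y. x \<in> carrier G \<Longrightarrow> y \<in> carrier G \<Longrightarrow> int p dvd z (\<pi> x, \<pi> y) - dd c (x, y)" by blast
  obtain c' where c': "loc_const TN c'" "\<And>x. x \<in> carrier G \<Longrightarrow> c' (\<pi> x) = c x"
    using descend[OF c(1,2)] by blast
  have "int p dvd z (A, B) - Q.dd c' (A, B)" if "A \<in> carrier GN" "B \<in> carrier GN" for A B
    using that c(3) c'(2) by (auto simp: carrier_GN dd_apply Q.dd_apply rcos_sum)
  then show "\<exists>c. loc_const TN c \<and> (\<forall>x\<in>carrier GN. \<forall>y\<in>carrier GN. int p dvd z (x, y) - Q.dd c (x, y))"
    using c'(1) by blast
qed

text \<open>Reduction modulo p turns invariance up to multiples of p into equality, after which z
  descends.\<close>

lemma Q_cocycleI: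
  assumes z: "loc_const (prod_topology T T) z" "cocycle_eq z"
    and inv: "\<And>n m x y. n \<in> N \<Longrightarrow> m \<in> N \<Longrightarrow> x \<in> carrier G \<Longrightarrow> y \<in> carrier G \<Longrightarrow>
      int p dvd z (n \<otimes> x, m \<otimes> y) - z (x, y)"
  obtains z' where "z' \<in> carrier Q.Z2"
    "\<And>x y. x \<in> carrier G \<Longrightarrow> y \<in> carrier G \<Longrightarrow> z' (\<pi> x, \<pi> y) = z (x, y) mod int p"
proof -
  have "loc_const (prod_topology T T) (\<lambda>q. z q mod int p)"
    using z(1) by (rule loc_const_comp)
  moreover have "z (n \<otimes> x, m \<otimes> y) mod int p = z (x, y) mod int p"
    if "n \<in> N" "m \<in> N" "x \<in> carrier G" "y \<in> carrier G" for n m x y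
    using inv[OF that] by (simp add: mod_eq_dvd_iff)
  ultimately obtain z' where z': "loc_const (prod_topology TN TN) z'"
    "\<And>x y. x \<in> carrier G \<Longrightarrow> y \<in> carrier G \<Longrightarrow> z' (\<pi> x, \<pi> y) = z (x, y) mod int p"
    by (rule descend2) auto
  have "cocycle_eq (\<lambda>(x, y). z' (\<pi> x, \<pi> y))"
    using z(2) by (rule cocycle_eq_cong_mod) (simp add: z'(2) mod_eq_dvd_iff[symmetric])
  then have "(\<lambda>q\<in>carrier GN \<times> carrier GN. z' q mod int p) \<in> carrier Q.Z2"
    using z'(1) Q_cocycle_eq_iff by (intro Q.cocycle_mod) auto
  then show thesis
    by (rule that) (simp add: z'(2) pi_in)
qed

end

lemma (in group) set_mult_rcoset_absorb:
  assumes M: "subgroup M G" and N: "subgroup N G" "N \<subseteq> M" and x: "x \<in> carrier G"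
  shows "M <#> (N #> x) = M #> x"
proof
  show "M <#> (N #> x) \<subseteq> M #> x"
  proof
    fix y assume "y \<in> M <#> (N #> x)"
    then obtain m n where mn: "m \<in> M" "n \<in> N" "y = m \<otimes> (n \<otimes> x)"
      by (auto simp: set_mult_def r_coset_def)
    then have "y = (m \<otimes> n) \<otimes> x" "m \<otimes> n \<in> M"
      using N(2) x subgroup.mem_carrier[OF M] subgroup.m_closed[OF M] by (auto simp: m_assoc)
    then show "y \<in> M #> x" unfolding r_coset_def by blast
  qed
  show "M #> x \<subseteq> M <#> (N #> x)"
  proof
    fix y assume "y \<in> M #> x"
    then obtain m where "m \<in> M" "y = m \<otimes> x" by (auto simp: r_coset_def)
    then show "y \<in> M <#> (N #> x)"
      using rcos_self[OF x N(1)] by (auto simp: set_mult_def)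
  qed
qed

section \<open>Inflation\<close>

locale inflation_setup = cohomology G T p + N: normal N G + M: normal M G
  for G (structure) and T and p and N M +
  assumes N_sub_M: "N \<subseteq> M"
begin

sublocale qN: quotient_cohomology G T p N by unfold_locales
sublocale qM: quotient_cohomology G T p M by unfold_locales

definition infl :: "('a set \<times> 'a set \<Rightarrow> int) \<Rightarrow> 'a set \<times> 'a set \<Rightarrow> int" where
  "infl z = (\<lambda>(A, B)\<in>carrier (G Mod N) \<times> carrier (G Mod N). z (M <#> A, M <#> B))"

lemma infl_apply: "x \<in> carrier G \<Longrightarrow> y \<in> carrier G \<Longrightarrow> infl z (N #> x, N #> y) = z (M #> x, M #> y)"
  using set_mult_rcoset_absorb[OF M.subgroup_axioms N.subgroup_axioms N_sub_M] qN.pi_in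
  by (simp add: infl_def)

lemma infl_cocycle:
  assumes z: "z \<in> carrier qM.Q.Z2"
  shows "infl z \<in> carrier qN.Q.Z2"
  unfolding qN.Q.Z2_iff
proof
  have lc: "loc_const (prod_topology T T) (\<lambda>q. z (M #> fst q, M #> snd q))"
    using z by (simp add: qM.Q.Z2_iff qM.Q.C2_iff qM.loc_const_pi2_iff)
  show "infl z \<in> carrier qN.Q.C2"
    unfolding qN.Q.C2_iff
  proof (intro conjI ballI)
    show "infl z \<in> extensional (carrier (G Mod N) \<times> carrier (G Mod N))" by (simp add: infl_def)
    show "loc_const (prod_topology qN.TN qN.TN) (infl z)"
      unfolding qN.loc_const_pi2_iff using lc
      by (rule loc_const_cong[rotated]) (auto simp: topspace_eq infl_apply)
    fix A B assume "A \<in> carrier (G Mod N)" "B \<in> carrier (G Mod N)"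
    then obtain x y where "x \<in> carrier G" "y \<in> carrier G" "A = N #> x" "B = N #> y"
      by (auto simp: carrier_FactGroup)
    then show "0 \<le> infl z (A, B)" "infl z (A, B) < int p"
      using z qM.pi_in by (auto simp: qM.Q.Z2_iff qM.Q.C2_iff infl_apply)
  qed
  show "qN.Q.cocycle_eq (infl z)"
    unfolding qN.Q_cocycle_eq_iff
    using z unfolding qM.Q.Z2_iff qM.Q_cocycle_eq_iff
    by (auto simp: infl_apply elim!: cocycle_eq_cong_mod)
qed

lemma infl_mult:
  "infl (z \<otimes>\<^bsub>qM.Q.Z2\<^esub> z') = infl z \<otimes>\<^bsub>qN.Q.Z2\<^esub> infl z'"
proof (rule extensionalityI[of _ "carrier (G Mod N) \<times> carrier (G Mod N)"])
  fix q assume "q \<in> carrier (G Mod N) \<times> carrier (G Mod N)"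
  then obtain x y where q: "q = (N #> x, N #> y)" "x \<in> carrier G" "y \<in> carrier G"
    by (auto simp: carrier_FactGroup)
  then show "infl (z \<otimes>\<^bsub>qM.Q.Z2\<^esub> z') q = (infl z \<otimes>\<^bsub>qN.Q.Z2\<^esub> infl z') q"
    by (simp add: infl_apply qM.Q.Z2_mult qN.Q.Z2_mult qM.pi_in qN.pi_in)
qed (simp_all add: infl_def qN.Q.Z2_mult)

lemma infl_trivial_iff:
  assumes z: "z \<in> carrier qM.Q.Z2"
  shows "qN.Q.cls (infl z) = \<one>\<^bsub>qN.Q.H2G\<^esub> \<longleftrightarrow>
    (\<exists>c. loc_const T c \<and> (\<forall>n\<in>N. \<forall>x\<in>carrier G. c (n \<otimes> x) = c x) \<and>
      (\<forall>x\<in>carrier G. \<forall>y\<in>carrier G. int p dvd z (M #> x, M #> y) - dd c (x, y)))"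
  unfolding qN.Q_cls_trivial_iff[OF infl_cocycle[OF z]] by (simp add: infl_apply)

lemma infl_B2: "b \<in> qM.Q.B2 \<Longrightarrow> infl b \<in> qN.Q.B2"
proof -
  assume b: "b \<in> qM.Q.B2"
  then have bZ: "b \<in> carrier qM.Q.Z2" by (simp add: qM.Q.B2_iff)
  have "qM.Q.cls b = \<one>\<^bsub>qM.Q.H2G\<^esub>" using b qM.Q.cls_one_iff[OF bZ] by simp
  then have "qN.Q.cls (infl b) = \<one>\<^bsub>qN.Q.H2G\<^esub>"
    unfolding infl_trivial_iff[OF bZ] qM.Q_cls_trivial_iff[OF bZ] using N_sub_M by blast
  then show ?thesis using qN.Q.cls_one_iff[OF infl_cocycle[OF bZ]] by simp
qed

text \<open>Inflation maps coboundaries to coboundaries, so the inflated cocycles of a class differ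
  by coboundaries; multiplying by all coboundaries of the quotient by N then yields exactly one
  class.\<close>

lemma inflation2_cls:
  assumes z: "z \<in> carrier qM.Q.Z2"
  shows "inflation2 p G T M N (qM.Q.cls z) = qN.Q.cls (infl z)"
proof -
  interpret ZN: comm_group qN.Q.Z2 by (rule qN.Q.Z2_group)
  interpret ZM: comm_group qM.Q.Z2 by (rule qM.Q.Z2_group)
  have BN: "b \<in> carrier qN.Q.Z2" if "b \<in> qN.Q.B2" for b
    using that by (simp add: qN.Q.B2_iff)
  have iz: "infl z \<in> carrier qN.Q.Z2" using infl_cocycle[OF z] .
  have "(\<lambda>z. \<lambda>(A, B)\<in>carrier qN.GN \<times> carrier qN.GN. z (M <#> A, M <#> B)) = infl"
    by (rule ext) (simp add: infl_def)
  then have "inflation2 p G T M N (qM.Q.cls z) = qN.Q.B2 <#>\<^bsub>qN.Q.Z2\<^esub> infl ` qM.Q.cls z"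
    unfolding inflation2_def by (rule arg_cong[where f = "\<lambda>h. qN.Q.B2 <#>\<^bsub>qN.Q.Z2\<^esub> h ` qM.Q.cls z"])
  moreover have "qM.Q.cls z = {b \<otimes>\<^bsub>qM.Q.Z2\<^esub> z | b. b \<in> qM.Q.B2}"
    by (auto simp: H2_class_def r_coset_def)
  ultimately have "inflation2 p G T M N (qM.Q.cls z) = {b' \<otimes>\<^bsub>qN.Q.Z2\<^esub> infl (b \<otimes>\<^bsub>qM.Q.Z2\<^esub> z) | b' b. b' \<in> qN.Q.B2 \<and> b \<in> qM.Q.B2}"
    unfolding set_mult_def by auto
  also have "\<dots> = {b' \<otimes>\<^bsub>qN.Q.Z2\<^esub> infl z | b'. b' \<in> qN.Q.B2}"
  proof (intro equalityI subsetI)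
    fix w assume "w \<in> {b' \<otimes>\<^bsub>qN.Q.Z2\<^esub> infl (b \<otimes>\<^bsub>qM.Q.Z2\<^esub> z) | b' b. b' \<in> qN.Q.B2 \<and> b \<in> qM.Q.B2}"
    then obtain b b' where b: "b' \<in> qN.Q.B2" "b \<in> qM.Q.B2"
      and w: "w = b' \<otimes>\<^bsub>qN.Q.Z2\<^esub> (infl b \<otimes>\<^bsub>qN.Q.Z2\<^esub> infl z)"
      by (auto simp: infl_mult)
    then have "w = (b' \<otimes>\<^bsub>qN.Q.Z2\<^esub> infl b) \<otimes>\<^bsub>qN.Q.Z2\<^esub> infl z"
      using BN infl_B2 iz by (simp add: ZN.m_assoc)
    moreover have "b' \<otimes>\<^bsub>qN.Q.Z2\<^esub> infl b \<in> qN.Q.B2"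
      using b infl_B2 subgroup.m_closed[OF qN.Q.B2_subgroup] by simp
    ultimately show "w \<in> {b' \<otimes>\<^bsub>qN.Q.Z2\<^esub> infl z | b'. b' \<in> qN.Q.B2}" by blast
  next
    fix w assume "w \<in> {b' \<otimes>\<^bsub>qN.Q.Z2\<^esub> infl z | b'. b' \<in> qN.Q.B2}"
    then obtain b' where "b' \<in> qN.Q.B2" "w = b' \<otimes>\<^bsub>qN.Q.Z2\<^esub> infl (\<one>\<^bsub>qM.Q.Z2\<^esub> \<otimes>\<^bsub>qM.Q.Z2\<^esub> z)"
      using z by auto
    then show "w \<in> {b' \<otimes>\<^bsub>qN.Q.Z2\<^esub> infl (b \<otimes>\<^bsub>qM.Q.Z2\<^esub> z) | b' b. b' \<in> qN.Q.B2 \<and> b \<in> qM.Q.B2}"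
      using subgroup.one_closed[OF qM.Q.B2_subgroup] by blast
  qed
  finally show ?thesis by (auto simp: H2_class_def r_coset_def)
qed

end

section \<open>Transgression\<close>

lemma dvd_range_zero: "k dvd a \<Longrightarrow> 0 \<le> a \<Longrightarrow> a < k \<Longrightarrow> a = (0 :: int)"
  using zdvd_not_zless[of a k] by linarith

lemma (in top_group) loc_constI:
  assumes W: "subgroup W G" "openin T W"
    and inv: "\<And>w x. w \<in> W \<Longrightarrow> x \<in> carrier G \<Longrightarrow> f (w \<otimes> x) = f x"
  shows "loc_const T f"
  unfolding continuous_map_def
proof (intro conjI allI impI)
  fix U
  show "openin T {x \<in> topspace T. f x \<in> U}"
  proof (subst openin_subopen, rule ballI)
    fix x assume x: "x \<in> {x \<in> topspace T. f x \<in> U}"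
    then have xc: "x \<in> carrier G" by (simp add: topspace_eq)
    let ?V = "{y \<in> carrier G. \<one> \<otimes> y \<otimes> inv x \<in> W}"
    have "f y = f x" if "y \<in> ?V" for y
    proof -
      have y: "y \<in> carrier G" "y \<otimes> inv x \<in> W" using that by auto
      have "f (y \<otimes> inv x \<otimes> x) = f x" by (rule inv[OF y(2) xc])
      then show ?thesis using y(1) xc by (simp add: group_simps)
    qed
    then have "?V \<subseteq> {x \<in> topspace T. f x \<in> U}" using x by (auto simp: topspace_eq)
    moreover have "openin T ?V" using W(2) xc by (intro openin_translate) auto
    moreover have "x \<in> ?V" using xc subgroup.one_closed[OF W(1)] by simp
    ultimately show "\<exists>V. openin T V \<and> x \<in> V \<and> V \<subseteq> {x \<in> topspace T. f x \<in> U}" by blast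
  qed
qed simp

lemma (in profinite) loc_const_invariant:
  assumes "loc_const T f"
  obtains W where "W \<lhd> G" "openin T W"
    "\<And>w x. w \<in> W \<Longrightarrow> x \<in> carrier G \<Longrightarrow> f (x \<otimes> w) = f x"
    "\<And>w x. w \<in> W \<Longrightarrow> x \<in> carrier G \<Longrightarrow> f (w \<otimes> x) = f x"
proof -
  obtain W where W: "W \<lhd> G" "openin T W"
    "\<And>g x y z. g \<in> W \<Longrightarrow> x \<in> carrier G \<Longrightarrow> y \<in> carrier G \<Longrightarrow> z \<in> topspace T
      \<Longrightarrow> f (fst (x \<otimes> g \<otimes> y, z)) = f (fst (x \<otimes> y, z))"
    using open_normal_invariance[OF loc_const_pull[OF assms continuous_map_fst] compact] by metis
  have Wc: "w \<in> carrier G" if "w \<in> W" for w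
    using that openin_subset[OF W(2)] topspace_eq by blast
  have "f (x \<otimes> w) = f x" "f (w \<otimes> x) = f x" if "w \<in> W" "x \<in> carrier G" for w x
    using W(3)[OF that(1) that(2) one_closed, of \<one>] W(3)[OF that(1) one_closed that(2), of \<one>]
      that Wc topspace_eq by simp_all
  then show thesis using that W(1,2) by blast
qed

text \<open>The assumptions are the two facts on which the five-term sequence relies here, in terms
  of cochains: homomorphisms from G to the coefficients vanish on M, which gives injectivity of
  transgression, and H^2(G) = 0, which gives surjectivity.\<close>

locale transgression_setup = profinite_prime G T p + normal M G
  for G (structure) and T and p and M +
  assumes hom_trivial: "\<And>c x. loc_const T c \<Longrightarrow>
      (\<And>x y. x \<in> carrier G \<Longrightarrow> y \<in> carrier G \<Longrightarrow> int p dvd c x + c y - c (x \<otimes> y)) \<Longrightarrow>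
      x \<in> M \<Longrightarrow> int p dvd c x"
    and H2_vanish: "\<And>z. loc_const (prod_topology T T) z \<Longrightarrow>
      (\<And>x y w. x \<in> carrier G \<Longrightarrow> y \<in> carrier G \<Longrightarrow> w \<in> carrier G \<Longrightarrow>
        int p dvd z (y, w) - z (x \<otimes> y, w) + z (x, y \<otimes> w) - z (x, y)) \<Longrightarrow>
      \<exists>c. loc_const T c \<and>
        (\<forall>x\<in>carrier G. \<forall>y\<in>carrier G. int p dvd z (x, y) - (c x + c y - c (x \<otimes> y)))"
begin

sublocale quotient_cohomology G T p M
  using p prime_gt_0_nat by unfold_locales blast

abbreviation "H1G \<equiv> H1_invariants p G T M"
abbreviation "TM \<equiv> subtopology T M"
abbreviation "trg \<equiv> transgression p G T M"

lemma topspace_TM: "topspace TM = M"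
  using subset by (auto simp: topspace_eq)

lemma H1_iff: "\<psi> \<in> carrier H1G \<longleftrightarrow> \<psi> \<in> carrier (cochain_group p TM) \<and>
    (\<forall>x\<in>M. \<forall>y\<in>M. int p dvd \<psi> x + \<psi> y - \<psi> (x \<otimes> y)) \<and>
    (\<forall>g\<in>carrier G. \<forall>x\<in>M. \<psi> (inv g \<otimes> x \<otimes> g) = \<psi> x)"
  by (auto simp: H1_invariants_def cocycles1_def cobd_def fun_eq_iff restrict_def mod_eq_0_iff_dvd)

lemma H1_cochain: "\<psi> \<in> carrier (cochain_group p TM) \<longleftrightarrow>
    \<psi> \<in> extensional M \<and> loc_const TM \<psi> \<and> (\<forall>x\<in>M. 0 \<le> \<psi> x \<and> \<psi> x < int p)"
  using cochain_iff[OF p_pos, of \<psi> TM] by (simp only: topspace_TM)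

lemma H1_mult: "\<psi> \<otimes>\<^bsub>H1G\<^esub> \<psi>' = (\<lambda>x\<in>M. (\<psi> x + \<psi>' x) mod int p)"
  unfolding H1_invariants_def by (simp add: cochain_mult topspace_TM del: topspace_subtopology)

lemma H1_one: "\<one>\<^bsub>H1G\<^esub> = (\<lambda>x\<in>M. 0)"
  unfolding H1_invariants_def by (simp add: cochain_one topspace_TM del: topspace_subtopology)

lemma H1_modI:
  assumes "loc_const TM f" and "\<And>x y. x \<in> M \<Longrightarrow> y \<in> M \<Longrightarrow> int p dvd f x + f y - f (x \<otimes> y)"
    and "\<And>g x. g \<in> carrier G \<Longrightarrow> x \<in> M \<Longrightarrow> int p dvd f (inv g \<otimes> x \<otimes> g) - f x"
  shows "(\<lambda>x\<in>M. f x mod int p) \<in> carrier H1G"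
  unfolding H1_iff
proof (intro conjI ballI)
  show "(\<lambda>x\<in>M. f x mod int p) \<in> carrier (cochain_group p TM)"
    using cochain_mod[OF p_pos assms(1)] by (simp only: topspace_TM)
  fix x y assume xy: "x \<in> M" "y \<in> M"
  have "(f x mod int p + f y mod int p - f (x \<otimes> y) mod int p) mod int p = (f x + f y - f (x \<otimes> y)) mod int p"
    by (intro mod_diff_cong mod_add_cong) simp_all
  then show "int p dvd (\<lambda>x\<in>M. f x mod int p) x + (\<lambda>x\<in>M. f x mod int p) y - (\<lambda>x\<in>M. f x mod int p) (x \<otimes> y)"
    using assms(2)[OF xy] xy unfolding mod_eq_0_iff_dvd[symmetric] by simp
next
  fix g x assume "g \<in> carrier G" "x \<in> M"
  then show "(\<lambda>x\<in>M. f x mod int p) (inv g \<otimes> x \<otimes> g) = (\<lambda>x\<in>M. f x mod int p) x"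
    using assms(3) inv_op_closed1 by (simp add: mod_eq_dvd_iff)
qed

lemma H1_comm_group: "comm_group H1G"
proof -
  interpret C: comm_group "cochain_group p TM" by (rule cochain_comm_group[OF p_pos])
  have "subgroup (carrier H1G) (cochain_group p TM)"
  proof (rule C.subgroupI)
    show "carrier H1G \<subseteq> carrier (cochain_group p TM)" by (auto simp: H1_iff)
    have "(\<lambda>x\<in>M. 0 mod int p) \<in> carrier H1G" by (rule H1_modI) auto
    then show "carrier H1G \<noteq> {}" by blast
    fix \<psi> assume \<psi>: "\<psi> \<in> carrier H1G"
    then have lc: "loc_const TM \<psi>" by (simp add: H1_iff H1_cochain)
    have "int p dvd - \<psi> x + - \<psi> y - - \<psi> (x \<otimes> y)" if "x \<in> M" "y \<in> M" for x y
    proof -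
      have "int p dvd - (\<psi> x + \<psi> y - \<psi> (x \<otimes> y))"
        using \<psi> that by (subst dvd_minus_iff) (simp add: H1_iff)
      then show ?thesis by (simp add: algebra_simps)
    qed
    then have "(\<lambda>x\<in>M. (- \<psi> x) mod int p) \<in> carrier H1G"
      using \<psi> by (intro H1_modI loc_const_uminus lc) (auto simp: H1_iff)
    then show "inv\<^bsub>cochain_group p TM\<^esub> \<psi> \<in> carrier H1G"
      using \<psi> cochain_inv[OF p_pos, of \<psi> TM] by (simp add: H1_iff topspace_TM del: topspace_subtopology)
    fix \<psi>' assume \<psi>': "\<psi>' \<in> carrier H1G"
    then have lc': "loc_const TM \<psi>'" by (simp add: H1_iff H1_cochain)
    have "int p dvd (\<psi> x + \<psi>' x) + (\<psi> y + \<psi>' y) - (\<psi> (x \<otimes> y) + \<psi>' (x \<otimes> y))" if "x \<in> M" "y \<in> M" for x y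
    proof -
      have "int p dvd (\<psi> x + \<psi> y - \<psi> (x \<otimes> y)) + (\<psi>' x + \<psi>' y - \<psi>' (x \<otimes> y))"
        using \<psi> \<psi>' that by - (rule dvd_add, auto simp: H1_iff)
      then show ?thesis by (simp add: algebra_simps)
    qed
    then have "(\<lambda>x\<in>M. (\<psi> x + \<psi>' x) mod int p) \<in> carrier H1G"
      using \<psi> \<psi>' by (intro H1_modI loc_const_add lc lc') (auto simp: H1_iff)
    then show "\<psi> \<otimes>\<^bsub>cochain_group p TM\<^esub> \<psi>' \<in> carrier H1G"
      by (simp add: cochain_mult topspace_TM del: topspace_subtopology)
  qed
  then have "group (cochain_group p TM\<lparr>carrier := carrier H1G\<rparr>)"
    by (rule subgroup.subgroup_is_group[OF _ C.is_group])
  then have "group H1G" by (simp add: H1_invariants_def)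
  then show ?thesis
    by (rule group.group_comm_groupI) (auto simp: H1_mult add.commute)
qed

text \<open>The witnesses in the description of \<open>transgression\<close>, with equalities
  weakened to congruences.\<close>

definition trg_data :: "('a \<Rightarrow> int) \<Rightarrow> ('a \<Rightarrow> int) \<Rightarrow> ('a set \<times> 'a set \<Rightarrow> int) \<Rightarrow> bool" where
  "trg_data \<psi> y z \<longleftrightarrow> loc_const T y \<and> z \<in> carrier Q.Z2 \<and> (\<forall>x\<in>M. int p dvd y x - \<psi> x) \<and>
     (\<forall>x\<in>carrier G. \<forall>x'\<in>carrier G. int p dvd dd y (x, x') - z (\<pi> x, \<pi> x'))"

lemma H1_one_val: "\<psi> \<in> carrier H1G \<Longrightarrow> int p dvd \<psi> \<one>"
  using one_closed unfolding H1_iff by fastforce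

lemma H1_one_eq_0: "\<psi> \<in> carrier H1G \<Longrightarrow> \<psi> \<one> = 0"
  using dvd_range_zero[OF H1_one_val] one_closed unfolding H1_iff H1_cochain by blast

lemma H1_open_normal:
  assumes \<psi>: "\<psi> \<in> carrier H1G"
  obtains W where "W \<lhd> G" "openin T W" "\<And>x. x \<in> W \<inter> M \<Longrightarrow> \<psi> x = 0"
proof -
  have "openin TM {x \<in> topspace TM. \<psi> x \<in> {0}}"
    using \<psi> by (intro openin_continuous_map_preimage[of TM "discrete_topology UNIV"]) (auto simp: H1_iff H1_cochain)
  then obtain O' where O': "openin T O'" "{x \<in> M. \<psi> x = 0} = O' \<inter> M"
    by (auto simp: openin_subtopology topspace_TM simp del: topspace_subtopology)
  then have "\<one> \<in> O'" using H1_one_eq_0[OF \<psi>] one_closed by blast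
  then obtain W where W: "W \<lhd> G" "openin T W" "W \<subseteq> O'"
    using open_normal_subset[OF O'(1)] by blast
  then show thesis using that O'(2) by blast
qed

text \<open>Modulo p, \<open>dd y (m, x)\<close> depends on cosets only, so it agrees with
  \<open>dd y (\<one>, x) = y \<one>\<close>, which is congruent to \<open>\<psi> \<one>\<close> and
  so to 0.\<close>

lemma trg_data_translate:
  assumes \<psi>: "\<psi> \<in> carrier H1G" and d: "trg_data \<psi> y z" and m: "m \<in> M" and x: "x \<in> carrier G"
  shows "int p dvd y (m \<otimes> x) - \<psi> m - y x"
proof -
  have mc: "m \<in> carrier G" using m by (rule mem_carrier)
  have "\<pi> m = \<pi> \<one>" using m mc pi_eq_iff[of \<one> m] by auto
  moreover have "int p dvd dd y (m, x) - z (\<pi> m, \<pi> x)" "int p dvd dd y (\<one>, x) - z (\<pi> \<one>, \<pi> x)"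
    using d x mc by (auto simp: trg_data_def)
  ultimately have "int p dvd dd y (m, x) - z (\<pi> \<one>, \<pi> x)" "int p dvd dd y (\<one>, x) - z (\<pi> \<one>, \<pi> x)"
    by simp_all
  from dvd_diff[OF this] have "int p dvd dd y (m, x) - dd y (\<one>, x)" by simp
  moreover have "int p dvd y \<one> - \<psi> \<one>" "int p dvd y m - \<psi> m"
    using d m one_closed by (auto simp: trg_data_def)
  ultimately have "int p dvd - (dd y (m, x) - dd y (\<one>, x)) + (y m - \<psi> m) - (y \<one> - \<psi> \<one>) - \<psi> \<one>"
    using H1_one_val[OF \<psi>] by (meson dvd_add dvd_diff dvd_minus_iff)
  then show ?thesis using x by (simp add: dd_apply algebra_simps)
qed

text \<open>Uniqueness behind the definite description: two extensions of \<open>\<psi>\<close> obey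
  the same translation rule, so their difference is M-invariant modulo p, descends to G / M and
  bounds the difference of the two cocycles.\<close>

lemma trg_eq:
  assumes \<psi>: "\<psi> \<in> carrier H1G" and d: "trg_data \<psi> y z"
  shows "trg \<psi> = Q.cls z"
proof -
  define y' where "y' = (\<lambda>x\<in>carrier G. y x mod int p)"
  have lc: "loc_const T y" and zZ: "z \<in> carrier Q.Z2" using d by (auto simp: trg_data_def)
  have y': "y' \<in> carrier C1"
    using cochain_mod[OF p_pos lc] by (simp add: y'_def topspace_eq)
  have z_range: "z (\<pi> x, \<pi> x') mod int p = z (\<pi> x, \<pi> x')" if "x \<in> carrier G" "x' \<in> carrier G" for x x'
    using zZ pi_in[OF that(1)] pi_in[OF that(2)]
    by (intro mod_pos_pos_trivial) (auto simp: Q.Z2_iff Q.C2_iff)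
  have ex: "(\<forall>x\<in>M. y' x = \<psi> x) \<and> (\<forall>x\<in>carrier G. \<forall>x'\<in>carrier G. cobd p G y' (x, x') = z (\<pi> x, \<pi> x'))"
  proof (intro conjI ballI)
    fix x assume x: "x \<in> M"
    have "y x mod int p = \<psi> x mod int p" using d x by (simp add: trg_data_def mod_eq_dvd_iff)
    also have "\<dots> = \<psi> x" using \<psi> x by (intro mod_pos_pos_trivial) (auto simp: H1_iff H1_cochain)
    finally show "y' x = \<psi> x" using x by (simp add: y'_def)
  next
    fix x x' assume c: "x \<in> carrier G" "x' \<in> carrier G"
    have "dd y' (x, x') mod int p = dd y (x, x') mod int p"
      unfolding dd_apply using c by (intro mod_diff_cong mod_add_cong) (simp_all add: y'_def)
    also have "\<dots> = z (\<pi> x, \<pi> x') mod int p"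
      using d c by (simp add: trg_data_def mod_eq_dvd_iff)
    finally show "cobd p G y' (x, x') = z (\<pi> x, \<pi> x')"
      using c z_range by (simp add: cobd_eq)
  qed
  have uniq: "Q.cls w = Q.cls z"
    if u: "u \<in> carrier C1" and w: "w \<in> carrier Q.Z2" and "\<forall>x\<in>M. u x = \<psi> x"
      and dw: "\<forall>x\<in>carrier G. \<forall>x'\<in>carrier G. cobd p G u (x, x') = w (\<pi> x, \<pi> x')" for u w
  proof -
    have "int p dvd dd u (x, x') - w (\<pi> x, \<pi> x')" if "x \<in> carrier G" "x' \<in> carrier G" for x x'
    proof -
      have "w (\<pi> x, \<pi> x') = dd u (x, x') mod int p"
        using bspec[OF bspec[OF dw that(1)] that(2)] that by (simp add: cobd_eq)
      then show ?thesis by (simp add: dvd_minus_mod)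
    qed
    then have du: "trg_data \<psi> u w"
      using that by (auto simp: trg_data_def C1_iff)
    define c where "c x = (u x - y x) mod int p" for x
    have "loc_const T (\<lambda>x. u x - y x)" using u lc by (intro loc_const_diff) (simp_all add: C1_iff)
    then have lcc: "loc_const T c" unfolding c_def by (rule loc_const_comp)
    have "c (m \<otimes> x) = c x" if "m \<in> M" "x \<in> carrier G" for m x
    proof -
      have "int p dvd (u (m \<otimes> x) - \<psi> m - u x) - (y (m \<otimes> x) - \<psi> m - y x)"
        using trg_data_translate[OF \<psi> du that] trg_data_translate[OF \<psi> d that] by (rule dvd_diff)
      then show ?thesis by (simp add: c_def mod_eq_dvd_iff algebra_simps)
    qed
    then obtain c' where c': "loc_const TN c'" "\<And>x. x \<in> carrier G \<Longrightarrow> c' (\<pi> x) = c x"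
      using descend[OF lcc] by blast
    show ?thesis
    proof (rule Q.cls_eqI[OF w zZ c'(1)])
      fix A B assume "A \<in> carrier GN" "B \<in> carrier GN"
      then obtain x x' where x: "x \<in> carrier G" "x' \<in> carrier G" "A = \<pi> x" "B = \<pi> x'"
        by (auto simp: carrier_FactGroup)
      have "int p dvd (dd y (x, x') - z (A, B)) - (dd u (x, x') - w (A, B))"
        using d du x by - (rule dvd_diff, auto simp: trg_data_def)
      moreover have "(dd u (x, x') - dd y (x, x')) mod int p = Q.dd c' (A, B) mod int p"
      proof -
        have "dd u (x, x') - dd y (x, x') = (u x - y x) + (u x' - y x') - (u (x \<otimes> x') - y (x \<otimes> x'))"
          by (simp add: dd_apply)
        also have "\<dots> mod int p = (c x + c x' - c (x \<otimes> x')) mod int p"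
          by (intro mod_diff_cong mod_add_cong) (simp_all add: c_def)
        finally show ?thesis using x c'(2) by (simp add: Q.dd_apply rcos_sum)
      qed
      then have "int p dvd dd u (x, x') - dd y (x, x') - Q.dd c' (A, B)" by (simp add: mod_eq_dvd_iff)
      ultimately have "int p dvd ((dd y (x, x') - z (A, B)) - (dd u (x, x') - w (A, B)))
          + (dd u (x, x') - dd y (x, x') - Q.dd c' (A, B))" by (rule dvd_add)
      then show "int p dvd w (A, B) - z (A, B) - Q.dd c' (A, B)" by (simp add: algebra_simps)
    qed
  qed
  show ?thesis
    unfolding transgression_def
    by (rule the_equality) (use y' zZ ex uniq in blast)+
qed

lemma trg_data_add:
  assumes d: "trg_data \<psi> y z" "trg_data \<psi>' y' z'"
  shows "trg_data (\<psi> \<otimes>\<^bsub>H1G\<^esub> \<psi>') (\<lambda>x. y x + y' x) (z \<otimes>\<^bsub>Q.Z2\<^esub> z')"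
  unfolding trg_data_def
proof (intro conjI ballI)
  interpret Z2: comm_group Q.Z2 by (rule Q.Z2_group)
  show "loc_const T (\<lambda>x. y x + y' x)" using d by (intro loc_const_add) (auto simp: trg_data_def)
  show "z \<otimes>\<^bsub>Q.Z2\<^esub> z' \<in> carrier Q.Z2" using d by (intro Z2.m_closed) (auto simp: trg_data_def)
  fix x assume x: "x \<in> M"
  have "int p dvd (y x - \<psi> x) + (y' x - \<psi>' x)" using d x by - (rule dvd_add, auto simp: trg_data_def)
  then have "(y x + y' x) mod int p = (\<psi> x + \<psi>' x) mod int p" by (simp add: mod_eq_dvd_iff algebra_simps)
  then show "int p dvd y x + y' x - (\<psi> \<otimes>\<^bsub>H1G\<^esub> \<psi>') x"
    using x by (simp add: H1_mult mod_eq_dvd_iff[symmetric])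
next
  fix x x' assume c: "x \<in> carrier G" "x' \<in> carrier G"
  have "int p dvd (dd y (x, x') - z (\<pi> x, \<pi> x')) + (dd y' (x, x') - z' (\<pi> x, \<pi> x'))"
    using d c by - (rule dvd_add, auto simp: trg_data_def)
  then have "dd (\<lambda>x. y x + y' x) (x, x') mod int p = (z (\<pi> x, \<pi> x') + z' (\<pi> x, \<pi> x')) mod int p"
    by (simp add: mod_eq_dvd_iff dd_apply algebra_simps)
  then show "int p dvd dd (\<lambda>x. y x + y' x) (x, x') - (z \<otimes>\<^bsub>Q.Z2\<^esub> z') (\<pi> x, \<pi> x')"
    using c pi_in by (simp add: Q.Z2_mult mod_eq_dvd_iff[symmetric])
qed

text \<open>\<open>\<psi>\<close> is first carried over to the open subgroup P = W M, where it is
  still a homomorphism modulo p. For an open subgroup, representatives of the cosets can be chosen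
  arbitrarily without harm to continuity, so y can be \<open>\<psi>'\<close> of the P-part of x;
  this takes the place of a continuous section of G over G / M.\<close>

lemma trg_data_exists:
  assumes \<psi>: "\<psi> \<in> carrier H1G"
  obtains y z where "trg_data \<psi> y z"
proof -
  note M = subgroup_axioms
  have hom: "int p dvd \<psi> (x \<otimes> y) - \<psi> x - \<psi> y" if "x \<in> M" "y \<in> M" for x y
  proof -
    have "int p dvd - (\<psi> x + \<psi> y - \<psi> (x \<otimes> y))"
      using \<psi> that by (subst dvd_minus_iff) (simp add: H1_iff)
    then show ?thesis by (simp add: algebra_simps)
  qed
  have \<psi>1: "\<psi> \<one> = 0" using \<psi> by (rule H1_one_eq_0)
  obtain W where W: "W \<lhd> G" "openin T W" and WM: "\<And>x. x \<in> W \<inter> M \<Longrightarrow> \<psi> x = 0"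
    using H1_open_normal[OF \<psi>] by blast
  interpret W: normal W G by (rule W(1))
  obtain \<psi>' where \<psi>': "\<And>x s. s \<in> M \<Longrightarrow> W #> x = W #> s \<Longrightarrow> int p dvd \<psi>' x - \<psi> s"
  proof -
    have "\<exists>\<psi>'. \<forall>x. \<forall>s\<in>M. W #> x = W #> s \<longrightarrow> int p dvd \<psi>' x - \<psi> s"
      using hom WM by (intro hom_factor_mod[OF W(1) M]) auto
    then show thesis using that by blast
  qed
  define P where "P = {q \<in> carrier G. \<exists>m\<in>M. W #> q = W #> m}"
  interpret h: group_hom G "G Mod W" "\<lambda>x. W #> x"
    using W.r_coset_hom_Mod W.factorgroup_is_group is_group
    by (simp add: group_hom_def group_hom_axioms_def)
  have P: "subgroup P G"
    unfolding P_def using W(1) M by (rule subgroup_mod)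
  have Pc: "q \<in> carrier G" if "q \<in> P" for q using that by (simp add: P_def)
  have \<psi>'_mult: "int p dvd \<psi>' (q \<otimes> q') - \<psi>' q - \<psi>' q'" if "q \<in> P" "q' \<in> P" for q q'
  proof -
    obtain s t where s: "q \<in> carrier G" "s \<in> M" "W #> q = W #> s"
      and t: "q' \<in> carrier G" "t \<in> M" "W #> q' = W #> t"
      using \<open>q \<in> P\<close> \<open>q' \<in> P\<close> by (auto simp: P_def)
    have "W #> (q \<otimes> q') = W #> (s \<otimes> t)" using s t mem_carrier h.hom_mult by metis
    then have "int p dvd \<psi>' (q \<otimes> q') - \<psi> (s \<otimes> t)" by (rule \<psi>'[OF m_closed[OF s(2) t(2)]])
    from dvd_diff[OF dvd_diff[OF dvd_add[OF this hom[OF s(2) t(2)]] \<psi>'[OF s(2,3)]] \<psi>'[OF t(2,3)]]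
    show ?thesis by (simp add: algebra_simps)
  qed
  have MP: "m \<in> P" if "m \<in> M" for m using that mem_carrier by (auto simp: P_def)
  have \<psi>'_W: "int p dvd \<psi>' w" and WP: "w \<in> P" if "w \<in> W" for w
  proof -
    have 1: "W #> w = W #> \<one>" using that W.rcos_const W.subset by simp
    then show "int p dvd \<psi>' w" using \<psi>'[OF one_closed 1] \<psi>1 by simp
    show "w \<in> P" unfolding P_def using 1 one_closed W.mem_carrier[OF that] by blast
  qed
  \<comment> \<open>The representative of P itself is \<open>\<one>\<close>, so that y extends
    \<open>\<psi>\<close>.\<close>
  define r where "r x = (if x \<in> P then \<one> else SOME u. u \<in> P #> x)" for x
  have r: "x \<otimes> inv (r x) \<in> P" "r x \<in> carrier G" if x: "x \<in> carrier G" for x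
  proof -
    have "x \<otimes> inv (r x) \<in> P \<and> r x \<in> carrier G"
    proof (cases "x \<in> P")
      case True
      then show ?thesis using x by (simp add: r_def)
    next
      case False
      have "x \<in> P #> x" by (rule rcos_self[OF x P])
      then have "r x \<in> P #> x" unfolding r_def using False by (simp add: someI[of "\<lambda>u. u \<in> P #> x"])
      then obtain q where q: "q \<in> P" "r x = q \<otimes> x" by (auto simp: r_coset_def)
      then have "x \<otimes> inv (r x) = inv q" using x Pc by (simp add: group_simps)
      then show ?thesis using q Pc x subgroup.m_inv_closed[OF P] by simp
    qed
    then show "x \<otimes> inv (r x) \<in> P" "r x \<in> carrier G" by auto
  qed
  have r_mult: "r (q \<otimes> x) = r x" if q: "q \<in> P" and x: "x \<in> carrier G" for q x
  proof -
    have "q \<otimes> x \<in> P \<longleftrightarrow> x \<in> P"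
    proof
      assume "q \<otimes> x \<in> P"
      then have "inv q \<otimes> (q \<otimes> x) \<in> P"
        using q by (auto intro: subgroup.m_closed[OF P] subgroup.m_inv_closed[OF P])
      then show "x \<in> P" using x q Pc by (simp add: inv_mult_cancel)
    qed (use q subgroup.m_closed[OF P] in blast)
    moreover have "P #> (q \<otimes> x) = P #> x"
      using repr_independence[OF _ x P, of "q \<otimes> x"] q by (auto simp: r_coset_def)
    ultimately show ?thesis by (simp add: r_def)
  qed
  define y where "y x = \<psi>' (x \<otimes> inv (r x)) mod int p" for x
  have y_mult: "int p dvd y (q \<otimes> x) - \<psi>' q - y x" if q: "q \<in> P" and x: "x \<in> carrier G" for q x
  proof -
    have "q \<otimes> x \<otimes> inv (r x) = q \<otimes> (x \<otimes> inv (r x))" using q x Pc r by (simp add: m_assoc)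
    then have 1: "int p dvd \<psi>' (q \<otimes> x \<otimes> inv (r x)) - \<psi>' q - \<psi>' (x \<otimes> inv (r x))"
      using \<psi>'_mult[OF q r(1)[OF x]] by simp
    have "(y (q \<otimes> x) - \<psi>' q - y x) mod int p =
        (\<psi>' (q \<otimes> x \<otimes> inv (r x)) - \<psi>' q - \<psi>' (x \<otimes> inv (r x))) mod int p"
      unfolding y_def r_mult[OF q x] by (intro mod_diff_cong) simp_all
    then show ?thesis using 1 unfolding mod_eq_0_iff_dvd[symmetric] by simp
  qed
  have y_M: "int p dvd y m - \<psi> m" if "m \<in> M" for m
  proof -
    have "y m = \<psi>' m mod int p" using MP[OF that] mem_carrier[OF that] by (simp add: y_def r_def)
    then show ?thesis using \<psi>'[OF that refl] by (simp add: mod_eq_dvd_iff[symmetric])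
  qed
  have y_transl: "int p dvd y (m \<otimes> x) - \<psi> m - y x" if "m \<in> M" "x \<in> carrier G" for m x
    using dvd_add[OF y_mult[OF MP[OF that(1)] that(2)] \<psi>'[OF that(1) refl]] by (simp add: algebra_simps)
  have "y (w \<otimes> x) = y x" if "w \<in> W" "x \<in> carrier G" for w x
  proof -
    have "int p dvd (y (w \<otimes> x) - \<psi>' w - y x) + \<psi>' w"
      using y_mult[OF WP[OF that(1)] that(2)] \<psi>'_W[OF that(1)] by (rule dvd_add)
    then have "y (w \<otimes> x) mod int p = y x mod int p" by (simp add: mod_eq_dvd_iff)
    then show ?thesis by (simp add: y_def)
  qed
  then have lc: "loc_const T y"
    by (rule loc_constI[OF W.subgroup_axioms W(2)])
  have "int p dvd dd y (n \<otimes> x, m \<otimes> x') - dd y (x, x')"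
    if n: "n \<in> M" and m: "m \<in> M" and x: "x \<in> carrier G" and x': "x' \<in> carrier G" for n m x x'
  proof -
    \<comment> \<open>Moving m to the left across x conjugates it, which the invariant
      \<open>\<psi>\<close> does not see.\<close>
    let ?m = "x \<otimes> m \<otimes> inv x"
    have m': "?m \<in> M" using inv_op_closed2[OF x m] .
    have "n \<otimes> x \<otimes> (m \<otimes> x') = (n \<otimes> ?m) \<otimes> (x \<otimes> x')"
      using n m x x' mem_carrier by (simp add: group_simps)
    then have 1: "int p dvd y (n \<otimes> x \<otimes> (m \<otimes> x')) - \<psi> (n \<otimes> ?m) - y (x \<otimes> x')"
      using y_transl[OF m_closed[OF n m'], of "x \<otimes> x'"] x x' by simp
    have "\<psi> (inv (inv x) \<otimes> m \<otimes> inv x) = \<psi> m"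
      using \<psi> m x unfolding H1_iff by blast
    then have 2: "\<psi> ?m = \<psi> m" using x by simp
    have "int p dvd (y (n \<otimes> x) - \<psi> n - y x) + (y (m \<otimes> x') - \<psi> m - y x')
        - (y (n \<otimes> x \<otimes> (m \<otimes> x')) - \<psi> (n \<otimes> ?m) - y (x \<otimes> x')) - (\<psi> (n \<otimes> ?m) - \<psi> n - \<psi> ?m)"
      by (rule dvd_diff[OF dvd_diff[OF dvd_add[OF y_transl[OF n x] y_transl[OF m x']] 1] hom[OF n m']])
    then show ?thesis by (simp add: dd_apply 2 algebra_simps)
  qed
  then obtain z where z: "z \<in> carrier Q.Z2"
    "\<And>x x'. x \<in> carrier G \<Longrightarrow> x' \<in> carrier G \<Longrightarrow> z (\<pi> x, \<pi> x') = dd y (x, x') mod int p"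
    using Q_cocycleI[OF loc_const_dd[OF lc] cocycle_eq_dd] by blast
  have "trg_data \<psi> y z"
    unfolding trg_data_def using lc z y_M by (simp add: mod_eq_dvd_iff[symmetric])
  then show thesis by (rule that)
qed

text \<open>y and c have congruent coboundaries, so y - c is a homomorphism modulo p on G and
  vanishes on M by \<open>hom_trivial\<close>; on N the function c is constant. With N = M this
  gives injectivity of transgression, in general the kernel of inflation.\<close>

lemma trg_data_vanish:
  assumes \<psi>: "\<psi> \<in> carrier H1G" and d: "trg_data \<psi> y z"
    and c: "loc_const T c" and NM: "N \<subseteq> M"
    and inv: "\<And>n x. n \<in> N \<Longrightarrow> x \<in> carrier G \<Longrightarrow> c (n \<otimes> x) = c x"
    and dc: "\<And>x x'. x \<in> carrier G \<Longrightarrow> x' \<in> carrier G \<Longrightarrow> int p dvd z (\<pi> x, \<pi> x') - dd c (x, x')"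
    and n: "n \<in> N"
  shows "\<psi> n = 0"
proof -
  have nM: "n \<in> M" using NM n by blast
  have "loc_const T (\<lambda>x. y x - c x)" using d c by (intro loc_const_diff) (auto simp: trg_data_def)
  moreover have "int p dvd (y x - c x) + (y x' - c x') - (y (x \<otimes> x') - c (x \<otimes> x'))"
    if "x \<in> carrier G" "x' \<in> carrier G" for x x'
  proof -
    have "int p dvd (dd y (x, x') - z (\<pi> x, \<pi> x')) + (z (\<pi> x, \<pi> x') - dd c (x, x'))"
      using d that dc by - (rule dvd_add, auto simp: trg_data_def)
    then show ?thesis by (simp add: dd_apply algebra_simps)
  qed
  ultimately have "int p dvd y x - c x" if "x \<in> M" for x using hom_trivial that by blast
  from this[OF nM] this[OF one_closed] have "int p dvd (y n - c n) - (y \<one> - c \<one>)" by (rule dvd_diff)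
  moreover have "c n = c \<one>" using inv[OF n, of \<one>] nM mem_carrier by simp
  moreover have "int p dvd y \<one> - \<psi> \<one>" "int p dvd y n - \<psi> n"
    using d nM one_closed by (auto simp: trg_data_def)
  ultimately have "int p dvd (y n - c n) - (y \<one> - c \<one>) - (y n - \<psi> n) + (y \<one> - \<psi> \<one>) + \<psi> \<one>"
    using H1_one_val[OF \<psi>] by (meson dvd_add dvd_diff)
  then have "int p dvd \<psi> n" using \<open>c n = c \<one>\<close> by (simp add: algebra_simps)
  moreover have "0 \<le> \<psi> n" "\<psi> n < int p" using \<psi> nM by (auto simp: H1_iff H1_cochain)
  ultimately show ?thesis by (rule dvd_range_zero)
qed

lemma trg_hom: "trg \<in> hom H1G Q.H2G"
proof (rule homI)
  interpret H1: comm_group H1G by (rule H1_comm_group)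
  fix \<psi> assume \<psi>: "\<psi> \<in> carrier H1G"
  obtain y z where d: "trg_data \<psi> y z" using trg_data_exists[OF \<psi>] by blast
  then have zZ: "z \<in> carrier Q.Z2" by (simp add: trg_data_def)
  then show "trg \<psi> \<in> carrier Q.H2G" using trg_eq[OF \<psi> d] Q.cls_in by simp
  fix \<psi>' assume \<psi>': "\<psi>' \<in> carrier H1G"
  obtain y' z' where d': "trg_data \<psi>' y' z'" using trg_data_exists[OF \<psi>'] by blast
  then have zZ': "z' \<in> carrier Q.Z2" by (simp add: trg_data_def)
  show "trg (\<psi> \<otimes>\<^bsub>H1G\<^esub> \<psi>') = trg \<psi> \<otimes>\<^bsub>Q.H2G\<^esub> trg \<psi>'"
    using trg_eq[OF \<psi> d] trg_eq[OF \<psi>' d'] trg_eq[OF H1.m_closed[OF \<psi> \<psi>'] trg_data_add[OF d d']]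
      Q.cls_mult[OF zZ zZ'] by simp
qed

text \<open>A coboundary that depends on cosets only makes y additive as soon as one argument lies
  in M, on either side; comparing the two sides gives invariance under conjugation. The
  normalisation of z' makes \<open>y \<one>\<close> vanish modulo p.\<close>

lemma trg_dataI:
  assumes y: "loc_const T y" and z': "z' \<in> carrier Q.Z2"
    and dy: "\<And>x x'. x \<in> carrier G \<Longrightarrow> x' \<in> carrier G \<Longrightarrow> int p dvd dd y (x, x') - z' (\<pi> x, \<pi> x')"
    and z11: "z' (\<pi> \<one>, \<pi> \<one>) = 0"
  shows "(\<lambda>x\<in>M. y x mod int p) \<in> carrier H1G" "trg_data (\<lambda>x\<in>M. y x mod int p) y z'"
proof -
  have y1: "int p dvd y \<one>" using dy[of \<one> \<one>] z11 by (simp add: dd_apply)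
  have pM: "\<pi> m = \<pi> \<one>" if "m \<in> M" for m
    using that pi_eq_iff[of \<one> m] mem_carrier[OF that] by auto
  have left: "int p dvd y (m \<otimes> x) - y m - y x" if "m \<in> M" "x \<in> carrier G" for m x
  proof -
    have "int p dvd (dd y (\<one>, x) - z' (\<pi> \<one>, \<pi> x)) - (dd y (m, x) - z' (\<pi> \<one>, \<pi> x)) - y \<one>"
      using dy[of \<one> x] dy[of m x] pM[OF that(1)] that mem_carrier y1 by - (rule dvd_diff[OF dvd_diff], auto)
    then show ?thesis using that mem_carrier by (simp add: dd_apply algebra_simps)
  qed
  have right: "int p dvd y (x \<otimes> m) - y m - y x" if "m \<in> M" "x \<in> carrier G" for m x
  proof -
    have "int p dvd (dd y (x, \<one>) - z' (\<pi> x, \<pi> \<one>)) - (dd y (x, m) - z' (\<pi> x, \<pi> \<one>)) - y \<one>"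
      using dy[of x \<one>] dy[of x m] pM[OF that(1)] that mem_carrier y1 by - (rule dvd_diff[OF dvd_diff], auto)
    then show ?thesis using that mem_carrier by (simp add: dd_apply algebra_simps)
  qed
  show "(\<lambda>x\<in>M. y x mod int p) \<in> carrier H1G"
  proof (rule H1_modI)
    show "loc_const TM y" using y by (rule continuous_map_from_subtopology)
    show "int p dvd y a + y b - y (a \<otimes> b)" if "a \<in> M" "b \<in> M" for a b
    proof -
      have "int p dvd - (y (a \<otimes> b) - y a - y b)"
        using left[OF that(1) mem_carrier[OF that(2)]] by (subst dvd_minus_iff)
      then show ?thesis by (simp add: algebra_simps)
    qed
    show "int p dvd y (inv g \<otimes> a \<otimes> g) - y a" if g: "g \<in> carrier G" and a: "a \<in> M" for g a
    proof -
      have eq: "g \<otimes> (inv g \<otimes> a \<otimes> g) = a \<otimes> g" using g mem_carrier[OF a] by (simp add: group_simps)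
      have "int p dvd (y (a \<otimes> g) - y a - y g) - (y (g \<otimes> (inv g \<otimes> a \<otimes> g)) - y (inv g \<otimes> a \<otimes> g) - y g)"
        using left[OF a g] right[OF inv_op_closed1[OF g a] g] by (rule dvd_diff)
      then show ?thesis by (simp add: eq)
    qed
  qed
  show "trg_data (\<lambda>x\<in>M. y x mod int p) y z'"
    unfolding trg_data_def using y z' dy by (simp add: mod_eq_dvd_iff[symmetric])
qed

lemma trg_surj:
  assumes "\<alpha> \<in> carrier Q.H2G"
  obtains \<psi> where "\<psi> \<in> carrier H1G" "trg \<psi> = \<alpha>"
proof -
  obtain z where z: "z \<in> carrier Q.Z2" "\<alpha> = Q.cls z" using assms by (auto simp: Q.carrier_H2)
  \<comment> \<open>The constant k is the coboundary of the constant cochain k, so subtracting it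
    keeps the class, and the new cocycle vanishes at the identity.\<close>
  define k where "k = z (\<pi> \<one>, \<pi> \<one>)"
  let ?z = "\<lambda>q. z (\<pi>2 q) - k"
  have zl: "loc_const (prod_topology T T) (\<lambda>q. z (\<pi>2 q))"
    using z(1) by (simp add: Q.Z2_iff Q.C2_iff loc_const_pi2_iff)
  have lc: "loc_const (prod_topology T T) ?z"
    by (rule loc_const_diff[OF zl loc_const_const])
  have "cocycle_eq (\<lambda>(x, y). z (\<pi> x, \<pi> y))"
    using z(1) by (simp add: Q.Z2_iff Q_cocycle_eq_iff)
  then have ce: "cocycle_eq ?z"
    by (simp add: cocycle_eq_def algebra_simps)
  have pi_M: "\<pi> (n \<otimes> x) = \<pi> x" if "n \<in> M" "x \<in> carrier G" for n x
    using pi_eq_iff[of x "n \<otimes> x"] that mem_carrier by auto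
  obtain z' where z': "z' \<in> carrier Q.Z2"
    "\<And>x y. x \<in> carrier G \<Longrightarrow> y \<in> carrier G \<Longrightarrow> z' (\<pi> x, \<pi> y) = (z (\<pi> x, \<pi> y) - k) mod int p"
  proof (rule Q_cocycleI[OF lc ce])
    fix n m x y assume "n \<in> M" "m \<in> M" "x \<in> carrier G" "y \<in> carrier G"
    then show "int p dvd ?z (n \<otimes> x, m \<otimes> y) - ?z (x, y)" by (simp add: pi_M)
  qed (use that in simp)
  have cls: "Q.cls z = Q.cls z'"
  proof (rule Q.cls_eqI[OF z(1) z'(1) loc_const_const])
    fix A B assume "A \<in> carrier GN" "B \<in> carrier GN"
    then obtain x y where "x \<in> carrier G" "y \<in> carrier G" "A = \<pi> x" "B = \<pi> y"
      by (auto simp: carrier_FactGroup)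
    then have "z' (A, B) = (z (A, B) - k) mod int p" using z'(2) by simp
    moreover have "int p dvd (z (A, B) - k) - (z (A, B) - k) mod int p" by (rule dvd_minus_mod)
    ultimately show "int p dvd z (A, B) - z' (A, B) - Q.dd (\<lambda>_. k) (A, B)"
      by (simp add: Q.dd_apply diff_diff_eq add.commute)
  qed
  have "\<exists>c. loc_const T c \<and>
        (\<forall>x\<in>carrier G. \<forall>y\<in>carrier G. int p dvd ?z (x, y) - (c x + c y - c (x \<otimes> y)))"
    using H2_vanish[OF lc] cocycle_eqD[OF ce] by blast
  then obtain y where y: "loc_const T y"
    "\<And>x x'. x \<in> carrier G \<Longrightarrow> x' \<in> carrier G \<Longrightarrow> int p dvd ?z (x, x') - dd y (x, x')"
    unfolding dd_apply by auto
  have dy: "int p dvd dd y (x, x') - z' (\<pi> x, \<pi> x')" if "x \<in> carrier G" "x' \<in> carrier G" for x x'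
    using y(2)[OF that] z'(2)[OF that] by (simp add: mod_eq_dvd_iff[symmetric])
  have "z' (\<pi> \<one>, \<pi> \<one>) = 0" using z'(2)[of \<one> \<one>] by (simp add: k_def)
  note 1 = trg_dataI[OF y(1) z'(1) dy this]
  show thesis using that[OF 1(1)] trg_eq[OF 1] cls z(2) by simp
qed

lemma trg_iso: "trg \<in> iso H1G Q.H2G"
proof -
  interpret H1: comm_group H1G by (rule H1_comm_group)
  interpret H2: comm_group Q.H2G by (rule Q.H2_comm_group)
  interpret h: group_hom H1G Q.H2G trg
    using trg_hom by (simp add: group_hom_def group_hom_axioms_def H1.is_group H2.is_group)
  have "inj_on trg (carrier H1G)"
  proof (rule h.inj_on_one_iff[THEN iffD2], intro allI impI)
    fix \<psi> assume \<psi>: "\<psi> \<in> carrier H1G" and 1: "trg \<psi> = \<one>\<^bsub>Q.H2G\<^esub>"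
    obtain y z where d: "trg_data \<psi> y z" using trg_data_exists[OF \<psi>] by blast
    then have zZ: "z \<in> carrier Q.Z2" by (simp add: trg_data_def)
    have "Q.cls z = \<one>\<^bsub>Q.H2G\<^esub>" using trg_eq[OF \<psi> d] 1 by simp
    then obtain c where c: "loc_const T c" "\<forall>n\<in>M. \<forall>x\<in>carrier G. c (n \<otimes> x) = c x"
      "\<forall>x\<in>carrier G. \<forall>y\<in>carrier G. int p dvd z (\<pi> x, \<pi> y) - dd c (x, y)"
      unfolding Q_cls_trivial_iff[OF zZ] by blast
    have "\<psi> n = 0" if "n \<in> M" for n
      by (rule trg_data_vanish[OF \<psi> d c(1) order_refl _ _ that]) (use c in auto)
    then show "\<psi> = \<one>\<^bsub>H1G\<^esub>"
      using \<psi> by (intro extensionalityI[of _ M]) (auto simp: H1_one H1_iff H1_cochain)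
  qed
  moreover have "trg ` carrier H1G = carrier Q.H2G"
    using trg_surj h.hom_closed by blast
  ultimately show ?thesis
    using trg_hom by (simp add: iso_def bij_betw_def)
qed

text \<open>If \<open>\<psi>\<close> vanishes on N, then y itself, reduced modulo p to turn
  congruences into equalities, is N-invariant and trivialises the inflated cocycle. The converse is
  \<open>trg_data_vanish\<close>.\<close>

lemma inflation_trg_trivial_iff:
  assumes N: "N \<lhd> G" "N \<subseteq> M" and \<psi>: "\<psi> \<in> carrier H1G"
  shows "inflation2 p G T M N (trg \<psi>) = \<one>\<^bsub>H2_Mod p G T N\<^esub> \<longleftrightarrow> (\<forall>x\<in>N. \<psi> x = 0)"
proof -
  interpret inflation_setup G T p N M
    using N by (intro inflation_setup.intro inflation_setup_axioms.intro cohomology_axioms normal_axioms)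
  obtain y z where d: "trg_data \<psi> y z" using trg_data_exists[OF \<psi>] by blast
  then have zZ: "z \<in> carrier Q.Z2" by (simp add: trg_data_def)
  have "inflation2 p G T M N (trg \<psi>) = qN.Q.cls (infl z)"
    using trg_eq[OF \<psi> d] inflation2_cls[OF zZ] by simp
  moreover have "qN.Q.cls (infl z) = \<one>\<^bsub>qN.Q.H2G\<^esub> \<longleftrightarrow> (\<forall>x\<in>N. \<psi> x = 0)"
    unfolding infl_trivial_iff[OF zZ]
  proof
    assume "\<exists>c. loc_const T c \<and> (\<forall>n\<in>N. \<forall>x\<in>carrier G. c (n \<otimes> x) = c x) \<and>
      (\<forall>x\<in>carrier G. \<forall>y\<in>carrier G. int p dvd z (M #> x, M #> y) - dd c (x, y))"
    then obtain c where c: "loc_const T c" "\<forall>n\<in>N. \<forall>x\<in>carrier G. c (n \<otimes> x) = c x"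
      "\<forall>x\<in>carrier G. \<forall>y\<in>carrier G. int p dvd z (M #> x, M #> y) - dd c (x, y)" by blast
    show "\<forall>x\<in>N. \<psi> x = 0"
    proof
      fix n assume n: "n \<in> N"
      show "\<psi> n = 0"
        by (rule trg_data_vanish[OF \<psi> d c(1) N(2) _ _ n]) (use c(2,3) in auto)
    qed
  next
    assume 0: "\<forall>x\<in>N. \<psi> x = 0"
    define c where "c x = y x mod int p" for x
    have "loc_const T c"
      unfolding c_def by (rule loc_const_comp) (use d in \<open>simp add: trg_data_def\<close>)
    moreover have "c (n \<otimes> x) = c x" if "n \<in> N" "x \<in> carrier G" for n x
      using trg_data_translate[OF \<psi> d _ that(2), of n] that(1) N(2) 0 by (auto simp: c_def mod_eq_dvd_iff)
    moreover have "int p dvd z (M #> x, M #> x') - dd c (x, x')" if "x \<in> carrier G" "x' \<in> carrier G" for x x'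
    proof -
      have "dd c (x, x') mod int p = dd y (x, x') mod int p"
        unfolding dd_apply c_def by (intro mod_diff_cong mod_add_cong) simp_all
      also have "\<dots> = z (M #> x, M #> x') mod int p"
        using d that by (simp add: trg_data_def mod_eq_dvd_iff)
      finally show ?thesis by (simp add: mod_eq_dvd_iff dvd_diff_commute)
    qed
    ultimately show "\<exists>c. loc_const T c \<and> (\<forall>n\<in>N. \<forall>x\<in>carrier G. c (n \<otimes> x) = c x) \<and>
      (\<forall>x\<in>carrier G. \<forall>y\<in>carrier G. int p dvd z (M #> x, M #> y) - dd c (x, y))"
      by (intro exI[of _ c]) auto
  qed
  ultimately show ?thesis by simp
qed

end

section \<open>Lifting from a basis\<close>

locale free_profinite = profinite_prime G T p for G (structure) and T and p +
  fixes X :: "'a set"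
  assumes basis: "free_profinite_basis G T X"
begin

sublocale cohomology G T p
  using p prime_gt_0_nat by unfold_locales blast

lemma X_carrier: "X \<subseteq> carrier G"
  using basis by (simp add: free_profinite_basis_def)

lemma X_finite: "W \<lhd> G \<Longrightarrow> openin T W \<Longrightarrow> finite {x \<in> X. x \<notin> W}"
  using basis by (simp add: free_profinite_basis_def converges_to_one_def)

lemma closed_subgroup_eq:
  assumes "subgroup H G" "closedin T H" "X \<subseteq> H"
  shows "H = carrier G"
  using closed_subgroup_generated_minimal[OF assms] basis subgroup.subset[OF assms(1)]
  by (auto simp: free_profinite_basis_def)

lemma open_subgroup_eq:
  assumes "subgroup H G" "openin T H" "X \<subseteq> H"
  shows "H = carrier G"
  by (rule closed_subgroup_eq[OF assms(1) open_subgroup_closed[OF assms(1,2)] assms(3)])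

text \<open>The universal property concerns groups on the type \<open>'a + nat\<close>; a finite
  group is copied there through a numbering of its elements and given the discrete topology.\<close>

lemma finite_lift:
  fixes H :: "'h monoid"
  assumes "group H" and fin: "finite (carrier H)" and f: "f \<in> X \<rightarrow> carrier H"
    and one: "finite {x \<in> X. f x \<noteq> \<one>\<^bsub>H\<^esub>}"
  obtains h where "h \<in> hom G H" "loc_const T h" "\<And>x. x \<in> X \<Longrightarrow> h x = f x"
proof -
  interpret H: group H by (rule assms(1))
  obtain e0 :: "'h \<Rightarrow> nat" where "inj_on e0 (carrier H)"
    using finite_imp_inj_to_nat_seg[OF fin] by blast
  then have inj: "inj_on (\<lambda>x. Inr (e0 x) :: 'a + nat) (carrier H)"
    by (auto simp: inj_on_def)
  define e where "e = (\<lambda>x. Inr (e0 x) :: 'a + nat)"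
  define K where "K = image_group e H"
  have e: "e \<in> iso H K" "group K" "carrier K = e ` carrier H"
    using inj_imp_image_group_iso[OF inj] H.inj_imp_image_group_is_group[OF inj]
    by (auto simp: K_def e_def image_group_carrier)
  interpret K: group K by (rule e(2))
  have e_inv: "inv_into (carrier H) e \<in> iso K H"
    using H.iso_set_sym[OF e(1)] .
  let ?T = "discrete_topology (carrier K)"
  have "profinite_group K ?T"
    unfolding profinite_group_def topological_group_def
  proof (intro conjI allI impI)
    show "continuous_map (prod_topology ?T ?T) ?T (\<lambda>(x, y). x \<otimes>\<^bsub>K\<^esub> y)"
      by (auto simp flip: prod_topology_discrete_topology)
    show "compact_space ?T" using fin e(3) by (simp add: compact_space_discrete_topology)
    show "\<exists>x. C \<subseteq> {x}" if "connectedin ?T C" for C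
      using that by (metis connectedin_discrete_topology empty_subsetI order_refl)
  qed (auto simp: e(2))
  moreover have "converges_to_one K ?T X (\<lambda>x. e (f x))"
    unfolding converges_to_one_def
  proof (intro conjI allI impI)
    show "(\<lambda>x. e (f x)) \<in> X \<rightarrow> carrier K" using f e(3) by auto
    fix U assume "U \<lhd> K \<and> openin ?T U"
    then have "\<one>\<^bsub>K\<^esub> \<in> U" using subgroup.one_closed normal_imp_subgroup by metis
    moreover have "e \<one>\<^bsub>H\<^esub> = \<one>\<^bsub>K\<^esub>"
      using hom_one[of e H K] e(1,2) assms(1) by (simp add: iso_def)
    ultimately have "{x \<in> X. e (f x) \<notin> U} \<subseteq> {x \<in> X. f x \<noteq> \<one>\<^bsub>H\<^esub>}" by auto
    then show "finite {x \<in> X. e (f x) \<notin> U}" using one by (rule finite_subset)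
  qed
  ultimately obtain h where h: "h \<in> hom G K" "continuous_map T ?T h" "\<And>x. x \<in> X \<Longrightarrow> h x = e (f x)"
    using basis unfolding free_profinite_basis_def by blast
  show thesis
  proof
    show "inv_into (carrier H) e \<circ> h \<in> hom G H"
      using h(1) e_inv by (auto simp: iso_def hom_def Pi_iff)
    have "loc_const T h" using h(2) by (simp add: continuous_map_discrete_iff[of T "carrier K"])
    then show "loc_const T (inv_into (carrier H) e \<circ> h)"
      unfolding o_def by (rule loc_const_comp)
    show "(inv_into (carrier H) e \<circ> h) x = f x" if "x \<in> X" for x
    proof -
      have "inj_on e (carrier H)" using inj by (simp add: e_def)
      moreover have "f x \<in> carrier H" using f that by blast
      ultimately show ?thesis using h(3)[OF that] by simp
    qed
  qed
qed

text \<open>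
  Only finitely many values of \<open>z\<close> matter, so that the central extension defined by \<open>z\<close> may be replaced by
  the finite extension \<open>E\<close> of the quotient of \<open>G\<close> by an open normal subgroup.
\<close>

lemma lift_cocycle:
  assumes z: "loc_const (prod_topology T T) z" "cocycle_eq z" and z1: "z (\<one>, \<one>) = 0"
    and b: "finite {x \<in> X. \<not> int p dvd b x}"
  obtains y where "loc_const T y"
    "\<And>s t. s \<in> carrier G \<Longrightarrow> t \<in> carrier G \<Longrightarrow> int p dvd z (s, t) - dd y (s, t)"
    "\<And>x. x \<in> X \<Longrightarrow> int p dvd y x - b x"
proof -
  \<comment> \<open>z is paired with its flip, since \<open>open_normal_invariance\<close> controls
    the first argument only.\<close>
  have "continuous_map (prod_topology T T) (prod_topology T T) (\<lambda>q. (snd q, fst q))"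
    by (intro continuous_map_pairedI continuous_map_fst continuous_map_snd)
  from loc_const_comp2[OF z(1) loc_const_pull[OF z(1) this], of Pair]
  have lc: "loc_const (prod_topology T T) (\<lambda>q. (z q, z (snd q, fst q)))" .
  obtain W where W: "W \<lhd> G" "openin T W"
    and inv: "\<And>g x y t. g \<in> W \<Longrightarrow> x \<in> carrier G \<Longrightarrow> y \<in> carrier G \<Longrightarrow> t \<in> topspace T
      \<Longrightarrow> (z (x \<otimes> g \<otimes> y, t), z (snd (x \<otimes> g \<otimes> y, t), fst (x \<otimes> g \<otimes> y, t)))
        = (z (x \<otimes> y, t), z (snd (x \<otimes> y, t), fst (x \<otimes> y, t)))"
    using open_normal_invariance[OF lc compact] by metis
  interpret W: top_quotient G T W
    using W(1) by (simp add: top_quotient_def top_group_axioms)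
  have invW: "z (w \<otimes> x, t) = z (x, t)" "z (t, w \<otimes> x) = z (t, x)"
    if "w \<in> W" "x \<in> carrier G" "t \<in> carrier G" for w x t
    using inv[of w \<one> x t] that W.mem_carrier[OF that(1)] by (auto simp: topspace_eq)
  define zW where "zW A B = z (W.rep A, W.rep B)" for A B
  have zW: "zW (W #> s) (W #> t) = z (s, t)" if s: "s \<in> carrier G" and t: "t \<in> carrier G" for s t
  proof -
    obtain n m where n: "n \<in> W" "W.rep (W #> s) = n \<otimes> s" and m: "m \<in> W" "W.rep (W #> t) = m \<otimes> t"
      using W.rep[OF s] W.rep[OF t] by blast
    have "z (n \<otimes> s, m \<otimes> t) = z (s, m \<otimes> t)"
      using invW(1)[OF n(1) s] W.mem_carrier[OF m(1)] t by simp
    also have "\<dots> = z (s, t)" using invW(2)[OF m(1) t s] .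
    finally show ?thesis by (simp add: zW_def n m)
  qed
  \<comment> \<open>The normalisation of z makes the pair of 0 and W a left unit of E.\<close>
  have zW1: "int p dvd zW W B" if B: "B \<in> carrier W.GN" for B
  proof -
    obtain t where t: "t \<in> carrier G" "B = W #> t" using B W.carrier_GN by blast
    have "W = W #> \<one>" using W.subset by (simp add: coset_mult_one)
    then have "zW W B = z (\<one>, t)" using zW[of \<one> t] t by simp
    moreover have "int p dvd z (\<one>, t)"
      using cocycle_eqD[OF z(2), of \<one> \<one> t] t z1 by simp
    ultimately show ?thesis by simp
  qed
  interpret GW: group W.GN by (rule W.GN_group)
  \<comment> \<open>The sign of the cocycle is chosen such that the first component y of the lift
    satisfies y(st) = y(s) + y(t) - z(s, t) modulo p, that is, has coboundary z.\<close>
  define E where "E = \<lparr>carrier = {0..<int p} \<times> carrier W.GN,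
    mult = (\<lambda>(a, A) (b, B). ((a + b - zW A B) mod int p, A \<otimes>\<^bsub>W.GN\<^esub> B)), one = (0, W)\<rparr>"
  have E_mult: "(a, A) \<otimes>\<^bsub>E\<^esub> (b, B) = ((a + b - zW A B) mod int p, A \<otimes>\<^bsub>W.GN\<^esub> B)" for a A b B
    by (simp add: E_def)
  have E_carrier: "(a, A) \<in> carrier E \<longleftrightarrow> 0 \<le> a \<and> a < int p \<and> A \<in> carrier W.GN" for a A
    by (auto simp: E_def)
  have E_one: "\<one>\<^bsub>E\<^esub> = (0, \<one>\<^bsub>W.GN\<^esub>)" by (simp add: E_def)
  have WGN: "W \<in> carrier W.GN" using GW.one_closed by simp
  have "group E"
  proof (rule groupI)
    show "\<one>\<^bsub>E\<^esub> \<in> carrier E" using p_pos WGN by (simp add: E_one E_carrier)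
    fix u v assume "u \<in> carrier E" "v \<in> carrier E"
    then show "u \<otimes>\<^bsub>E\<^esub> v \<in> carrier E"
      using p_pos GW.m_closed by (cases u; cases v) (simp add: E_carrier E_mult)
  next
    fix u v w assume "u \<in> carrier E" "v \<in> carrier E" "w \<in> carrier E"
    then obtain a A b B c C where u: "u = (a, A)" "v = (b, B)" "w = (c, C)"
      and c: "A \<in> carrier W.GN" "B \<in> carrier W.GN" "C \<in> carrier W.GN"
      by (metis E_carrier surj_pair)
    obtain r s t where r: "r \<in> carrier G" "A = W #> r" and s: "s \<in> carrier G" "B = W #> s"
      and t: "t \<in> carrier G" "C = W #> t"
      using c W.carrier_GN by metis
    have "int p dvd z (s, t) - z (r \<otimes> s, t) + z (r, s \<otimes> t) - z (r, s)"
      using cocycle_eqD[OF z(2)] r s t by blast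
    then have "int p dvd zW B C - zW (A \<otimes>\<^bsub>W.GN\<^esub> B) C + zW A (B \<otimes>\<^bsub>W.GN\<^esub> C) - zW A B"
      using r s t zW by (simp add: W.rcos_sum)
    then have "(a + b - zW A B + c - zW (A \<otimes>\<^bsub>W.GN\<^esub> B) C) mod int p =
        (a + (b + c - zW B C) - zW A (B \<otimes>\<^bsub>W.GN\<^esub> C)) mod int p"
      by (simp add: mod_eq_dvd_iff algebra_simps)
    moreover have "((a + b - zW A B) mod int p + c - zW (A \<otimes>\<^bsub>W.GN\<^esub> B) C) mod int p =
        (a + b - zW A B + c - zW (A \<otimes>\<^bsub>W.GN\<^esub> B) C) mod int p"
      by (intro mod_diff_cong mod_add_cong) simp_all
    moreover have "(a + (b + c - zW B C) mod int p - zW A (B \<otimes>\<^bsub>W.GN\<^esub> C)) mod int p =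
        (a + (b + c - zW B C) - zW A (B \<otimes>\<^bsub>W.GN\<^esub> C)) mod int p"
      by (rule mod_diff_cong, rule mod_add_cong) simp_all
    ultimately show "u \<otimes>\<^bsub>E\<^esub> v \<otimes>\<^bsub>E\<^esub> w = u \<otimes>\<^bsub>E\<^esub> (v \<otimes>\<^bsub>E\<^esub> w)"
      unfolding u E_mult using GW.m_assoc[OF c] by simp
  next
    fix u assume u: "u \<in> carrier E"
    then obtain a A where a: "u = (a, A)" "0 \<le> a" "a < int p" "A \<in> carrier W.GN"
      by (metis E_carrier surj_pair)
    have "int p dvd (a - zW W A) - a" using zW1[OF a(4)] by simp
    then have "(a - zW W A) mod int p = a mod int p" by (simp only: mod_eq_dvd_iff)
    then have "(a - zW W A) mod int p = a" using a(2,3) by (simp add: mod_pos_pos_trivial)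
    then show "\<one>\<^bsub>E\<^esub> \<otimes>\<^bsub>E\<^esub> u = u"
      using a GW.l_one[OF a(4)] by (simp add: E_one E_mult)
    let ?B = "inv\<^bsub>W.GN\<^esub> A"
    let ?v = "((zW ?B A - a) mod int p, ?B)"
    have "?v \<in> carrier E" using p_pos a GW.inv_closed[OF a(4)] by (simp add: E_carrier)
    moreover have "((zW ?B A - a) mod int p + a - zW ?B A) mod int p = (zW ?B A - a + a - zW ?B A) mod int p"
      by (intro mod_diff_cong mod_add_cong) simp_all
    then have "?v \<otimes>\<^bsub>E\<^esub> u = \<one>\<^bsub>E\<^esub>"
      unfolding a(1) E_mult E_one using GW.l_inv[OF a(4)] by simp
    ultimately show "\<exists>v\<in>carrier E. v \<otimes>\<^bsub>E\<^esub> u = \<one>\<^bsub>E\<^esub>" by blast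
  qed
  moreover have "finite (carrier E)"
    using finite_rcosets[OF W.subgroup_axioms W(2)] by (simp add: E_def FactGroup_def)
  moreover have "(\<lambda>x. (b x mod int p, W #> x)) \<in> X \<rightarrow> carrier E"
    using X_carrier p_pos W.pi_in by (auto simp: E_carrier)
  moreover have "finite {x \<in> X. (b x mod int p, W #> x) \<noteq> \<one>\<^bsub>E\<^esub>}"
  proof (rule finite_subset)
    show "{x \<in> X. (b x mod int p, W #> x) \<noteq> \<one>\<^bsub>E\<^esub>} \<subseteq> {x \<in> X. \<not> int p dvd b x} \<union> {x \<in> X. x \<notin> W}"
      using W.rcos_const by (auto simp: E_one)
    show "finite ({x \<in> X. \<not> int p dvd b x} \<union> {x \<in> X. x \<notin> W})"
      using b X_finite[OF W] by simp
  qed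
  ultimately obtain h where h: "h \<in> hom G E" "loc_const T h"
    and hX: "\<And>x. x \<in> X \<Longrightarrow> h x = (b x mod int p, W #> x)"
  proof (rule finite_lift)
    fix h assume "h \<in> hom G E" "loc_const T h" "\<And>x. x \<in> X \<Longrightarrow> h x = (b x mod int p, W #> x)"
    then show thesis by (rule that)
  qed
  have h_mult: "h (s \<otimes> t) = ((fst (h s) + fst (h t) - zW (snd (h s)) (snd (h t))) mod int p,
      snd (h s) \<otimes>\<^bsub>W.GN\<^esub> snd (h t))" if "s \<in> carrier G" "t \<in> carrier G" for s t
    using hom_mult[OF h(1) that] by (metis E_mult prod.collapse)
  have h_snd: "snd (h s) \<in> carrier W.GN" if "s \<in> carrier G" for s
    using hom_carrier[OF h(1)] that by (metis E_carrier image_subset_iff prod.collapse)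
  have hom2: "group_hom G W.GN (\<lambda>s. snd (h s))"
    unfolding group_hom_def group_hom_axioms_def
    using h_mult h_snd is_group GW.is_group by (auto simp: hom_def)
  interpret h2: group_hom G W.GN "\<lambda>s. snd (h s)" by (rule hom2)
  \<comment> \<open>On X the lift covers the projection to G / W by construction. The elements where
    it does so form an open subgroup, hence all of G.\<close>
  define H where "H = {s \<in> carrier G. snd (h s) = W #> s}"
  have "subgroup H G"
  proof (rule subgroupI)
    show "H \<noteq> {}" using h2.hom_one W.subset by (auto simp: H_def intro!: exI[of _ \<one>] simp: coset_mult_one)
    fix s assume s: "s \<in> H"
    then show "inv s \<in> H" using h2.hom_inv[of s] W.pi_inv[of s] by (simp add: H_def)
    fix t assume "t \<in> H"
    then show "s \<otimes> t \<in> H" using s h2.hom_mult[of s t] by (simp add: H_def W.rcos_sum)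
  qed (auto simp: H_def)
  moreover have "openin T H"
  proof -
    have "loc_const T (\<lambda>s. W #> s)"
    proof (rule loc_constI[OF W.subgroup_axioms W(2)])
      fix w x assume wx: "w \<in> W" "x \<in> carrier G"
      show "W #> (w \<otimes> x) = W #> x"
        using W.pi_eq_iff[of x "w \<otimes> x"] wx W.mem_carrier[OF wx(1)] by auto
    qed
    from loc_const_comp2[OF h(2) this, of "\<lambda>a A. snd a = A"]
    have "openin T {s \<in> topspace T. (snd (h s) = W #> s) \<in> {True}}"
      by (rule openin_continuous_map_preimage) simp
    then show ?thesis by (simp add: H_def topspace_eq)
  qed
  moreover have "X \<subseteq> H" using X_carrier hX by (auto simp: H_def)
  ultimately have "H = carrier G" by (rule open_subgroup_eq)
  then have hs: "snd (h s) = W #> s" if "s \<in> carrier G" for s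
    using that unfolding H_def by blast
  show thesis
  proof
    show "loc_const T (\<lambda>s. fst (h s))" using h(2) by (rule loc_const_comp)
    show "int p dvd fst (h x) - b x" if "x \<in> X" for x
      using hX[OF that] by (simp add: mod_eq_dvd_iff[symmetric])
    fix s t assume c: "s \<in> carrier G" "t \<in> carrier G"
    have "fst (h (s \<otimes> t)) = (fst (h s) + fst (h t) - z (s, t)) mod int p"
      using h_mult[OF c] hs c zW by simp
    moreover have "int p dvd (fst (h s) + fst (h t) - z (s, t)) - (fst (h s) + fst (h t) - z (s, t)) mod int p"
      by (rule dvd_minus_mod)
    ultimately have "int p dvd - (z (s, t) - dd (\<lambda>s. fst (h s)) (s, t))"
      by (simp add: dd_apply algebra_simps)
    then show "int p dvd z (s, t) - dd (\<lambda>s. fst (h s)) (s, t)"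
      by (subst (asm) dvd_minus_iff)
  qed
qed

text \<open>This is \<open>lift_cocycle\<close> with value 0 on the basis, after z has been
  normalised by a constant, which is a coboundary.\<close>

lemma H2_vanish:
  assumes z: "loc_const (prod_topology T T) z" "cocycle_eq z"
  obtains y where "loc_const T y"
    "\<And>s t. s \<in> carrier G \<Longrightarrow> t \<in> carrier G \<Longrightarrow> int p dvd z (s, t) - dd y (s, t)"
proof -
  define k where "k = z (\<one>, \<one>)"
  have lc: "loc_const (prod_topology T T) (\<lambda>q. z q - k)"
    using z(1) by (intro loc_const_diff loc_const_const)
  have ce: "cocycle_eq (\<lambda>q. z q - k)"
    using z(2) by (simp add: cocycle_eq_def algebra_simps)
  obtain y where y: "loc_const T y"
    "\<And>s t. s \<in> carrier G \<Longrightarrow> t \<in> carrier G \<Longrightarrow> int p dvd z (s, t) - k - dd y (s, t)"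
  proof (rule lift_cocycle[OF lc ce, of "\<lambda>_. 0"])
    fix y assume "loc_const T y"
      "\<And>s t. s \<in> carrier G \<Longrightarrow> t \<in> carrier G \<Longrightarrow> int p dvd z (s, t) - k - dd y (s, t)"
    then show thesis by (rule that)
  qed (simp_all add: k_def)
  show thesis
  proof
    show "loc_const T (\<lambda>s. y s + k)" using y(1) by (intro loc_const_add loc_const_const)
    show "int p dvd z (s, t) - dd (\<lambda>s. y s + k) (s, t)" if "s \<in> carrier G" "t \<in> carrier G" for s t
      using y(2)[OF that] by (simp add: dd_apply algebra_simps)
  qed
qed

text \<open>The kernel of c modulo p is an open subgroup that contains the p-th powers and the
  commutators, which generate \<open>Z 2\<close>.\<close>

lemma hom_trivial:
  assumes c: "loc_const T c"
    and hom: "\<And>x y. x \<in> carrier G \<Longrightarrow> y \<in> carrier G \<Longrightarrow> int p dvd dd c (x, y)"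
    and x: "x \<in> Z 2"
  shows "int p dvd c x"
proof -
  define H where "H = {x \<in> carrier G. int p dvd c x}"
  have one: "int p dvd c \<one>" using hom[of \<one> \<one>] by (simp add: dd_apply)
  have inv: "int p dvd c (inv x) + c x" if "x \<in> carrier G" for x
    using dvd_add[OF hom[of "inv x" x] one] that by (simp add: dd_apply)
  have "subgroup H G"
  proof (rule subgroupI)
    show "H \<noteq> {}" using one by (auto simp: H_def)
    fix x assume x: "x \<in> H"
    then show "inv x \<in> H" using dvd_diff[OF inv[of x], of "c x"] by (simp add: H_def)
    fix y assume "y \<in> H"
    then show "x \<otimes> y \<in> H"
      using dvd_diff[OF dvd_add[of "int p" "c x" "c y"] hom[of x y]] x by (simp add: H_def dd_apply)
  qed (auto simp: H_def)
  moreover have "openin T H"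
    using openin_continuous_map_preimage[OF loc_const_comp[OF c, of "\<lambda>a. int p dvd a"], of "{True}"]
    by (simp add: H_def topspace_eq)
  ultimately have "subgroup H G" "closedin T H" by (auto intro: open_subgroup_closed)
  moreover have "Z_gens 2 \<subseteq> H"
  proof -
    have pow: "int p dvd c (x [^] (k :: nat)) - int k * c x" if "x \<in> carrier G" for x k
    proof (induction k)
      case 0
      then show ?case using one by simp
    next
      case (Suc k)
      from dvd_diff[OF Suc hom[of "x [^] k" x]] that show ?case
        by (simp add: dd_apply algebra_simps)
    qed
    have "x [^] p \<in> H" if "x \<in> carrier G" for x
      using dvd_add[OF pow[OF that, of p], of "int p * c x"] that by (simp add: H_def)
    moreover have "inv x \<otimes> inv y \<otimes> x \<otimes> y \<in> H" if c: "x \<in> carrier G" "y \<in> carrier G" for x y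
    proof -
      have "int p dvd (c (inv x) + c x) + (c (inv y) + c y)
          - dd c (inv x, inv y) - dd c (inv x \<otimes> inv y, x) - dd c (inv x \<otimes> inv y \<otimes> x, y)"
        using inv[OF c(1)] inv[OF c(2)] hom[of "inv x" "inv y"] hom[of "inv x \<otimes> inv y" x]
          hom[of "inv x \<otimes> inv y \<otimes> x" y] c
        by (metis dvd_add dvd_diff inv_closed m_closed)
      then show ?thesis using c by (simp add: H_def dd_apply algebra_simps)
    qed
    ultimately show ?thesis using Z_carrier by (auto simp: Z_gens_def)
  qed
  ultimately have "Z 2 \<subseteq> H" unfolding Z_ge_2[OF order_refl] by (intro closed_subgroup_generated_minimal)
  then show ?thesis using x by (auto simp: H_def)
qed

lemma transgression_setup_Z:
  assumes "n \<ge> 2"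
  shows "transgression_setup G T p (Z n)"
proof (intro transgression_setup.intro transgression_setup_axioms.intro profinite_prime_axioms Z_normal)
  have "Z n \<subseteq> Z 2" using assms by (rule Z.Phi_mono)
  then show "int p dvd c x" if "loc_const T c" "x \<in> Z n"
    "\<And>x y. x \<in> carrier G \<Longrightarrow> y \<in> carrier G \<Longrightarrow> int p dvd c x + c y - c (x \<otimes> y)" for c x
    using hom_trivial[OF that(1)] that by (auto simp: dd_apply)
  fix z assume "loc_const (prod_topology T T) z"
    "\<And>x y w. x \<in> carrier G \<Longrightarrow> y \<in> carrier G \<Longrightarrow> w \<in> carrier G \<Longrightarrow>
        int p dvd z (y, w) - z (x \<otimes> y, w) + z (x, y \<otimes> w) - z (x, y)"
  then show "\<exists>c. loc_const T c \<and> (\<forall>x\<in>carrier G. \<forall>y\<in>carrier G. int p dvd z (x, y) - (c x + c y - c (x \<otimes> y)))"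
    using H2_vanish[of z] unfolding cocycle_eq_def dd_apply by metis
qed

end

section \<open>Defining systems and Magnus coefficients\<close>

text \<open>
  Up to the two terms of the sum that involve the diagonal, this is the entry \<open>(i, j + 1)\<close> of the
  product of the unipotent upper triangular matrices with entries \<open>c i j s\<close> and \<open>c i j t\<close> at \<open>(i, j + 1)\<close>.
\<close>

definition cup :: "(nat \<Rightarrow> nat \<Rightarrow> 'a \<Rightarrow> int) \<Rightarrow> nat \<Rightarrow> nat \<Rightarrow> 'a \<times> 'a \<Rightarrow> int" where
  "cup c i j = (\<lambda>(s, t). \<Sum>r = i..<j. c i r s * c (r + 1) j t)"

lemma cup_apply: "cup c i j (s, t) = (\<Sum>r = i..<j. c i r s * c (r + 1) j t)"
  by (simp add: cup_def)

lemma sum_triangle_swap: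
  fixes n :: nat
  shows "(\<Sum>r = 1..<n. \<Sum>q = 1..<r. f q r :: int) = (\<Sum>q = 1..<n. \<Sum>r = q + 1..<n. f q r)"
proof -
  have "(\<Sum>r = 1..<n. \<Sum>q = 1..<r. f q r) = (\<Sum>r\<in>{1..<n}. \<Sum>q | q \<in> {1..<n} \<and> q < r. f q r)"
    by (intro sum.cong refl) auto
  also have "\<dots> = (\<Sum>q\<in>{1..<n}. \<Sum>r | r \<in> {1..<n} \<and> q < r. f q r)"
    by (rule sum.swap_restrict) auto
  also have "\<dots> = (\<Sum>q = 1..<n. \<Sum>r = q + 1..<n. f q r)"
    by (intro sum.cong refl) auto
  finally show ?thesis .
qed

context cohomology
begin

lemma loc_const_cup:
  assumes "\<And>r. i \<le> r \<Longrightarrow> r < j \<Longrightarrow> loc_const T (c i r) \<and> loc_const T (c (r + 1) j)"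
  shows "loc_const (prod_topology T T) (cup c i j)"
proof -
  have "loc_const (prod_topology T T) (\<lambda>q. \<Sum>r = i..<j. c i r (fst q) * c (r + 1) j (snd q))"
  proof (intro loc_const_sum loc_const_mult)
    fix r assume "r \<in> {i..<j}"
    then have r: "loc_const T (c i r)" "loc_const T (c (r + 1) j)" using assms[of r] by auto
    show "loc_const (prod_topology T T) (\<lambda>q. c i r (fst q))"
      by (rule loc_const_pull[OF r(1) continuous_map_fst])
    show "loc_const (prod_topology T T) (\<lambda>q. c (r + 1) j (snd q))"
      by (rule loc_const_pull[OF r(2) continuous_map_snd])
  qed simp
  then show ?thesis by (simp add: cup_def case_prod_unfold)
qed

text \<open>This is associativity of the matrix product: by the relations for the shorter entries,
  the coboundary reduces to two triple sums over cuts q < r, which agree after the summations are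
  interchanged.\<close>

lemma cocycle_eq_cup:
  assumes c: "\<And>i j s t. 1 \<le> i \<Longrightarrow> i \<le> j \<Longrightarrow> j \<le> n \<Longrightarrow> (i, j) \<noteq> (1, n) \<Longrightarrow>
      s \<in> carrier G \<Longrightarrow> t \<in> carrier G \<Longrightarrow> int p dvd dd (c i j) (s, t) + cup c i j (s, t)"
  shows "cocycle_eq (cup c 1 n)"
  unfolding cocycle_eq_def
proof (intro ballI)
  fix x y w assume G: "x \<in> carrier G" "y \<in> carrier G" "w \<in> carrier G"
  have "(\<Sum>r = 1..<n. cup c 1 r (x, y) * c (r + 1) n w) = (\<Sum>r = 1..<n. \<Sum>q = 1..<r. c 1 q x * c (q + 1) r y * c (r + 1) n w)"
    by (simp add: cup_apply sum_distrib_right)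
  also have "\<dots> = (\<Sum>q = 1..<n. \<Sum>r = q + 1..<n. c 1 q x * c (q + 1) r y * c (r + 1) n w)"
    by (rule sum_triangle_swap)
  also have "\<dots> = (\<Sum>q = 1..<n. c 1 q x * cup c (q + 1) n (y, w))"
    by (simp add: cup_apply sum_distrib_left mult.assoc)
  finally have swap: "(\<Sum>r = 1..<n. cup c 1 r (x, y) * c (r + 1) n w) = (\<Sum>r = 1..<n. c 1 r x * cup c (r + 1) n (y, w))" .
  have "cup c 1 n (y, w) - cup c 1 n (x \<otimes> y, w) + cup c 1 n (x, y \<otimes> w) - cup c 1 n (x, y) =
      (\<Sum>r = 1..<n. dd (c 1 r) (x, y) * c (r + 1) n w - c 1 r x * dd (c (r + 1) n) (y, w))"
    unfolding cup_apply sum_subtractf[symmetric] sum.distrib[symmetric]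
    by (intro sum.cong refl) (simp add: dd_apply algebra_simps)
  also have "\<dots> = (\<Sum>r = 1..<n. (dd (c 1 r) (x, y) + cup c 1 r (x, y)) * c (r + 1) n w
      - c 1 r x * (dd (c (r + 1) n) (y, w) + cup c (r + 1) n (y, w)))"
    using swap by (simp add: sum_subtractf sum.distrib algebra_simps)
  finally have eq: "cup c 1 n (y, w) - cup c 1 n (x \<otimes> y, w) + cup c 1 n (x, y \<otimes> w) - cup c 1 n (x, y) =
      (\<Sum>r = 1..<n. (dd (c 1 r) (x, y) + cup c 1 r (x, y)) * c (r + 1) n w
      - c 1 r x * (dd (c (r + 1) n) (y, w) + cup c (r + 1) n (y, w)))" .
  show "int p dvd cup c 1 n (y, w) - cup c 1 n (x \<otimes> y, w) + cup c 1 n (x, y \<otimes> w) - cup c 1 n (x, y)"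
    unfolding eq
  proof (rule dvd_sum)
    fix r assume r: "r \<in> {1..<n}"
    have "int p dvd dd (c 1 r) (x, y) + cup c 1 r (x, y)" "int p dvd dd (c (r + 1) n) (y, w) + cup c (r + 1) n (y, w)"
      using r G by (auto intro!: c)
    then show "int p dvd (dd (c 1 r) (x, y) + cup c 1 r (x, y)) * c (r + 1) n w
      - c 1 r x * (dd (c (r + 1) n) (y, w) + cup c (r + 1) n (y, w))"
      by (simp add: dvd_diff dvd_mult dvd_mult2)
  qed
qed

text \<open>A defining system completed by the corner entry (1, n); equivalently, a continuous
  homomorphism modulo p from G to the unipotent upper triangular matrices of size n + 1.\<close>

definition unipotent :: "nat \<Rightarrow> (nat \<Rightarrow> nat \<Rightarrow> 'a \<Rightarrow> int) \<Rightarrow> bool" where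
  "unipotent n c \<longleftrightarrow> (\<forall>i j. 1 \<le> i \<longrightarrow> i \<le> j \<longrightarrow> j \<le> n \<longrightarrow> loc_const T (c i j) \<and>
     (\<forall>s\<in>carrier G. \<forall>t\<in>carrier G. int p dvd dd (c i j) (s, t) + cup c i j (s, t)))"

lemma unipotentD:
  assumes "unipotent n c" "1 \<le> i" "i \<le> j" "j \<le> n"
  shows "loc_const T (c i j)"
    and "s \<in> carrier G \<Longrightarrow> t \<in> carrier G \<Longrightarrow> int p dvd dd (c i j) (s, t) + cup c i j (s, t)"
  using assms by (auto simp: unipotent_def)

lemma unipotent_one:
  assumes c: "unipotent n c"
  shows "1 \<le> i \<Longrightarrow> i \<le> j \<Longrightarrow> j \<le> n \<Longrightarrow> int p dvd c i j \<one>"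
proof (induction "j - i" arbitrary: i j rule: less_induct)
  case less
  have "int p dvd c i r \<one> * c (r + 1) j \<one>" if "r \<in> {i..<j}" for r
    using less.hyps[of r i] less.prems that by (intro dvd_mult2) auto
  then have "int p dvd cup c i j (\<one>, \<one>)"
    unfolding cup_apply by (rule dvd_sum)
  moreover have "int p dvd dd (c i j) (\<one>, \<one>) + cup c i j (\<one>, \<one>)"
    using unipotentD(2)[OF c less.prems] by simp
  ultimately have "int p dvd dd (c i j) (\<one>, \<one>)" by (simp add: dvd_add_left_iff)
  then show ?case by (simp add: dd_apply)
qed

text \<open>The difference by h of the entry (i, j) is congruent to its value at h plus a
  combination of the entries (i, r) with r < j. By induction the degree is at most j + 1 - i, the
  distance of the matrix position from the diagonal.\<close>

lemma unipotent_degree: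
  assumes c: "unipotent n c"
  shows "1 \<le> i \<Longrightarrow> i \<le> j \<Longrightarrow> j \<le> n \<Longrightarrow> deg_less p G (lower_filtration G) (j + 2 - i) (c i j)"
proof (induction "j - i" arbitrary: i j rule: less_induct)
  case less
  interpret F: filtration G "lower_filtration G" p by (rule filtration_lower)
  have low: "lower_filtration G 0 = carrier G" by (simp add: lower_filtration_def)
  have "F.K (j + 2 - i - v) (rdiff G h (c i j))" if v: "v \<ge> 1" and h: "h \<in> lower_filtration G v" for v h
  proof -
    have v1: "v = 1" and hc: "h \<in> carrier G"
      using v h by (auto simp: lower_filtration_def split: if_splits)
    have "F.K (j + 1 - i) (\<lambda>x. c (r + 1) j h * c i r x)" if r: "r \<in> {i..<j}" for r
    proof (rule F.K_scale, rule F.K_mono)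
      have "r - i < j - i" "i \<le> r" "r \<le> n" using r less.prems by auto
      then show "F.K (r + 2 - i) (c i r)" by (rule less.hyps[OF _ less.prems(1)])
      show "r + 2 - i \<le> j + 1 - i" using r by auto
    qed
    then have "F.K (j + 1 - i) (\<lambda>x. \<Sum>r = i..<j. c (r + 1) j h * c i r x)"
      by (intro F.K_sum) auto
    then have "F.K (j + 1 - i) (\<lambda>x. c i j h + (\<Sum>r = i..<j. c (r + 1) j h * c i r x))"
      using less.prems by (intro F.K_add F.K_const) auto
    then have "F.K (j + 1 - i) (rdiff G h (c i j))"
    proof (rule F.K_cong_mod)
      fix x assume "x \<in> lower_filtration G 0"
      then have "int p dvd dd (c i j) (x, h) + cup c i j (x, h)"
        using unipotentD(2)[OF c less.prems] hc low by simp
      then show "int p dvd c i j h + (\<Sum>r = i..<j. c (r + 1) j h * c i r x) - rdiff G h (c i j) x"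
        by (simp add: dd_apply cup_apply rdiff_apply algebra_simps)
    qed
    then show ?thesis by (simp add: v1)
  qed
  then show ?case using less.prems by (subst F.K_pos) auto
qed

end

section \<open>Vanishing of matrix entries, and Magnus coefficients\<close>

context free_profinite
begin

text \<open>A function of degree at most j + 1 - i is constant on \<open>Z (j + 2 - i)\<close> by
  \<open>low_degree_const\<close>, with value that at \<open>\<one>\<close>, which is 0 modulo p. On
  \<open>Z n\<close> this covers all entries but the corner (1, n), for which the level is
  \<open>Z (Suc n)\<close>.\<close>

lemma unipotent_vanish:
  assumes c: "unipotent n c" and ij: "1 \<le> i" "i \<le> j" "j \<le> n" and m: "j + 2 - i \<le> m" and s: "s \<in> Z m"
  shows "int p dvd c i j s"
proof -
  obtain W where W: "W \<lhd> G" "openin T W"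
    "\<And>w x. w \<in> W \<Longrightarrow> x \<in> carrier G \<Longrightarrow> c i j (x \<otimes> w) = c i j x"
    using loc_const_invariant[OF unipotentD(1)[OF c ij]] by metis
  have s': "s \<in> Z (j + 2 - i)" using s Z.Phi_mono[OF m] by blast
  have "int p dvd c i j (\<one> \<otimes> s) - c i j \<one>"
  proof (rule low_degree_const[OF W(1,2) _ unipotent_degree[OF c ij]])
    show "int p dvd c i j (x \<otimes> w) - c i j x" if "x \<in> carrier G" "w \<in> W" for x w
      using W(3)[OF that(2,1)] by simp
    show "1 \<le> j + 2 - i" using ij by simp
  qed (use s' in simp_all)
  from dvd_add[OF this unipotent_one[OF c ij]] show ?thesis
    using Z_carrier[OF s] by simp
qed

text \<open>One level earlier than in \<open>unipotent_vanish\<close>: the entries (i, r) with r < j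
  already vanish at s, so the mixed terms disappear modulo p.\<close>

lemma unipotent_translate:
  assumes c: "unipotent n c" and ij: "1 \<le> i" "i \<le> j" "j \<le> n" and m: "j + 1 - i \<le> m" and s: "s \<in> Z m"
    and t: "t \<in> carrier G"
  shows "int p dvd c i j (s \<otimes> t) - c i j s - c i j t"
proof -
  have "int p dvd c i r s * c (r + 1) j t" if "r \<in> {i..<j}" for r
    using that ij m by (intro dvd_mult2 unipotent_vanish[OF c _ _ _ _ s]) auto
  then have "int p dvd cup c i j (s, t)" unfolding cup_apply by (rule dvd_sum)
  moreover have "int p dvd dd (c i j) (s, t) + cup c i j (s, t)"
    using unipotentD(2)[OF c ij] Z_carrier[OF s] t by simp
  ultimately have "int p dvd dd (c i j) (s, t)" by (simp add: dvd_add_left_iff)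
  then have "int p dvd - dd (c i j) (s, t)" by (subst dvd_minus_iff)
  then show ?thesis by (simp add: dd_apply algebra_simps)
qed

text \<open>
  The coefficient of the word \<open>w\<close> in the Magnus expansion \<open>G \<rightarrow> \<int>/p\<langle>\<langle>X\<rangle>\<rangle>\<close>, \<open>x \<mapsto> 1 + x\<close>.
\<close>

function eps :: "'a list \<Rightarrow> 'a \<Rightarrow> int" where
  "eps w = (if w = [] then (\<lambda>_. 1) else SOME y. loc_const T y \<and>
     (\<forall>s\<in>carrier G. \<forall>t\<in>carrier G. int p dvd
        dd y (s, t) + (\<Sum>k\<in>{1..<length w}. eps (take k w) s * eps (drop k w) t)) \<and>
     (\<forall>x\<in>X. int p dvd y x - (if w = [x] then 1 else 0)))"
  by pat_completeness auto
termination
  by (relation "Wellfounded.measure length") auto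

declare eps.simps [simp del]

lemma eps_Nil: "eps [] = (\<lambda>_. 1)"
  by (subst eps.simps) simp

text \<open>Letters i to j, counted from 1 to match the indices of defining systems: the
  coefficients of the subwords of w become the entries of a unipotent matrix.\<close>

definition subword :: "'a list \<Rightarrow> nat \<Rightarrow> nat \<Rightarrow> 'a list" where
  "subword w i j = take (j + 1 - i) (drop (i - 1) w)"

lemma length_subword: "1 \<le> i \<Longrightarrow> i \<le> j \<Longrightarrow> j \<le> length w \<Longrightarrow> length (subword w i j) = j + 1 - i"
  by (simp add: subword_def)

lemma take_subword: "1 \<le> i \<Longrightarrow> i \<le> r \<Longrightarrow> r \<le> j \<Longrightarrow> take (r + 1 - i) (subword w i j) = subword w i r"
  by (simp add: subword_def min_def)

lemma drop_subword: "1 \<le> i \<Longrightarrow> i \<le> r \<Longrightarrow> r \<le> j \<Longrightarrow> drop (r + 1 - i) (subword w i j) = subword w (r + 1) j"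
  by (simp add: subword_def drop_take add.commute Suc_diff_le)

lemma subword_full: "subword w 1 (length w) = w"
  by (simp add: subword_def)

lemma cup_subword:
  assumes "1 \<le> i" "i \<le> j" "j \<le> length w"
  shows "cup (\<lambda>i j. eps (subword w i j)) i j (s, t) =
    (\<Sum>k\<in>{1..<length (subword w i j)}. eps (take k (subword w i j)) s * eps (drop k (subword w i j)) t)"
  unfolding cup_apply
  by (rule sum.reindex_bij_witness[of _ "\<lambda>k. i + k - 1" "\<lambda>r. r + 1 - i"])
    (use assms take_subword[of i _ j w] drop_subword[of i _ j w] in \<open>auto simp: length_subword\<close>)

text \<open>The choice in \<open>eps\<close> is not void: by induction the coefficients of the
  proper subwords form a defining system, its cup sum is a cocycle, and \<open>lift_cocycle\<close>
  solves the equation with the prescribed values on X.\<close>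

lemma eps_props:
  assumes "w \<noteq> []"
  shows "loc_const T (eps w)"
    and "s \<in> carrier G \<Longrightarrow> t \<in> carrier G \<Longrightarrow> int p dvd
        dd (eps w) (s, t) + (\<Sum>k\<in>{1..<length w}. eps (take k w) s * eps (drop k w) t)"
    and "x \<in> X \<Longrightarrow> int p dvd eps w x - (if w = [x] then 1 else 0)"
proof -
  define P where "P w y \<longleftrightarrow> loc_const T y \<and>
     (\<forall>s\<in>carrier G. \<forall>t\<in>carrier G. int p dvd
        dd y (s, t) + (\<Sum>k\<in>{1..<length w}. eps (take k w) s * eps (drop k w) t)) \<and>
     (\<forall>x\<in>X. int p dvd y x - (if w = [x] then 1 else 0))" for w y
  have eps: "eps w = (SOME y. P w y)" if "w \<noteq> []" for w
    by (subst eps.simps) (simp only: that P_def[abs_def] if_False)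
  have "P w (eps w) \<and> int p dvd eps w \<one>"
    using assms
  proof (induction w rule: length_induct)
    case (1 w)
    let ?n = "length w" and ?c = "\<lambda>i j. eps (subword w i j)"
    have n: "?n \<ge> 1" using 1(2) by (cases w) auto
    have IH: "P (subword w i j) (?c i j)" "int p dvd ?c i j \<one>"
      if "1 \<le> i" "i \<le> j" "j \<le> ?n" "(i, j) \<noteq> (1, ?n)" for i j
    proof -
      have "length (subword w i j) < ?n" "subword w i j \<noteq> []"
        using that length_subword[OF that(1-3)] by auto
      then show "P (subword w i j) (?c i j)" "int p dvd ?c i j \<one>" using 1(1) by blast+
    qed
    have rel: "int p dvd dd (?c i j) (s, t) + cup ?c i j (s, t)"
      if "1 \<le> i" "i \<le> j" "j \<le> ?n" "(i, j) \<noteq> (1, ?n)" "s \<in> carrier G" "t \<in> carrier G" for i j s t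
      using IH(1)[OF that(1-4)] that cup_subword[OF that(1-3), of s t] by (simp add: P_def)
    \<comment> \<open>The added constant, a multiple of p, makes the cocycle vanish exactly at the
      identity, as \<open>lift_cocycle\<close> requires.\<close>
    let ?z = "\<lambda>q. - cup ?c 1 ?n q + cup ?c 1 ?n (\<one>, \<one>)"
    have lc: "loc_const (prod_topology T T) (cup ?c 1 ?n)"
    proof (rule loc_const_cup)
      fix r assume "1 \<le> r" "r < ?n"
      then show "loc_const T (?c 1 r) \<and> loc_const T (?c (r + 1) ?n)"
        using IH(1)[of 1 r] IH(1)[of "r + 1" ?n] by (simp add: P_def)
    qed
    have z1: "int p dvd cup ?c 1 ?n (\<one>, \<one>)"
      unfolding cup_apply using IH(2)[of 1] by (intro dvd_sum dvd_mult2) auto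
    have ce0: "cocycle_eq (cup ?c 1 ?n)" by (rule cocycle_eq_cup) (rule rel)
    have ce: "cocycle_eq ?z"
      by (rule cocycle_eq_cong_mod[OF cocycle_eq_uminus[OF ce0]]) (use z1 in simp)
    have lc': "loc_const (prod_topology T T) ?z"
      by (intro loc_const_add loc_const_uminus lc loc_const_const)
    have fin: "finite {x \<in> X. \<not> int p dvd (if w = [x] then 1 else 0 :: int)}"
    proof (rule finite_subset)
      show "{x \<in> X. \<not> int p dvd (if w = [x] then 1 else 0)} \<subseteq> {hd w}" by auto
    qed simp
    obtain y where y: "loc_const T y"
      "\<And>s t. s \<in> carrier G \<Longrightarrow> t \<in> carrier G \<Longrightarrow> int p dvd ?z (s, t) - dd y (s, t)"
      "\<And>x. x \<in> X \<Longrightarrow> int p dvd y x - (if w = [x] then 1 else 0)"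
      using lift_cocycle[OF lc' ce _ fin] by auto
    have sum: "(\<Sum>k\<in>{1..<?n}. eps (take k w) s * eps (drop k w) t) = cup ?c 1 ?n (s, t)" for s t
      using cup_subword[of 1 ?n w s t] n by (simp add: subword_full[simplified])
    have "P w y"
      unfolding P_def sum
    proof (intro conjI ballI y(1,3))
      fix s t assume "s \<in> carrier G" "t \<in> carrier G"
      then have "int p dvd - (?z (s, t) - dd y (s, t)) + cup ?c 1 ?n (\<one>, \<one>)"
        using y(2) z1 by (meson dvd_add dvd_minus_iff)
      then show "int p dvd dd y (s, t) + cup ?c 1 ?n (s, t)" by (simp add: algebra_simps)
    qed
    then have P: "P w (eps w)" unfolding eps[OF 1(2)] by (rule someI[of "P w" y])
    then have "int p dvd dd (eps w) (\<one>, \<one>) + cup ?c 1 ?n (\<one>, \<one>)"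
      unfolding P_def sum by simp
    then have "int p dvd dd (eps w) (\<one>, \<one>)" using z1 by (simp add: dvd_add_left_iff)
    then show ?case using P by (simp add: dd_apply)
  qed
  then have P: "P w (eps w)" ..
  then show "loc_const T (eps w)"
    and "s \<in> carrier G \<Longrightarrow> t \<in> carrier G \<Longrightarrow> int p dvd
        dd (eps w) (s, t) + (\<Sum>k\<in>{1..<length w}. eps (take k w) s * eps (drop k w) t)"
    and "x \<in> X \<Longrightarrow> int p dvd eps w x - (if w = [x] then 1 else 0)"
    by (auto simp: P_def)
qed

lemma unipotent_eps: "unipotent (length w) (\<lambda>i j. eps (subword w i j))"
  unfolding unipotent_def
proof (intro allI impI conjI ballI)
  fix i j assume ij: "1 \<le> i" "i \<le> j" "j \<le> length w"
  then have ne: "subword w i j \<noteq> []" using length_subword[OF ij] by auto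
  then show "loc_const T (eps (subword w i j))" by (rule eps_props)
  fix s t assume "s \<in> carrier G" "t \<in> carrier G"
  then show "int p dvd dd (eps (subword w i j)) (s, t) + cup (\<lambda>i j. eps (subword w i j)) i j (s, t)"
    using eps_props(2)[OF ne] cup_subword[OF ij] by simp
qed

text \<open>Multiplicativity of the Magnus map, coefficient by coefficient; the end terms k = 0 and
  k = \<open>length w\<close> come from the coefficient 1 of the empty word.\<close>

lemma eps_mult:
  assumes "s \<in> carrier G" "t \<in> carrier G"
  shows "int p dvd eps w (s \<otimes> t) - (\<Sum>k\<le>length w. eps (take k w) s * eps (drop k w) t)"
proof (cases "w = []")
  case True
  then show ?thesis by (simp add: eps_Nil)
next
  case False
  then have "{..length w} = insert 0 (insert (length w) {1..<length w})" "length w \<noteq> 0" by auto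
  then have "(\<Sum>k\<le>length w. eps (take k w) s * eps (drop k w) t) =
      eps w t + (eps w s + (\<Sum>k\<in>{1..<length w}. eps (take k w) s * eps (drop k w) t))"
    by (simp add: eps_Nil)
  moreover have "int p dvd - (dd (eps w) (s, t) + (\<Sum>k\<in>{1..<length w}. eps (take k w) s * eps (drop k w) t))"
    using eps_props(2)[OF False assms] by (subst dvd_minus_iff)
  ultimately show ?thesis by (simp add: dd_apply algebra_simps)
qed

lemma eps_vanish:
  assumes "w \<noteq> []" "length w < m" "s \<in> Z m"
  shows "int p dvd eps w s"
proof -
  have "1 \<le> length w" using assms(1) by (cases w) auto
  then show ?thesis
    using unipotent_vanish[OF unipotent_eps, of 1 "length w" w m s] assms
    by (simp add: subword_full[simplified])
qed

lemma eps_one: "w \<noteq> [] \<Longrightarrow> int p dvd eps w \<one>"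
  by (rule eps_vanish[of w "Suc (length w)"]) (auto intro: subgroup.one_closed[OF Z_subgroup])

section \<open>Taylor expansion along the Magnus coefficients\<close>

abbreviation rdiffs :: "'a list \<Rightarrow> ('a \<Rightarrow> int) \<Rightarrow> 'a \<Rightarrow> int" where
  "rdiffs w f \<equiv> foldr (rdiff G) w f"

text \<open>The Taylor polynomial of f at \<open>\<one>\<close>: \<open>rdiffs w f \<one>\<close> is
  the value of the linear extension of f at the product of the x - 1 over the letters x of w, and
  \<open>eps w\<close> is the dual coordinate. Y stands for a finite alphabet.\<close>

definition magnus :: "nat \<Rightarrow> 'a set \<Rightarrow> ('a \<Rightarrow> int) \<Rightarrow> 'a \<Rightarrow> int" where
  "magnus n Y f t = (\<Sum>w | set w \<subseteq> Y \<and> length w \<le> n. eps w t * rdiffs w f \<one>)"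

context
  fixes n :: nat and W :: "'a set"
  assumes W: "W \<lhd> G" "openin T W"
begin

interpretation F: filtration G "lower_filtration G" p
  by (rule filtration_lower)

text \<open>Invariance under W makes the differences by letters in W vanish modulo p, so that only
  the finitely many basis elements outside W matter.\<close>

definition bounded_degree :: "nat \<Rightarrow> ('a \<Rightarrow> int) \<Rightarrow> bool" where
  "bounded_degree m f \<longleftrightarrow> F.K m f \<and> (\<forall>x\<in>carrier G. \<forall>w\<in>W. int p dvd f (x \<otimes> w) - f x)"

abbreviation "Y \<equiv> {x \<in> X. x \<notin> W}"
abbreviation "words \<equiv> {w. set w \<subseteq> Y \<and> length w \<le> n}"

lemma finite_words: "finite words"
  using finite_lists_length_le[OF X_finite[OF W]] .

lemma low: "lower_filtration G 0 = carrier G" "lower_filtration G 1 = carrier G"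
  by (simp_all add: lower_filtration_def)

lemma W_carrier: "w \<in> W \<Longrightarrow> w \<in> carrier G"
  using openin_subset[OF W(2)] topspace_eq by blast

lemma bounded_degree_rdiff: "bounded_degree m f \<Longrightarrow> x \<in> carrier G \<Longrightarrow> bounded_degree (m - 1) (rdiff G x f)"
  unfolding bounded_degree_def using F.K_rdiff[of m f x 1] rdiff_invariant_mod[OF W(1)] low by simp

lemma bounded_degree_rdiffs: "bounded_degree m f \<Longrightarrow> set w \<subseteq> carrier G \<Longrightarrow> bounded_degree (m - length w) (rdiffs w f)"
proof (induction w)
  case (Cons x w)
  then show ?case using bounded_degree_rdiff[of "m - length w" "rdiffs w f" x] by simp
qed simp

lemma bounded_degree_mono: "bounded_degree m f \<Longrightarrow> m \<le> l \<Longrightarrow> bounded_degree l f"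
  using F.K_mono by (auto simp: bounded_degree_def)

lemma bounded_degree_left: "bounded_degree m f \<Longrightarrow> y \<in> carrier G \<Longrightarrow> bounded_degree m (\<lambda>x. f (y \<otimes> x))"
  unfolding bounded_degree_def using F.K_left[of m f y] low W_carrier by (auto simp: m_assoc[symmetric])

lemma bounded_degree_0: "bounded_degree 0 f \<Longrightarrow> x \<in> carrier G \<Longrightarrow> int p dvd f x"
  by (simp add: bounded_degree_def F.K_0 low)

lemma rdiffs_left:
  "set w \<subseteq> carrier G \<Longrightarrow> y \<in> carrier G \<Longrightarrow> x \<in> carrier G \<Longrightarrow>
    rdiffs w (\<lambda>x. f (y \<otimes> x)) x = rdiffs w f (y \<otimes> x)"
  by (induction w arbitrary: x) (auto simp: rdiff_apply m_assoc)

lemma words_carrier: "w \<in> words \<Longrightarrow> set w \<subseteq> carrier G"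
  using X_carrier by blast

text \<open>The coefficient of u at \<open>s \<otimes> t\<close> splits over the factorisations of u
  into words v and w. Allowing all pairs of words adds only pairs of total length above n, for which
  the iterated difference of f vanishes modulo p.\<close>

lemma magnus_split:
  assumes f: "bounded_degree (Suc n) f" and s: "s \<in> carrier G" and t: "t \<in> carrier G"
  shows "int p dvd magnus n Y f (s \<otimes> t) - (\<Sum>w\<in>words. eps w t * magnus n Y (rdiffs w f) s)"
proof -
  let ?A = "\<lambda>u. \<Sum>k\<le>length u. eps (take k u) s * eps (drop k u) t"
  have "int p dvd (\<Sum>u\<in>words. (eps u (s \<otimes> t) - ?A u) * rdiffs u f \<one>)"
    using eps_mult[OF s t] by (intro dvd_sum dvd_mult2) auto
  then have 1: "int p dvd magnus n Y f (s \<otimes> t) - (\<Sum>u\<in>words. ?A u * rdiffs u f \<one>)"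
    by (simp add: magnus_def left_diff_distrib sum_subtractf)
  define P where "P = {(v, w). v \<in> words \<and> w \<in> words \<and> length v + length w \<le> n}"
  let ?g = "\<lambda>(v, w). eps v s * eps w t * rdiffs (v @ w) f \<one>"
  have "(\<Sum>u\<in>words. ?A u * rdiffs u f \<one>) =
      (\<Sum>(u, k)\<in>Sigma words (\<lambda>u. {..length u}). eps (take k u) s * eps (drop k u) t * rdiffs u f \<one>)"
    using finite_words by (simp add: sum_distrib_right sum.Sigma)
  also have "\<dots> = (\<Sum>q\<in>P. ?g q)"
    by (rule sum.reindex_bij_witness[of _ "\<lambda>(v, w). (v @ w, length v)" "\<lambda>(u, k). (take k u, drop k u)"])
      (auto simp: P_def simp del: foldr_append dest: in_set_takeD in_set_dropD)
  also have "\<dots> = (\<Sum>q\<in>words \<times> words. if length (fst q) + length (snd q) \<le> n then ?g q else 0)"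
    by (rule sum.mono_neutral_cong_left) (use finite_words in \<open>auto simp: P_def\<close>)
  finally have 2: "(\<Sum>u\<in>words. ?A u * rdiffs u f \<one>) =
    (\<Sum>q\<in>words \<times> words. if length (fst q) + length (snd q) \<le> n then ?g q else 0)" .
  have "int p dvd (\<Sum>q\<in>words \<times> words. (if length (fst q) + length (snd q) \<le> n then ?g q else 0) - ?g q)"
  proof (rule dvd_sum)
    fix q assume "q \<in> words \<times> words"
    then obtain v w where q: "q = (v, w)" "v \<in> words" "w \<in> words" by blast
    have "int p dvd rdiffs (v @ w) f \<one>" if "n < length v + length w"
    proof (rule bounded_degree_0)
      have "set (v @ w) \<subseteq> carrier G" using words_carrier q(2,3) by simp
      from bounded_degree_rdiffs[OF f this] show "bounded_degree 0 (rdiffs (v @ w) f)" using that by simp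
    qed simp
    then show "int p dvd (if length (fst q) + length (snd q) \<le> n then ?g q else 0) - ?g q"
      by (auto simp: q(1) intro: dvd_mult)
  qed
  then have 3: "int p dvd (\<Sum>u\<in>words. ?A u * rdiffs u f \<one>) - (\<Sum>q\<in>words \<times> words. ?g q)"
    unfolding 2 sum_subtractf .
  have "(\<Sum>q\<in>words \<times> words. ?g q) = (\<Sum>v\<in>words. \<Sum>w\<in>words. ?g (v, w))"
    by (simp add: sum.cartesian_product)
  also have "\<dots> = (\<Sum>w\<in>words. \<Sum>v\<in>words. ?g (v, w))"
    by (rule sum.swap)
  also have "\<dots> = (\<Sum>w\<in>words. eps w t * magnus n Y (rdiffs w f) s)"
    by (simp add: magnus_def sum_distrib_left mult_ac)
  finally have 4: "(\<Sum>q\<in>words \<times> words. ?g q) = (\<Sum>w\<in>words. eps w t * magnus n Y (rdiffs w f) s)" .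
  show ?thesis using dvd_add[OF 1 3] unfolding 4 by simp
qed

text \<open>All f are tested at once, since products and inverses involve the expansion of
  translates and differences of f.\<close>

definition good :: "'a \<Rightarrow> bool" where
  "good t \<longleftrightarrow> (\<forall>f. bounded_degree (Suc n) f \<longrightarrow> int p dvd f t - magnus n Y f t)"

lemma magnus_one: "int p dvd magnus n Y f \<one> - f \<one>"
proof -
  have "magnus n Y f \<one> = f \<one> + (\<Sum>w\<in>words - {[]}. eps w \<one> * rdiffs w f \<one>)"
    unfolding magnus_def using finite_words by (subst sum.remove[of _ "[]"]) (auto simp: eps_Nil)
  moreover have "int p dvd (\<Sum>w\<in>words - {[]}. eps w \<one> * rdiffs w f \<one>)"
    using eps_one by (intro dvd_sum dvd_mult2) auto
  ultimately show ?thesis by simp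
qed

text \<open>Expand the left translate of f by s at t: its coefficients are the differences of f at
  s. Together with \<open>magnus_split\<close>, the error at \<open>s \<otimes> t\<close> becomes a
  combination of the errors of these differences at s.\<close>

lemma good_translate:
  assumes t: "good t" "t \<in> carrier G" and f: "bounded_degree (Suc n) f" and s: "s \<in> carrier G"
  shows "int p dvd (f (s \<otimes> t) - magnus n Y f (s \<otimes> t))
    - (\<Sum>w\<in>words. eps w t * (rdiffs w f s - magnus n Y (rdiffs w f) s))"
proof -
  have "int p dvd f (s \<otimes> t) - magnus n Y (\<lambda>x. f (s \<otimes> x)) t"
    by (rule t(1)[unfolded good_def, rule_format, OF bounded_degree_left[OF f s]])
  moreover have "magnus n Y (\<lambda>x. f (s \<otimes> x)) t = (\<Sum>w\<in>words. eps w t * rdiffs w f s)"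
    unfolding magnus_def using words_carrier s by (intro sum.cong refl) (simp add: rdiffs_left)
  ultimately have "int p dvd f (s \<otimes> t) - (\<Sum>w\<in>words. eps w t * rdiffs w f s)" by simp
  from dvd_diff[OF this magnus_split[OF f s t(2)]]
  show ?thesis by (simp add: sum_subtractf right_diff_distrib algebra_simps)
qed

lemma good_mult:
  assumes s: "good s" "s \<in> carrier G" and t: "good t" "t \<in> carrier G"
  shows "good (s \<otimes> t)"
  unfolding good_def
proof (intro allI impI)
  fix f assume f: "bounded_degree (Suc n) f"
  have "int p dvd rdiffs w f s - magnus n Y (rdiffs w f) s" if "w \<in> words" for w
    by (rule s(1)[unfolded good_def, rule_format, OF bounded_degree_mono[OF bounded_degree_rdiffs[OF f words_carrier[OF that]]]]) simp
  then have "int p dvd (\<Sum>w\<in>words. eps w t * (rdiffs w f s - magnus n Y (rdiffs w f) s))"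
    by (intro dvd_sum dvd_mult) auto
  from dvd_add[OF good_translate[OF t f s(2)] this]
  show "int p dvd f (s \<otimes> t) - magnus n Y f (s \<otimes> t)" by simp
qed

text \<open>
  Put \<open>s = t\<^sup>-\<^sup>1\<close> in \<open>good_translate\<close>: the terms of nonempty words involve polynomials of lower degree.
\<close>

lemma good_inv:
  assumes t: "good t" "t \<in> carrier G"
  shows "good (inv t)"
proof -
  have "int p dvd f (inv t) - magnus n Y f (inv t)" if "bounded_degree m f" "m \<le> Suc n" for m f
    using that
  proof (induction m arbitrary: f rule: less_induct)
    case (less m)
    have f: "bounded_degree (Suc n) f" using less.prems by (rule bounded_degree_mono)
    let ?D = "\<lambda>f. f (inv t) - magnus n Y f (inv t)"
    show ?case
    proof (cases "m = 0")
      case True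
      have "int p dvd rdiffs w f \<one>" if "w \<in> words" for w
        using bounded_degree_rdiffs[OF _ words_carrier[OF that], of 0 f] bounded_degree_0 less.prems(1) True by simp
      then have "int p dvd magnus n Y f (inv t)"
        unfolding magnus_def by (intro dvd_sum dvd_mult) auto
      then show ?thesis using bounded_degree_0[of f "inv t"] less.prems(1) True t(2) by simp
    next
      case False
      have "int p dvd ?D (rdiffs w f)" if "w \<in> words - {[]}" for w
      proof (rule less.IH)
        show "bounded_degree (m - length w) (rdiffs w f)"
          using bounded_degree_rdiffs[OF less.prems(1)] words_carrier that by blast
        have "length w > 0" using that by simp
        then show "m - length w < m" "m - length w \<le> Suc n" using False less.prems(2) by auto
      qed
      then have 1: "int p dvd (\<Sum>w\<in>words - {[]}. eps w t * ?D (rdiffs w f))"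
        by (intro dvd_sum dvd_mult) auto
      have "(\<Sum>w\<in>words. eps w t * ?D (rdiffs w f)) = ?D f + (\<Sum>w\<in>words - {[]}. eps w t * ?D (rdiffs w f))"
        using finite_words by (subst sum.remove[of _ "[]"]) (auto simp: eps_Nil)
      then have "int p dvd (f \<one> - magnus n Y f \<one>) - (?D f + (\<Sum>w\<in>words - {[]}. eps w t * ?D (rdiffs w f)))"
        using good_translate[OF t f, of "inv t"] t(2) by simp
      then have "int p dvd ((f \<one> - magnus n Y f \<one>) - (?D f + (\<Sum>w\<in>words - {[]}. eps w t * ?D (rdiffs w f))))
          + (magnus n Y f \<one> - f \<one>) + (\<Sum>w\<in>words - {[]}. eps w t * ?D (rdiffs w f))"
        using magnus_one 1 by (intro dvd_add[OF dvd_add]) auto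
      then have "int p dvd - ?D f" by (simp add: algebra_simps)
      then show ?thesis by (subst (asm) dvd_minus_iff)
    qed
  qed
  then show ?thesis by (auto simp: good_def)
qed

text \<open>At a basis element x only the empty word and the word [x] have nonzero coefficients
  modulo p, which leaves f(1) + (f(x) - f(1)). If x lies in W, the word [x] is absent, but then f(x)
  is congruent to f(1).\<close>

lemma good_basis:
  assumes n: "n \<ge> 1" and x: "x \<in> X"
  shows "good x"
  unfolding good_def
proof (intro allI impI)
  fix f assume f: "bounded_degree (Suc n) f"
  have xc: "x \<in> carrier G" using x X_carrier by blast
  let ?d = "\<lambda>w. if w = [] then f \<one> else if w = [x] then rdiff G x f \<one> else 0"
  have "int p dvd (\<Sum>w\<in>words. eps w x * rdiffs w f \<one> - ?d w)"
  proof (rule dvd_sum)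
    fix w assume "w \<in> words"
    show "int p dvd eps w x * rdiffs w f \<one> - ?d w"
    proof (cases "w = []")
      case True
      then show ?thesis by (simp add: eps_Nil)
    next
      case False
      from dvd_mult2[OF eps_props(3)[OF False x], of "rdiffs w f \<one>"] False
      show ?thesis by (auto simp: left_diff_distrib split: if_splits)
    qed
  qed
  then have 1: "int p dvd magnus n Y f x - (\<Sum>w\<in>words. ?d w)"
    by (simp only: magnus_def sum_subtractf)
  have "(\<Sum>w\<in>words. ?d w) = (\<Sum>w\<in>words. if w = [] then f \<one> else 0) + (\<Sum>w\<in>words. if w = [x] then rdiff G x f \<one> else 0)"
    by (subst sum.distrib[symmetric]) (intro sum.cong refl, auto)
  also have "\<dots> = f \<one> + (if x \<in> W then 0 else rdiff G x f \<one>)"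
    using finite_words n x by (simp add: sum.delta)
  finally have 2: "(\<Sum>w\<in>words. ?d w) = f \<one> + (if x \<in> W then 0 else rdiff G x f \<one>)" .
  have "int p dvd f x - (f \<one> + (if x \<in> W then 0 else rdiff G x f \<one>))"
  proof (cases "x \<in> W")
    case True
    then have "int p dvd f (\<one> \<otimes> x) - f \<one>" using f unfolding bounded_degree_def by blast
    then show ?thesis using True xc by simp
  next
    case False
    then show ?thesis using xc by (simp add: rdiff_apply)
  qed
  from dvd_diff[OF this 1[unfolded 2]] show "int p dvd f x - magnus n Y f x" by simp
qed

text \<open>The good elements form a closed subgroup, so the topological generators in X
  suffice.\<close>

lemma good_all:
  assumes n: "n \<ge> 1" and t: "t \<in> carrier G"
  shows "good t"
proof -
  define H where "H = {t \<in> carrier G. good t}"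
  have "subgroup H G"
  proof (rule subgroupI)
    have "good \<one>"
    proof (unfold good_def, intro allI impI)
      fix f show "int p dvd f \<one> - magnus n Y f \<one>"
        using magnus_one[of f] by (simp add: dvd_diff_commute)
    qed
    then show "H \<noteq> {}" by (auto simp: H_def)
  qed (auto simp: H_def good_inv good_mult)
  moreover have "closedin T H"
  proof -
    let ?C = "\<lambda>f. {t \<in> topspace T. (f t - magnus n Y f t) mod int p \<in> {0}}"
    have cl: "closedin T (?C f)" if f: "bounded_degree (Suc n) f" for f
    proof -
      interpret W: normal W G by (rule W(1))
      \<comment> \<open>f itself is W-invariant only modulo p, so it is its reduction that is
        locally constant.\<close>
      have 1: "loc_const T (\<lambda>t. f t mod int p)"
      proof (rule loc_constI[OF W.subgroup_axioms W(2)])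
        fix w x assume wx: "w \<in> W" "x \<in> carrier G"
        have "w \<otimes> x = x \<otimes> (inv x \<otimes> w \<otimes> x)" using wx W_carrier by (simp add: group_simps)
        moreover have "int p dvd f (x \<otimes> (inv x \<otimes> w \<otimes> x)) - f x"
          using f wx W.inv_op_closed1[OF wx(2,1)] by (simp add: bounded_degree_def)
        ultimately show "f (w \<otimes> x) mod int p = f x mod int p" by (simp add: mod_eq_dvd_iff)
      qed
      have le: "loc_const T (eps w)" for w
        by (cases "w = []") (simp_all add: eps_Nil eps_props(1))
      have 2: "loc_const T (magnus n Y f)"
        unfolding magnus_def[abs_def]
        by (intro loc_const_sum loc_const_mult loc_const_const le finite_words)
      from loc_const_comp2[OF 1 2, of "\<lambda>a b. (a - b) mod int p"]
      have "loc_const T (\<lambda>t. (f t - magnus n Y f t) mod int p)" by (simp add: mod_simps)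
      then show ?thesis by (rule closedin_continuous_map_preimage) simp
    qed
    have "H = (\<Inter>f\<in>{f. bounded_degree (Suc n) f}. ?C f) \<inter> topspace T"
      by (auto simp: H_def good_def topspace_eq mod_eq_0_iff_dvd)
    moreover have "bounded_degree (Suc n) (\<lambda>_. 0)" by (auto simp: bounded_degree_def intro: F.K_zero)
    then have "closedin T (\<Inter>f\<in>{f. bounded_degree (Suc n) f}. ?C f)"
      using cl by (intro closedin_INT) auto
    ultimately show ?thesis by (simp add: closedin_Int)
  qed
  moreover have "X \<subseteq> H" using good_basis[OF n] X_carrier by (auto simp: H_def)
  ultimately have "H = carrier G" by (rule closed_subgroup_eq)
  then show ?thesis using t by (auto simp: H_def)
qed

end

lemma magnus_expansion:
  assumes "n \<ge> 1" and W: "W \<lhd> G" "openin T W"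
    and "deg_less p G (lower_filtration G) (Suc n) f"
    and "\<And>x w. x \<in> carrier G \<Longrightarrow> w \<in> W \<Longrightarrow> int p dvd f (x \<otimes> w) - f x" and "t \<in> carrier G"
  shows "int p dvd f t - (\<Sum>w | set w \<subseteq> {x \<in> X. x \<notin> W} \<and> length w \<le> n. eps w t * rdiffs w f \<one>)"
  using good_all[OF W assms(1,6)] assms(4,5)
  by (simp add: good_def[OF W] bounded_degree_def[OF W] magnus_def)

end

section \<open>Massey products\<close>

context cohomology
begin

lemma cup_sum_eq: "cup_sum p G c i j = (\<lambda>q\<in>carrier G \<times> carrier G. (- cup c i j q) mod int p)"
  by (auto simp: cup_sum_def cup_def fun_eq_iff)

lemma defining_system_iff:
  "defining_system p n G T c \<longleftrightarrow> (\<forall>i j. 1 \<le> i \<and> i \<le> j \<and> j \<le> n \<and> (i, j) \<noteq> (1, n) \<longrightarrow>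
     c i j \<in> carrier C1 \<and> (\<forall>s\<in>carrier G. \<forall>t\<in>carrier G. int p dvd dd (c i j) (s, t) + cup c i j (s, t)))"
proof -
  have eq: "cobd p G (c i j) = cup_sum p G c i j \<longleftrightarrow>
      (\<forall>s\<in>carrier G. \<forall>t\<in>carrier G. int p dvd dd (c i j) (s, t) + cup c i j (s, t))" for i j
  proof -
    have "cobd p G (c i j) = cup_sum p G c i j \<longleftrightarrow>
        (\<forall>q\<in>carrier G \<times> carrier G. dd (c i j) q mod int p = (- cup c i j q) mod int p)"
      unfolding cobd_eq cup_sum_eq by (auto simp: fun_eq_iff restrict_def)
    then show ?thesis by (simp add: mod_eq_dvd_iff)
  qed
  show ?thesis unfolding defining_system_def eq ..
qed

lemma cup_sum_cocycle:
  assumes "defining_system p n G T c"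
  shows "cup_sum p G c 1 n \<in> carrier Z2"
  unfolding cup_sum_eq
proof (intro cocycle_mod loc_const_uminus cocycle_eq_uminus loc_const_cup cocycle_eq_cup)
  fix r assume "1 \<le> r" "r < n"
  then show "loc_const T (c 1 r) \<and> loc_const T (c (r + 1) n)"
    using assms[unfolded defining_system_iff, rule_format, of 1 r]
      assms[unfolded defining_system_iff, rule_format, of "r + 1" n] by (auto simp: C1_iff)
next
  fix i j s t assume "1 \<le> i" "i \<le> j" "j \<le> n" "(i, j) \<noteq> (1, n)" "s \<in> carrier G" "t \<in> carrier G"
  then show "int p dvd dd (c i j) (s, t) + cup c i j (s, t)"
    using assms unfolding defining_system_iff by blast
qed

lemma massey_products_subset: "massey_products p n G T \<subseteq> carrier H2G"
  using cup_sum_cocycle cls_in by (auto simp: massey_products_def)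

end

locale free_profinite_massey = free_profinite G T p X for G (structure) and T and p and X +
  fixes n :: nat
  assumes n: "n \<ge> 2"
begin

sublocale M: transgression_setup G T p "Z n"
  using n by (rule transgression_setup_Z)

text \<open>The coboundary of the corner entry \<open>c 1 n\<close> is the inflation of the Massey
  cocycle of d, so its restriction to \<open>Z n\<close> transgresses to the Massey class. This
  serves both directions: from a representation to a defining system of the quotient, and
  back.\<close>

lemma massey_trg:
  assumes c: "unipotent n c" and d: "defining_system p n M.GN M.TN d"
    and cd: "\<And>i j x. 1 \<le> i \<Longrightarrow> i \<le> j \<Longrightarrow> j \<le> n \<Longrightarrow> (i, j) \<noteq> (1, n) \<Longrightarrow> x \<in> carrier G \<Longrightarrow>
      int p dvd c i j x - d i j (M.\<pi> x)"
  defines "\<psi> \<equiv> (\<lambda>x\<in>Z n. c 1 n x mod int p)"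
  shows "\<psi> \<in> carrier M.H1G" "M.trg \<psi> = M.Q.cls (cup_sum p M.GN d 1 n)"
    "\<And>x. x \<in> Z (Suc n) \<Longrightarrow> \<psi> x = 0"
proof -
  let ?z = "cup_sum p M.GN d 1 n"
  have z: "?z \<in> carrier M.Q.Z2" using d by (rule M.Q.cup_sum_cocycle)
  have cup_eq: "int p dvd cup c 1 n (x, y) - cup d 1 n (M.\<pi> x, M.\<pi> y)"
    if "x \<in> carrier G" "y \<in> carrier G" for x y
    unfolding cup_apply sum_subtractf[symmetric]
  proof (rule dvd_sum)
    fix r assume r: "r \<in> {1..<n}"
    have "int p dvd (c 1 r x - d 1 r (M.\<pi> x)) * c (r + 1) n y
        + d 1 r (M.\<pi> x) * (c (r + 1) n y - d (r + 1) n (M.\<pi> y))"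
      using cd[of 1 r x] cd[of "r + 1" n y] r that by (intro dvd_add dvd_mult dvd_mult2) auto
    then show "int p dvd c 1 r x * c (r + 1) n y - d 1 r (M.\<pi> x) * d (r + 1) n (M.\<pi> y)"
      by (simp add: algebra_simps)
  qed
  have zval: "int p dvd - cup c 1 n (x, y) - ?z (M.\<pi> x, M.\<pi> y)" if "x \<in> carrier G" "y \<in> carrier G" for x y
  proof -
    have "?z (M.\<pi> x, M.\<pi> y) = (- cup d 1 n (M.\<pi> x, M.\<pi> y)) mod int p"
      using M.pi_in that by (simp add: M.Q.cup_sum_eq)
    moreover have "(- cup c 1 n (x, y)) mod int p = (- cup d 1 n (M.\<pi> x, M.\<pi> y)) mod int p"
      using cup_eq[OF that] by (intro mod_minus_cong) (simp add: mod_eq_dvd_iff)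
    ultimately show ?thesis by (simp add: mod_eq_dvd_iff[symmetric])
  qed
  have lc: "loc_const T (c 1 n)" using unipotentD(1)[OF c, of 1 n] n by simp
  have dy: "int p dvd dd (c 1 n) (x, y) - ?z (M.\<pi> x, M.\<pi> y)" if "x \<in> carrier G" "y \<in> carrier G" for x y
    using dvd_add[OF unipotentD(2)[OF c, of 1 n x y] zval[OF that]] n that by simp
  have "int p dvd cup c 1 n (\<one>, \<one>)"
    unfolding cup_apply using unipotent_one[OF c, of 1] by (intro dvd_sum dvd_mult2) auto
  from dvd_add[OF zval[of \<one> \<one>] this] have "int p dvd - ?z (M.\<pi> \<one>, M.\<pi> \<one>)" by simp
  then have "int p dvd ?z (M.\<pi> \<one>, M.\<pi> \<one>)" by (subst (asm) dvd_minus_iff)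
  moreover have "M.\<pi> \<one> \<in> carrier M.GN" by (rule M.pi_in) simp
  then have "0 \<le> ?z (M.\<pi> \<one>, M.\<pi> \<one>)" "?z (M.\<pi> \<one>, M.\<pi> \<one>) < int p"
    using z by (auto simp: M.Q.Z2_iff M.Q.C2_iff)
  ultimately have z11: "?z (M.\<pi> \<one>, M.\<pi> \<one>) = 0" by (rule dvd_range_zero)
  note 1 = M.trg_dataI[OF lc z dy z11]
  show "\<psi> \<in> carrier M.H1G" using 1(1) by (simp add: \<psi>_def)
  show "M.trg \<psi> = M.Q.cls ?z" using M.trg_eq[OF 1] by (simp add: \<psi>_def)
  fix x assume x: "x \<in> Z (Suc n)"
  have "int p dvd c 1 n x"
    using unipotent_vanish[OF c _ _ _ _ x, of 1 n] n by simp
  then show "\<psi> x = 0" using x Z_Suc by (auto simp: \<psi>_def)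
qed

text \<open>All entries but the corner vanish on \<open>Z n\<close> and so are invariant under
  translation by \<open>Z n\<close>, modulo p; they descend to a defining system of the quotient, to
  which \<open>massey_trg\<close> applies.\<close>

lemma massey_of_unipotent:
  assumes c: "unipotent n c"
  shows "M.trg (\<lambda>x\<in>Z n. c 1 n x mod int p) \<in> massey_products p n M.GN M.TN"
    and "(\<lambda>x\<in>Z n. c 1 n x mod int p) \<in> carrier M.H1G"
proof -
  define d where "d i j = (\<lambda>A\<in>carrier M.GN. c i j (M.rep A) mod int p)" for i j
  have dval: "d i j (M.\<pi> x) = c i j x mod int p"
    if ij: "1 \<le> i" "i \<le> j" "j \<le> n" "(i, j) \<noteq> (1, n)" and x: "x \<in> carrier G" for i j x
  proof -
    obtain m where m: "m \<in> Z n" "M.rep (M.\<pi> x) = m \<otimes> x" using M.rep[OF x] by blast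
    \<comment> \<open>Off the corner, i > 1 or j < n makes the entry at least one step
      shorter.\<close>
    have "j + 2 - i \<le> n" using ij by (cases "i = 1") auto
    then have "int p dvd c i j m" "int p dvd c i j (m \<otimes> x) - c i j m - c i j x"
      using unipotent_vanish[OF c ij(1-3) _ m(1)] unipotent_translate[OF c ij(1-3) _ m(1) x] by auto
    from dvd_add[OF this] have "c i j (m \<otimes> x) mod int p = c i j x mod int p"
      by (simp add: mod_eq_dvd_iff)
    then show ?thesis using M.pi_in[OF x] by (simp add: d_def m(2))
  qed
  have d: "defining_system p n M.GN M.TN d"
    unfolding M.Q.defining_system_iff
  proof (intro allI impI conjI ballI)
    fix i j assume "1 \<le> i \<and> i \<le> j \<and> j \<le> n \<and> (i, j) \<noteq> (1, n)"
    then have ij: "1 \<le> i" "i \<le> j" "j \<le> n" "(i, j) \<noteq> (1, n)" by auto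
    show "d i j \<in> carrier M.Q.C1"
      unfolding M.Q.C1_iff
    proof (intro conjI ballI)
      have "loc_const T (\<lambda>x. c i j x mod int p)"
        by (rule loc_const_comp[OF unipotentD(1)[OF c ij(1-3)]])
      then show "loc_const M.TN (d i j)"
        unfolding M.loc_const_pi_iff
        by (rule loc_const_cong[rotated]) (simp add: dval[OF ij] topspace_eq)
    qed (use p_pos in \<open>simp_all add: d_def\<close>)
    fix A B assume "A \<in> carrier M.GN" "B \<in> carrier M.GN"
    then obtain x y where x: "x \<in> carrier G" "A = M.\<pi> x" and y: "y \<in> carrier G" "B = M.\<pi> y"
      using M.carrier_GN by metis
    have "(M.Q.dd (d i j) (A, B) + cup d i j (A, B)) mod int p = (dd (c i j) (x, y) + cup c i j (x, y)) mod int p"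
    proof (rule mod_add_cong)
      show "M.Q.dd (d i j) (A, B) mod int p = dd (c i j) (x, y) mod int p"
        unfolding x(2) y(2) M.Q.dd_apply dd_apply M.pi_mult[OF x(1) y(1)]
        using x(1) y(1) by (intro mod_diff_cong mod_add_cong) (simp_all add: dval[OF ij])
      show "cup d i j (A, B) mod int p = cup c i j (x, y) mod int p"
        unfolding mod_eq_dvd_iff cup_apply sum_subtractf[symmetric]
      proof (rule dvd_sum)
        fix r assume r: "r \<in> {i..<j}"
        have "d i r A = c i r x mod int p" "d (r + 1) j B = c (r + 1) j y mod int p"
          using dval[of i r x] dval[of "r + 1" j y] r ij x y by auto
        then show "int p dvd d i r A * d (r + 1) j B - c i r x * c (r + 1) j y"
          by (simp add: mod_eq_dvd_iff[symmetric] mod_mult_eq)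
      qed
    qed
    moreover have "int p dvd dd (c i j) (x, y) + cup c i j (x, y)"
      using unipotentD(2)[OF c ij(1-3)] x y by blast
    ultimately show "int p dvd M.Q.dd (d i j) (A, B) + cup d i j (A, B)"
      by (simp add: mod_eq_0_iff_dvd[symmetric])
  qed
  have cd: "int p dvd c i j x - d i j (M.\<pi> x)"
    if "1 \<le> i" "i \<le> j" "j \<le> n" "(i, j) \<noteq> (1, n)" "x \<in> carrier G" for i j x
    using dval[OF that] by (simp add: mod_eq_dvd_iff[symmetric])
  show "M.trg (\<lambda>x\<in>Z n. c 1 n x mod int p) \<in> massey_products p n M.GN M.TN"
    using massey_trg(2)[OF c d cd] d unfolding massey_products_def by blast
  show "(\<lambda>x\<in>Z n. c 1 n x mod int p) \<in> carrier M.H1G"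
    by (rule massey_trg(1)[OF c d cd])
qed

text \<open>Inflated to G, the cup sum of the defining system becomes a coboundary, as H^2 of the
  free group vanishes; the bounding cochain is the missing corner entry of a unipotent
  representation, and \<open>massey_trg\<close> applies.\<close>

lemma massey_product_trg:
  assumes "\<alpha> \<in> massey_products p n M.GN M.TN"
  obtains \<psi> where "\<psi> \<in> carrier M.H1G" "\<And>x. x \<in> Z (Suc n) \<Longrightarrow> \<psi> x = 0" "\<alpha> = M.trg \<psi>"
proof -
  obtain d where d: "defining_system p n M.GN M.TN d" "\<alpha> = M.Q.cls (cup_sum p M.GN d 1 n)"
    using assms by (auto simp: massey_products_def)
  have d1: "d i j \<in> carrier M.Q.C1" and d2: "A \<in> carrier M.GN \<Longrightarrow> B \<in> carrier M.GN \<Longrightarrow>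
      int p dvd M.Q.dd (d i j) (A, B) + cup d i j (A, B)"
    if "1 \<le> i" "i \<le> j" "j \<le> n" "(i, j) \<noteq> (1, n)" for i j A B
    using d(1) that unfolding M.Q.defining_system_iff by blast+
  define c0 where "c0 i j x = d i j (M.\<pi> x)" for i j x
  have lc: "loc_const T (c0 i j)" if "1 \<le> i" "i \<le> j" "j \<le> n" "(i, j) \<noteq> (1, n)" for i j
  proof -
    have "loc_const M.TN (d i j)" using d1[OF that] by (simp add: M.Q.C1_iff)
    then show ?thesis unfolding M.loc_const_pi_iff c0_def[abs_def] .
  qed
  have rel: "int p dvd dd (c0 i j) (x, y) + cup c0 i j (x, y)"
    if "1 \<le> i" "i \<le> j" "j \<le> n" "(i, j) \<noteq> (1, n)" "x \<in> carrier G" "y \<in> carrier G" for i j x y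
    using d2[OF that(1-4) M.pi_in[OF that(5)] M.pi_in[OF that(6)]] that
    by (simp add: dd_apply M.Q.dd_apply cup_apply c0_def M.rcos_sum)
  have ce: "cocycle_eq (\<lambda>q. - cup c0 1 n q)"
    by (rule cocycle_eq_uminus, rule cocycle_eq_cup) (rule rel)
  have lcc: "loc_const (prod_topology T T) (\<lambda>q. - cup c0 1 n q)"
  proof (intro loc_const_uminus loc_const_cup)
    fix r assume "1 \<le> r" "r < n"
    then show "loc_const T (c0 1 r) \<and> loc_const T (c0 (r + 1) n)" by (auto intro!: lc)
  qed
  obtain y where y: "loc_const T y"
    "\<And>s t. s \<in> carrier G \<Longrightarrow> t \<in> carrier G \<Longrightarrow> int p dvd - cup c0 1 n (s, t) - dd y (s, t)"
    using H2_vanish[OF lcc ce] by blast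
  define c where "c i j = (if (i, j) = (1, n) then y else c0 i j)" for i j
  have cup_c: "cup c i j q = cup c0 i j q" if "1 \<le> i" "i \<le> j" "j \<le> n" for i j q
    unfolding cup_def case_prod_beta c_def using that by (intro sum.cong refl) auto
  have c: "unipotent n c"
    unfolding unipotent_def
  proof (intro allI impI conjI ballI)
    fix i j assume ij: "1 \<le> i" "i \<le> j" "j \<le> n"
    show "loc_const T (c i j)" using lc[OF ij] y(1) by (auto simp: c_def)
    fix s t assume st: "s \<in> carrier G" "t \<in> carrier G"
    show "int p dvd dd (c i j) (s, t) + cup c i j (s, t)"
    proof (cases "(i, j) = (1, n)")
      case True
      have "int p dvd - (- cup c0 1 n (s, t) - dd y (s, t))"
        using y(2)[OF st] by (subst dvd_minus_iff)
      then show ?thesis using True cup_c[OF ij] by (simp add: c_def add.commute)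
    next
      case False
      then have "c i j = c0 i j" by (auto simp: c_def)
      then show ?thesis using rel[OF ij False st] cup_c[OF ij] by simp
    qed
  qed
  have cd: "int p dvd c i j x - d i j (M.\<pi> x)"
    if "1 \<le> i" "i \<le> j" "j \<le> n" "(i, j) \<noteq> (1, n)" "x \<in> carrier G" for i j x
    using that by (auto simp: c_def c0_def)
  show thesis
  proof (rule that)
    show "(\<lambda>x\<in>Z n. c 1 n x mod int p) \<in> carrier M.H1G"
      by (rule massey_trg(1)[OF c d(1)]) (rule cd)
    show "(\<lambda>x\<in>Z n. c 1 n x mod int p) x = 0" if "x \<in> Z (Suc n)" for x
      by (rule massey_trg(3)[OF c d(1) _ that]) (rule cd)
    show "\<alpha> = M.trg (\<lambda>x\<in>Z n. c 1 n x mod int p)"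
      unfolding d(2) by (rule massey_trg(2)[OF c d(1), symmetric]) (rule cd)
  qed
qed

lemma H2_Massey_eq:
  "generate M.Q.H2G (massey_products p n M.GN M.TN) = M.trg ` {\<psi> \<in> carrier M.H1G. \<forall>x\<in>Z (Suc n). \<psi> x = 0}"
  (is "?gen = M.trg ` ?V")
proof
  interpret H1: comm_group M.H1G by (rule M.H1_comm_group)
  interpret H2: comm_group M.Q.H2G by (rule M.Q.H2_comm_group)
  interpret h: group_hom M.H1G M.Q.H2G M.trg
    using M.trg_hom by (simp add: group_hom_def group_hom_axioms_def H1.is_group H2.is_group)
  have Zsub: "x \<in> Z (Suc n) \<Longrightarrow> x \<in> Z n" for x using Z_Suc by blast
  have V: "subgroup ?V M.H1G"
  proof (rule H1.subgroupI)
    show "?V \<noteq> {}" using H1.one_closed Zsub by (auto simp: M.H1_one intro!: exI[of _ "\<one>\<^bsub>M.H1G\<^esub>"])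
    fix \<psi> assume \<psi>: "\<psi> \<in> ?V"
    have inv_mult: "(inv\<^bsub>M.H1G\<^esub> \<psi> \<otimes>\<^bsub>M.H1G\<^esub> \<psi>) x = 0" if "x \<in> Z n" for x
      using \<psi> that by (simp add: M.H1_one)
    have "(inv\<^bsub>M.H1G\<^esub> \<psi>) x mod int p = 0" if "x \<in> Z (Suc n)" for x
    proof -
      have "\<psi> x = 0" "((inv\<^bsub>M.H1G\<^esub> \<psi>) x + \<psi> x) mod int p = 0"
        using inv_mult[OF Zsub[OF that]] \<psi> that Zsub[OF that] by (simp_all add: M.H1_mult)
      then show ?thesis by simp
    qed
    moreover have "(inv\<^bsub>M.H1G\<^esub> \<psi>) x mod int p = (inv\<^bsub>M.H1G\<^esub> \<psi>) x" if "x \<in> Z n" for x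
      using \<psi> H1.inv_closed[of \<psi>] that by (intro mod_pos_pos_trivial) (auto simp: M.H1_iff M.H1_cochain)
    ultimately show "inv\<^bsub>M.H1G\<^esub> \<psi> \<in> ?V" using \<psi> Zsub by auto
    fix \<psi>' assume \<psi>': "\<psi>' \<in> ?V"
    have "\<psi> \<otimes>\<^bsub>M.H1G\<^esub> \<psi>' \<in> carrier M.H1G" using \<psi> \<psi>' by simp
    moreover have "(\<psi> \<otimes>\<^bsub>M.H1G\<^esub> \<psi>') x = 0" if "x \<in> Z (Suc n)" for x
      using \<psi> \<psi>' that Zsub[OF that] by (simp add: M.H1_mult)
    ultimately show "\<psi> \<otimes>\<^bsub>M.H1G\<^esub> \<psi>' \<in> ?V" by blast
  qed auto
  have "massey_products p n M.GN M.TN \<subseteq> M.trg ` ?V"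
  proof
    fix \<alpha> assume "\<alpha> \<in> massey_products p n M.GN M.TN"
    then obtain \<psi> where "\<psi> \<in> carrier M.H1G" "\<And>x. x \<in> Z (Suc n) \<Longrightarrow> \<psi> x = 0" "\<alpha> = M.trg \<psi>"
      using massey_product_trg by blast
    then show "\<alpha> \<in> M.trg ` ?V" by auto
  qed
  then show "?gen \<subseteq> M.trg ` ?V"
    by (rule H2.generate_subgroup_incl[OF _ h.subgroup_img_is_subgroup[OF V]])
  have gen: "subgroup ?gen M.Q.H2G"
    using M.Q.massey_products_subset by (rule H2.generate_is_subgroup)
  \<comment> \<open>Combinations of Magnus coefficients are formed among the characters, before
    transgression; P is closed under sums.\<close>
  define P where "P = {\<psi> \<in> carrier M.H1G. M.trg \<psi> \<in> ?gen}"
  have P_mult: "\<psi> \<otimes>\<^bsub>M.H1G\<^esub> \<psi>' \<in> P" if "\<psi> \<in> P" "\<psi>' \<in> P" for \<psi> \<psi>'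
    using that subgroup.m_closed[OF gen] by (simp add: P_def)
  have P_0: "(\<lambda>x\<in>Z n. 0) \<in> P"
    using H1.one_closed h.hom_one subgroup.one_closed[OF gen] by (simp add: P_def M.H1_one)
  \<comment> \<open>Scalar multiples are obtained as repeated sums, so the scalar is a natural
    number here.\<close>
  have P_eps: "(\<lambda>x\<in>Z n. (int k * eps w x) mod int p) \<in> P" if "length w = n" for k w
  proof (induction k)
    case 0
    show ?case using P_0 by (simp only: of_nat_0 mult_zero_left mod_0)
  next
    case (Suc k)
    have "(\<lambda>x\<in>Z n. eps w x mod int p) \<in> P"
      using massey_of_unipotent[OF unipotent_eps[of w, unfolded that]] that
        subword_full[of w] H2.generate_incl M.Q.massey_products_subset generate.incl
      by (fastforce simp: P_def)
    from P_mult[OF Suc this] show ?case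
      by (simp add: M.H1_mult restrict_def mod_add_eq distrib_right add.commute cong: if_cong)
  qed
  have P_sum: "(\<lambda>x\<in>Z n. (\<Sum>w\<in>A. a w * eps w x) mod int p) \<in> P"
    if "finite A" "\<And>w. w \<in> A \<Longrightarrow> length w = n" for A and a :: "'a list \<Rightarrow> int"
    using that
  proof (induction A rule: finite_induct)
    case empty
    show ?case using P_0 by (simp only: sum.empty mod_0)
  next
    case (insert w A)
    \<comment> \<open>Replacing the coefficient by its residue makes it a natural number, as
      \<open>P_eps\<close> requires.\<close>
    have "int (nat (a w mod int p)) = a w mod int p" using p_pos by simp
    then have "(\<lambda>x\<in>Z n. (a w mod int p * eps w x) mod int p) \<in> P"
      using P_eps[of w "nat (a w mod int p)"] insert.prems by simp
    from P_mult[OF this insert.IH] insert.prems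
    have "(\<lambda>x\<in>Z n. ((a w mod int p * eps w x) mod int p + (\<Sum>w\<in>A. a w * eps w x) mod int p) mod int p) \<in> P"
      by (simp add: M.H1_mult restrict_def cong: if_cong)
    moreover have "((a w mod int p * eps w x) mod int p + (\<Sum>w\<in>A. a w * eps w x) mod int p) mod int p
        = (\<Sum>w\<in>insert w A. a w * eps w x) mod int p" for x
      using insert.hyps by (simp add: mod_add_eq mod_mult_left_eq)
    ultimately show ?case by (simp only:)
  qed
  show "M.trg ` ?V \<subseteq> ?gen"
  proof
    fix \<alpha> assume "\<alpha> \<in> M.trg ` ?V"
    then obtain \<psi> where \<psi>: "\<psi> \<in> carrier M.H1G" "\<forall>x\<in>Z (Suc n). \<psi> x = 0" "\<alpha> = M.trg \<psi>" by blast
    obtain W where W: "W \<lhd> G" "openin T W" "\<And>x. x \<in> W \<inter> Z n \<Longrightarrow> \<psi> x = 0"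
      using M.H1_open_normal[OF \<psi>(1)] by blast
    have hom: "int p dvd \<psi> (x \<otimes> y) - \<psi> x - \<psi> y" if "x \<in> Z n" "y \<in> Z n" for x y
    proof -
      have "int p dvd - (\<psi> x + \<psi> y - \<psi> (x \<otimes> y))"
        using \<psi>(1) that by (subst dvd_minus_iff) (simp add: M.H1_iff)
      then show ?thesis by (simp add: algebra_simps)
    qed
    have "\<exists>f. deg_less p G (lower_filtration G) (Suc n) f \<and>
        (\<forall>x\<in>carrier G. \<forall>w\<in>W. int p dvd f (x \<otimes> w) - f x) \<and> (\<forall>x\<in>Z n. int p dvd f x - \<psi> x)"
      using n \<psi>(2) W(3) by (intro zassenhaus_hom_extends[OF _ W(1,2) hom]) auto
    then obtain f where f: "deg_less p G (lower_filtration G) (Suc n) f"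
      "\<And>x w. x \<in> carrier G \<Longrightarrow> w \<in> W \<Longrightarrow> int p dvd f (x \<otimes> w) - f x"
      "\<And>x. x \<in> Z n \<Longrightarrow> int p dvd f x - \<psi> x"
      by blast
    define Y where "Y = {x \<in> X. x \<notin> W}"
    have Yfin: "finite Y" unfolding Y_def by (rule X_finite[OF W(1,2)])
    define A where "A = {w. set w \<subseteq> Y \<and> length w = n}"
    have A: "finite A" unfolding A_def by (rule finite_lists_length_eq[OF Yfin])
    let ?a = "\<lambda>w. rdiffs w f \<one>"
    have "\<psi> x = (\<Sum>w\<in>A. ?a w * eps w x) mod int p" if x: "x \<in> Z n" for x
    proof -
      let ?B = "{w. set w \<subseteq> Y \<and> length w \<le> n}"
      have B: "finite ?B" by (rule finite_lists_length_le[OF Yfin])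
      have 1: "int p dvd f x - (\<Sum>w\<in>?B. eps w x * ?a w)"
        unfolding Y_def using magnus_expansion[OF _ W(1,2) f(1,2)] n Z_carrier[OF x] by simp
      have "int p dvd f \<one> - \<psi> \<one>" using f(3) subgroup.one_closed[OF Z_subgroup] by blast
      then have f1: "int p dvd f \<one>" using M.H1_one_eq_0[OF \<psi>(1)] by simp
      \<comment> \<open>On \<open>Z n\<close> only the words of length n survive in the Taylor
        expansion: shorter nonempty words have vanishing coefficients there modulo p, and the
        constant term f(1) is congruent to \<open>\<psi> \<one> = 0\<close>.\<close>
      have "(\<Sum>w\<in>?B. eps w x * ?a w) = (\<Sum>w\<in>A. eps w x * ?a w) + (\<Sum>w\<in>?B - A. eps w x * ?a w)"
        using sum.subset_diff[of A ?B] B by (auto simp: A_def add.commute)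
      moreover have "int p dvd (\<Sum>w\<in>?B - A. eps w x * ?a w)"
      proof (rule dvd_sum)
        fix w assume w: "w \<in> ?B - A"
        show "int p dvd eps w x * ?a w"
        proof (cases "w = []")
          case True
          then show ?thesis using f1 by simp
        next
          case False
          then show ?thesis using w x by (intro dvd_mult2 eps_vanish[of w n]) (auto simp: A_def)
        qed
      qed
      ultimately have "int p dvd (f x - (\<Sum>w\<in>?B. eps w x * ?a w)) + (\<Sum>w\<in>?B - A. eps w x * ?a w) - (f x - \<psi> x)"
        using 1 f(3)[OF x] by (intro dvd_diff[OF dvd_add]) auto
      then have "int p dvd \<psi> x - (\<Sum>w\<in>A. eps w x * ?a w)"
        using \<open>(\<Sum>w\<in>?B. eps w x * ?a w) = _\<close> by simp
      then have "\<psi> x mod int p = (\<Sum>w\<in>A. ?a w * eps w x) mod int p"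
        by (simp add: mod_eq_dvd_iff mult.commute)
      moreover have "\<psi> x mod int p = \<psi> x"
        using \<psi>(1) x by (intro mod_pos_pos_trivial) (auto simp: M.H1_iff M.H1_cochain)
      ultimately show ?thesis by simp
    qed
    then have "\<psi> = (\<lambda>x\<in>Z n. (\<Sum>w\<in>A. ?a w * eps w x) mod int p)"
      using \<psi>(1) by (intro extensionalityI[of _ "Z n"]) (auto simp: M.H1_iff M.H1_cochain)
    moreover have "\<dots> \<in> P" by (rule P_sum[OF A]) (simp add: A_def)
    ultimately show "\<alpha> \<in> ?gen" using \<psi>(3) by (simp add: P_def)
  qed
qed

end

section \<open>The pairing\<close>

lemma (in group) set_mult_eq_mod:
  assumes N: "N \<lhd> G" and K: "subgroup K G"
  shows "N <#> K = {x \<in> carrier G. \<exists>k\<in>K. N #> x = N #> k}"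
proof -
  interpret N: normal N G by (rule N)
  show ?thesis
  proof (intro equalityI subsetI)
    fix x assume "x \<in> N <#> K"
    then obtain m k where x: "m \<in> N" "k \<in> K" "x = m \<otimes> k" by (auto simp: set_mult_def)
    then have kc: "k \<in> carrier G" using subgroup.mem_carrier[OF K] by blast
    have "x \<in> N #> k" using x by (auto simp: r_coset_def)
    then have "N #> x = N #> k" using repr_independence[OF _ kc N.subgroup_axioms] by simp
    then show "x \<in> {x \<in> carrier G. \<exists>k\<in>K. N #> x = N #> k}" using x kc N.mem_carrier by auto
  next
    fix x assume "x \<in> {x \<in> carrier G. \<exists>k\<in>K. N #> x = N #> k}"
    then obtain k where x: "x \<in> carrier G" "k \<in> K" "N #> x = N #> k" by blast
    then have "x \<in> N #> k" using rcos_self[OF x(1) N.subgroup_axioms] by simp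
    then show "x \<in> N <#> K" using x(2) by (auto simp: r_coset_def set_mult_def)
  qed
qed

text \<open>The product set is the continuous image of a compact set, and compact sets are closed in
  a Hausdorff space.\<close>

lemma (in profinite) closedin_set_mult:
  assumes "closedin T A" "closedin T B"
  shows "closedin T (A <#> B)"
proof -
  have "compactin T A" "compactin T B"
    using assms compact closedin_compact_space by blast+
  then have "compactin (prod_topology T T) (A \<times> B)" by (simp add: compactin_Times)
  then have "compactin T ((\<lambda>(x, y). x \<otimes> y) ` (A \<times> B))"
    by (rule image_compactin) (use topological in \<open>simp add: topological_group_def\<close>)
  moreover have "(\<lambda>(x, y). x \<otimes> y) ` (A \<times> B) = A <#> B" by (auto simp: set_mult_def)
  ultimately show ?thesis using Hausdorff compactin_imp_closedin by metis
qed

context free_profinite_massey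
begin

text \<open>Modulo \<open>Z (Suc n)\<close>, hence modulo R, the group \<open>Z n\<close> is
  elementary abelian, so a subgroup B that is maximal among those containing R and avoiding
  \<open>\<sigma>\<close> is a hyperplane, and \<open>\<psi>\<close> is the exponent of
  \<open>\<sigma>\<close> modulo B. Reduction modulo W makes this a finite problem. Invariance under
  G is automatic, since commutators of \<open>Z n\<close> with G lie in
  \<open>Z (Suc n)\<close>.\<close>

lemma separation:
  assumes R: "R \<lhd> G" "closedin T R" "Z (Suc n) \<subseteq> R" "R \<subseteq> Z n"
    and \<sigma>: "\<sigma> \<in> Z n" "\<sigma> \<notin> R"
  obtains \<psi> where "\<psi> \<in> carrier M.H1G" "\<And>x. x \<in> R \<Longrightarrow> \<psi> x = 0" "\<psi> \<sigma> \<noteq> 0"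
proof -
  interpret R: normal R G by (rule R(1))
  have \<sigma>c: "\<sigma> \<in> carrier G" using \<sigma>(1) by (rule Z_carrier)
  \<comment> \<open>A normal subgroup W inside this neighbourhood keeps \<open>\<sigma>\<close> out
    of the product of R and W.\<close>
  let ?U = "{x \<in> carrier G. \<sigma> \<otimes> x \<otimes> \<one> \<in> carrier G - R}"
  have "openin T (carrier G - R)" using R(2) by (auto simp: closedin_def topspace_eq)
  then have "openin T ?U" using \<sigma>c by (intro openin_translate) auto
  moreover have "\<one> \<in> ?U" using \<sigma>(2) \<sigma>c by simp
  ultimately obtain W where W: "W \<lhd> G" "openin T W" "W \<subseteq> ?U" using open_normal_subset by blast
  interpret W: normal W G by (rule W(1))
  define \<Phi> where "\<Phi> v = {x \<in> carrier G. \<exists>s\<in>Z v. W #> x = W #> s}" for v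
  interpret \<Phi>: np_filtration G \<Phi> p
    unfolding \<Phi>_def by (rule Z.np_filtration_mod[OF W(1)])
  define R' where "R' = {x \<in> carrier G. \<exists>s\<in>R. W #> x = W #> s}"
  have R': "subgroup R' G" unfolding R'_def by (rule subgroup_mod[OF W(1) R.subgroup_axioms])
  have W1: "W #> w = W #> \<one>" if "w \<in> W" for w using that W.rcos_const W.subset by simp
  have WR': "W \<subseteq> R'" unfolding R'_def using W1 R.one_closed W.mem_carrier by blast
  have RR': "R \<subseteq> R'" unfolding R'_def using R.mem_carrier by blast
  have \<Phi>R': "\<Phi> (Suc n) \<subseteq> R'" unfolding R'_def \<Phi>_def using R(3) by blast
  have R'\<Phi>: "R' \<subseteq> \<Phi> n" unfolding R'_def \<Phi>_def using R(4) by blast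
  have \<sigma>R': "\<sigma> \<notin> R'"
  proof
    assume "\<sigma> \<in> R'"
    then obtain s where s: "s \<in> R" "W #> \<sigma> = W #> s" by (auto simp: R'_def)
    then have sc: "s \<in> carrier G" by simp
    have "s \<in> W #> \<sigma>" using rcos_self[OF sc W.subgroup_axioms] s(2) by simp
    then obtain w where w: "w \<in> W" "s = w \<otimes> \<sigma>" by (auto simp: r_coset_def)
    have "inv \<sigma> \<otimes> w \<otimes> \<sigma> \<in> W" using W.inv_op_closed1[OF \<sigma>c w(1)] .
    then have "\<sigma> \<otimes> (inv \<sigma> \<otimes> w \<otimes> \<sigma>) \<otimes> \<one> \<in> carrier G - R" using W(3) by blast
    then show False using w s \<sigma>c W.mem_carrier[OF w(1)] by (simp add: group_simps)
  qed
  define \<B> where "\<B> = {B. subgroup B G \<and> R' \<subseteq> B \<and> B \<subseteq> \<Phi> n \<and> \<sigma> \<notin> B}"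
  have "openin T R'" using WR' W.one_closed W(2) by (intro open_subgroupI[OF R']) auto
  then have "finite {B. subgroup B G \<and> R' \<subseteq> B}"
    by (intro finite_supergroups[OF R'] finite_rcosets[OF R'])
  then have "finite \<B>" by (rule rev_finite_subset) (auto simp: \<B>_def)
  moreover have "R' \<in> \<B>" using R' R'\<Phi> \<sigma>R' by (simp add: \<B>_def)
  ultimately obtain B where max: "B \<in> \<B>" "\<And>B'. B' \<in> \<B> \<Longrightarrow> B \<subseteq> B' \<Longrightarrow> B = B'"
    using finite_has_maximal[of \<B>] by blast
  have B: "subgroup B G" "R' \<subseteq> B" "B \<subseteq> \<Phi> n" "\<sigma> \<notin> B" using max(1) by (auto simp: \<B>_def)
  note Bc = subgroup.mem_carrier[OF B(1)]
  have \<Phi>B: "\<Phi> (Suc n) \<subseteq> B" using \<Phi>R' B(2) by blast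
  have pB: "x [^] p \<in> B" if "x \<in> \<Phi> n" for x
  proof -
    have "2 * n \<le> p * n" using p2 by (rule mult_le_mono1)
    then have "\<Phi> (p * n) \<subseteq> \<Phi> (Suc n)" using n by (intro \<Phi>.Phi_mono) linarith
    then show ?thesis using \<Phi>.Phi_pow[OF that] \<Phi>B by blast
  qed
  have \<sigma>\<Phi>: "\<sigma> \<in> \<Phi> n" unfolding \<Phi>_def using \<sigma>(1) \<sigma>c by blast
  have n1: "1 \<le> n" using n by simp
  \<comment> \<open>i is invertible modulo p, and both \<open>x [^] p\<close> and
    \<open>x [^] i\<close> lie in L, so x is a product of powers of elements of L.\<close>
  have root: "x \<in> L" if L: "subgroup L G" "B \<subseteq> L" and x: "x \<in> \<Phi> n" and a: "x [^] (i :: int) \<in> L" "\<not> int p dvd i"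
    for L x i
  proof -
    have xc: "x \<in> carrier G" using x \<Phi>.Phi_carrier by blast
    have "coprime (int p) i" using a(2) p prime_imp_coprime[of "int p" i] by simp
    then obtain u v where uv: "u * int p + v * i = 1" using bezout_int[of "int p" i] by auto
    have "(x [^] p) [^] u \<in> L" using pB[OF x] L(2) by (blast intro: subgroup_int_pow_closed[OF L(1)])
    moreover have "(x [^] i) [^] v \<in> L" using a(1) by (rule subgroup_int_pow_closed[OF L(1)])
    ultimately have in_L: "(x [^] p) [^] u \<otimes> (x [^] i) [^] v \<in> L" by (rule subgroup.m_closed[OF L(1)])
    have "(x [^] p) [^] u \<otimes> (x [^] i) [^] v = x [^] (u * int p + v * i)"
      using xc by (simp add: int_pow_mult int_pow_pow mult.commute flip: int_pow_int)
    also have "\<dots> = x" unfolding uv using xc by simp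
    finally show "x \<in> L" using in_L by (simp only:)
  qed
  obtain L where L: "subgroup L G" "B \<subseteq> L" "L \<subseteq> \<Phi> n" "\<sigma> \<in> L"
    "\<And>x. x \<in> L \<Longrightarrow> \<exists>a<p. \<exists>h\<in>B. x = \<sigma> [^] (a :: nat) \<otimes> h"
    using \<Phi>.cyclic_extension[OF B(1) n1 \<Phi>B B(3) \<sigma>\<Phi>] by blast
  \<comment> \<open>For x outside B, maximality forces \<open>\<sigma>\<close> into the group
    generated by x and B, so \<open>\<sigma>\<close> is x^a b with a prime to p; solving for x puts
    it into L.\<close>
  have "\<Phi> n \<subseteq> L"
  proof
    fix x assume x: "x \<in> \<Phi> n"
    show "x \<in> L"
    proof (cases "x \<in> B")
      case True
      then show ?thesis using L(2) by blast
    next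
      case False
      obtain L' where L': "subgroup L' G" "B \<subseteq> L'" "L' \<subseteq> \<Phi> n" "x \<in> L'"
        "\<And>y. y \<in> L' \<Longrightarrow> \<exists>a<p. \<exists>h\<in>B. y = x [^] (a :: nat) \<otimes> h"
        using \<Phi>.cyclic_extension[OF B(1) n1 \<Phi>B B(3) x] by blast
      have "\<sigma> \<in> L'"
      proof (rule ccontr)
        assume "\<sigma> \<notin> L'"
        then have "L' \<in> \<B>" using L' B(2) by (auto simp: \<B>_def)
        then show False using max(2) L'(2,4) False by blast
      qed
      then obtain a b where a: "a < p" "b \<in> B" "\<sigma> = x [^] (a :: nat) \<otimes> b" using L'(5) by blast
      have xc: "x \<in> carrier G" using x \<Phi>.Phi_carrier by blast
      have "a \<noteq> 0" using a(2,3) B(4) Bc by (cases "a = 0") auto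
      have "x [^] a = \<sigma> \<otimes> inv b" using a(2,3) Bc xc by (simp add: group_simps)
      then have "x [^] a \<in> L"
        using L(1,2,4) a(2) subgroup.m_closed[OF L(1)] subgroup.m_inv_closed[OF L(1)] by auto
      then have "x [^] int a \<in> L" by (simp add: int_pow_int)
      moreover have "\<not> int p dvd int a" using a(1) \<open>a \<noteq> 0\<close> by (auto dest: zdvd_imp_le)
      ultimately show ?thesis using root[OF L(1,2) x] by blast
    qed
  qed
  then have cases: "\<exists>a b. b \<in> B \<and> y = \<sigma> [^] (a :: int) \<otimes> b" if "y \<in> \<Phi> n" for y
    using L(5)[of y] that by (metis int_pow_int subsetD)
  have uniq: "int p dvd i - j" if b: "b \<in> B" "b' \<in> B" and eq: "\<sigma> [^] (i :: int) \<otimes> b = \<sigma> [^] j \<otimes> b'" for i j b b'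
  proof (rule ccontr)
    assume nd: "\<not> int p dvd i - j"
    have "\<sigma> [^] (i - j) = \<sigma> [^] (- j) \<otimes> (\<sigma> [^] i \<otimes> b) \<otimes> inv b"
      using \<sigma>c Bc b by (simp add: group_simps int_pow_mult[symmetric])
    also have "\<dots> = b' \<otimes> inv b"
      unfolding eq using \<sigma>c Bc b by (simp add: group_simps int_pow_neg)
    also have "\<dots> \<in> B" using b subgroup.m_closed[OF B(1)] subgroup.m_inv_closed[OF B(1)] by simp
    finally show False using root[OF B(1) order_refl \<sigma>\<Phi> _ nd] B(4) by blast
  qed
  \<comment> \<open>The exponent of \<open>\<sigma>\<close>, which \<open>uniq\<close> determines
    modulo p.\<close>
  define E where "E y = (SOME a. \<exists>b\<in>B. y = \<sigma> [^] (a :: int) \<otimes> b)" for y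
  have E: "int p dvd E (\<sigma> [^] i \<otimes> b) - i" if "b \<in> B" for i b
  proof -
    have "\<exists>b'\<in>B. \<sigma> [^] i \<otimes> b = \<sigma> [^] E (\<sigma> [^] i \<otimes> b) \<otimes> b'"
      unfolding E_def by (rule someI_ex) (use that in blast)
    then obtain b' where "b' \<in> B" "\<sigma> [^] E (\<sigma> [^] i \<otimes> b) \<otimes> b' = \<sigma> [^] i \<otimes> b" by metis
    then show ?thesis using uniq that by blast
  qed
  have conjB: "inv x \<otimes> b \<otimes> x \<in> B" if "x \<in> carrier G" "b \<in> B" for x b
  proof -
    have "inv b \<otimes> inv x \<otimes> b \<otimes> x \<in> \<Phi> (n + 1)"
      using \<Phi>.Phi_comm[of b n x 1] that B(3) \<Phi>.Phi_1 by auto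
    then have "inv b \<otimes> inv x \<otimes> b \<otimes> x \<in> B" using \<Phi>B by auto
    then show ?thesis
      using that \<Phi>.conj_eq_mult_comm[OF Bc[OF that(2)] that(1)] subgroup.m_closed[OF B(1)] by simp
  qed
  have E_mult: "int p dvd E x + E y - E (x \<otimes> y)" if x: "x \<in> \<Phi> n" and y: "y \<in> \<Phi> n" for x y
  proof -
    obtain i b where i: "b \<in> B" "x = \<sigma> [^] (i :: int) \<otimes> b" using cases[OF x] by blast
    obtain j b' where j: "b' \<in> B" "y = \<sigma> [^] (j :: int) \<otimes> b'" using cases[OF y] by blast
    have jc: "\<sigma> [^] j \<in> carrier G" using \<sigma>c by simp
    have b'': "inv (\<sigma> [^] j) \<otimes> b \<otimes> \<sigma> [^] j \<otimes> b' \<in> B"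
      using subgroup.m_closed[OF B(1) conjB[OF jc i(1)] j(1)] .
    have "x \<otimes> y = \<sigma> [^] (i + j) \<otimes> (inv (\<sigma> [^] j) \<otimes> b \<otimes> \<sigma> [^] j \<otimes> b')"
      using i j \<sigma>c Bc by (simp add: group_simps int_pow_mult)
    then have "int p dvd E (x \<otimes> y) - (i + j)" using E[OF b''] by simp
    moreover have "int p dvd E x - i" "int p dvd E y - j" using E i j by simp_all
    ultimately have "int p dvd (E x - i) + (E y - j) - (E (x \<otimes> y) - (i + j))" by (intro dvd_diff[OF dvd_add])
    then show ?thesis by (simp add: algebra_simps)
  qed
  have E_B: "int p dvd E b" if "b \<in> B" for b using E[OF that, of 0] Bc[OF that] by simp
  have Z\<Phi>: "x \<in> \<Phi> n" if "x \<in> Z n" for x unfolding \<Phi>_def using that Z_carrier by blast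
  \<comment> \<open>Extended by 0 to all of G, where continuity can be tested by invariance under
    W.\<close>
  define F where "F x = (if x \<in> \<Phi> n then E x mod int p else 0)" for x
  have "loc_const T F"
  proof (rule loc_constI[OF W.subgroup_axioms W(2)])
    fix w x assume w: "w \<in> W" and x: "x \<in> carrier G"
    have wB: "w \<in> B" using w WR' B(2) by blast
    then have w\<Phi>: "w \<in> \<Phi> n" using B(3) by blast
    have iff: "w \<otimes> x \<in> \<Phi> n \<longleftrightarrow> x \<in> \<Phi> n"
    proof
      assume "w \<otimes> x \<in> \<Phi> n"
      then have "inv w \<otimes> (w \<otimes> x) \<in> \<Phi> n"
        using w\<Phi> subgroup.m_closed[OF \<Phi>.Phi_subgroup] subgroup.m_inv_closed[OF \<Phi>.Phi_subgroup] by simp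
      then show "x \<in> \<Phi> n" using x Bc[OF wB] by (simp add: inv_mult_cancel)
    qed (use w\<Phi> subgroup.m_closed[OF \<Phi>.Phi_subgroup] in blast)
    show "F (w \<otimes> x) = F x"
    proof (cases "x \<in> \<Phi> n")
      case True
      have "int p dvd E w - (E w + E x - E (w \<otimes> x))"
        by (rule dvd_diff[OF E_B[OF wB] E_mult[OF w\<Phi> True]])
      then have "int p dvd E (w \<otimes> x) - E x" by (simp add: algebra_simps)
      then show ?thesis using True iff by (simp add: F_def mod_eq_dvd_iff)
    qed (simp add: F_def iff)
  qed
  then have FTM: "loc_const M.TM F" by (rule continuous_map_from_subtopology)
  have FE: "F x mod int p = E x mod int p" if "x \<in> Z n" for x using Z\<Phi>[OF that] by (simp add: F_def)
  have H1: "(\<lambda>x\<in>Z n. F x mod int p) \<in> carrier M.H1G"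
  proof (rule M.H1_modI[OF FTM])
    fix x y assume xy: "x \<in> Z n" "y \<in> Z n"
    then have xyZ: "x \<otimes> y \<in> Z n" by (rule subgroup.m_closed[OF Z_subgroup])
    have "(F x + F y - F (x \<otimes> y)) mod int p = (E x + E y - E (x \<otimes> y)) mod int p"
      by (intro mod_diff_cong mod_add_cong FE xy xyZ)
    then show "int p dvd F x + F y - F (x \<otimes> y)"
      using E_mult[OF Z\<Phi>[OF xy(1)] Z\<Phi>[OF xy(2)]] by (simp add: mod_eq_0_iff_dvd[symmetric])
  next
    fix g x assume g: "g \<in> carrier G" and x: "x \<in> Z n"
    have c: "inv x \<otimes> inv g \<otimes> x \<otimes> g \<in> Z (Suc n)"
      using Z_comm[of x n g 1] x g by (simp add: Z_le_1)
    then have cB: "inv x \<otimes> inv g \<otimes> x \<otimes> g \<in> B" using R(3) RR' B(2) by blast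
    have "int p dvd E x + E (inv x \<otimes> inv g \<otimes> x \<otimes> g) - E (x \<otimes> (inv x \<otimes> inv g \<otimes> x \<otimes> g))"
      using E_mult[OF Z\<Phi>[OF x], of "inv x \<otimes> inv g \<otimes> x \<otimes> g"] cB B(3) by blast
    from dvd_diff[OF E_B[OF cB] this]
    have "int p dvd E (inv g \<otimes> x \<otimes> g) - E x"
      using Z.conj_eq_mult_comm[OF Z_carrier[OF x] g] by simp
    then have "E (inv g \<otimes> x \<otimes> g) mod int p = E x mod int p" by (simp add: mod_eq_dvd_iff)
    then show "int p dvd F (inv g \<otimes> x \<otimes> g) - F x"
      using FE[OF x] FE[OF Z.Phi_conj[OF x g]] by (simp add: mod_eq_dvd_iff[symmetric])
  qed
  show thesis
  proof (rule that[OF H1])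
    show "(\<lambda>x\<in>Z n. F x mod int p) x = 0" if "x \<in> R" for x
    proof -
      have "x \<in> Z n" "x \<in> B" using that R(4) RR' B(2) by auto
      then show ?thesis using E_B FE by (simp add: mod_eq_0_iff_dvd)
    qed
    have "int p dvd E \<sigma> - 1" using E[OF subgroup.one_closed[OF B(1)], of 1] \<sigma>c by simp
    then have "E \<sigma> mod int p = 1 mod int p" by (simp only: mod_eq_dvd_iff)
    then have "F \<sigma> mod int p = 1" using FE[OF \<sigma>(1)] p2 by simp
    then show "(\<lambda>x\<in>Z n. F x mod int p) \<sigma> \<noteq> 0" using \<sigma>(1) by simp
  qed
qed

lemma trg_inv:
  "inv_into (carrier M.H1G) M.trg (M.trg \<psi>) = \<psi>" if "\<psi> \<in> carrier M.H1G"
  using M.trg_iso that by (auto simp: iso_def bij_betw_def)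

lemma kernel_Massey:
  assumes N: "N \<lhd> G" "N \<subseteq> Z n"
  shows "kernel (H2_Massey_Mod p n G T (Z n)) (H2_Mod p G T N) (inflation2 p G T (Z n) N) =
    M.trg ` {\<psi> \<in> carrier M.H1G. (\<forall>x\<in>Z (Suc n). \<psi> x = 0) \<and> (\<forall>x\<in>N. \<psi> x = 0)}"
  unfolding kernel_def H2_Massey_def using M.inflation_trg_trivial_iff[OF N]
  by (auto simp: H2_Massey_eq)

lemma kernel_H2:
  assumes N: "N \<lhd> G" "N \<subseteq> Z n"
  shows "kernel (H2_Mod p G T (Z n)) (H2_Mod p G T N) (inflation2 p G T (Z n) N) =
    M.trg ` {\<psi> \<in> carrier M.H1G. \<forall>x\<in>N. \<psi> x = 0}"
proof -
  have "carrier M.Q.H2G = M.trg ` carrier M.H1G"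
    using M.trg_iso by (simp add: iso_def bij_betw_def)
  then show ?thesis
    unfolding kernel_def using M.inflation_trg_trivial_iff[OF N] by auto
qed

context
  fixes N R :: "'a set"
  assumes N: "N \<lhd> G" "closedin T N" "N \<subseteq> Z n"
  defines "R \<equiv> N <#> Z (Suc n)"
begin

lemma N_R: "N \<subseteq> R" and Z_R: "Z (Suc n) \<subseteq> R" and R_Z: "R \<subseteq> Z n"
proof -
  interpret N: normal N G by (rule N(1))
  have "x = x \<otimes> \<one>" if "x \<in> N" for x using that by simp
  then show "N \<subseteq> R" unfolding R_def set_mult_def using subgroup.one_closed[OF Z_subgroup] by fast
  have "x = \<one> \<otimes> x" if "x \<in> Z (Suc n)" for x using that Z_carrier by simp
  then show "Z (Suc n) \<subseteq> R" unfolding R_def set_mult_def using N.one_closed by fast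
  show "R \<subseteq> Z n"
    using N(3) Z_Suc subgroup.m_closed[OF Z_subgroup, of _ n] unfolding R_def set_mult_def by blast
qed

lemma R_normal: "R \<lhd> G"
proof (rule normal_invI)
  interpret N: normal N G by (rule N(1))
  show "subgroup R G"
    unfolding R_def set_mult_eq_mod[OF N(1) Z_subgroup] using N(1) Z_subgroup by (rule subgroup_mod)
  fix x h assume x: "x \<in> carrier G" and "h \<in> R"
  then obtain m k where h: "m \<in> N" "k \<in> Z (Suc n)" "h = m \<otimes> k" by (auto simp: R_def set_mult_def)
  then have "x \<otimes> h \<otimes> inv x = (x \<otimes> m \<otimes> inv x) \<otimes> (x \<otimes> k \<otimes> inv x)"
    using x N.mem_carrier[OF h(1)] Z_carrier[OF h(2)] by (simp add: group_simps)
  moreover have "x \<otimes> m \<otimes> inv x \<in> N" using N.inv_op_closed2[OF x h(1)] .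
  moreover have "x \<otimes> k \<otimes> inv x \<in> Z (Suc n)" using normal.inv_op_closed2[OF Z_normal x h(2)] .
  ultimately show "x \<otimes> h \<otimes> inv x \<in> R" by (auto simp: R_def set_mult_def)
qed

lemma R_closed: "closedin T R"
  unfolding R_def using N(2) Z_closed by (rule closedin_set_mult)

lemma zero_on_R_iff:
  assumes "\<psi> \<in> carrier M.H1G"
  shows "(\<forall>x\<in>R. \<psi> x = 0) \<longleftrightarrow> (\<forall>x\<in>Z (Suc n). \<psi> x = 0) \<and> (\<forall>x\<in>N. \<psi> x = 0)"
proof
  assume 0: "(\<forall>x\<in>Z (Suc n). \<psi> x = 0) \<and> (\<forall>x\<in>N. \<psi> x = 0)"
  show "\<forall>x\<in>R. \<psi> x = 0"
  proof
    fix x assume x: "x \<in> R"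
    then obtain m k where h: "m \<in> N" "k \<in> Z (Suc n)" "x = m \<otimes> k" by (auto simp: R_def set_mult_def)
    then have mk: "m \<in> Z n" "k \<in> Z n" using N(3) Z_Suc by auto
    have "int p dvd \<psi> m + \<psi> k - \<psi> (m \<otimes> k)" using assms mk unfolding M.H1_iff by blast
    then have "int p dvd - \<psi> x" using 0 h by simp
    then have "int p dvd \<psi> x" by (subst (asm) dvd_minus_iff)
    moreover have "0 \<le> \<psi> x" "\<psi> x < int p"
      using assms x R_Z unfolding M.H1_iff M.H1_cochain by auto
    ultimately show "\<psi> x = 0" by (rule dvd_range_zero)
  qed
qed (use N_R Z_R in blast)

text \<open>Both kernels consist of the transgressions of the characters vanishing on R: inflation
  to the quotient by R imposes this directly, while for the other kernel vanishing on
  \<open>Z (Suc n)\<close> is the Massey condition and vanishing on N the inflation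
  condition.\<close>

lemma kernel_eq:
  "kernel (H2_Mod p G T (Z n)) (H2_Mod p G T R) (inflation2 p G T (Z n) R) =
   kernel (H2_Massey_Mod p n G T (Z n)) (H2_Mod p G T N) (inflation2 p G T (Z n) N)"
  unfolding kernel_Massey[OF N(1,3)] kernel_H2[OF R_normal R_Z] using zero_on_R_iff by blast

text \<open>Through transgression the pairing is evaluation of characters vanishing on R, so it
  depends on cosets of R only. A character all of whose values are 0 is trivial; the other half of
  non-degeneracy is \<open>separation\<close>.\<close>

lemma pairing:
  defines "KM \<equiv> kernel (H2_Massey_Mod p n G T (Z n)) (H2_Mod p G T N) (inflation2 p G T (Z n) N)"
  shows "\<exists>f. (\<forall>\<sigma>\<in>Z n. \<forall>\<alpha>\<in>KM. f (R #> \<sigma>) \<alpha> = inv_into (carrier M.H1G) M.trg \<alpha> \<sigma>) \<and>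
    bilinear_pairing (G\<lparr>carrier := Z n\<rparr> Mod R) ((H2_Massey_Mod p n G T (Z n))\<lparr>carrier := KM\<rparr>) (integer_mod_group p) f \<and>
    nondegenerate_pairing (G\<lparr>carrier := Z n\<rparr> Mod R) ((H2_Massey_Mod p n G T (Z n))\<lparr>carrier := KM\<rparr>) (integer_mod_group p) f"
proof -
  interpret R: normal R G by (rule R_normal)
  interpret H1: comm_group M.H1G by (rule M.H1_comm_group)
  interpret H2: comm_group M.Q.H2G by (rule M.Q.H2_comm_group)
  interpret h: group_hom M.H1G M.Q.H2G M.trg
    using M.trg_hom by (simp add: group_hom_def group_hom_axioms_def H1.is_group H2.is_group)
  let ?inv = "inv_into (carrier M.H1G) M.trg"
  define V where "V = {\<psi> \<in> carrier M.H1G. \<forall>x\<in>R. \<psi> x = 0}"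
  have KM: "KM = M.trg ` V"
    unfolding KM_def kernel_eq[symmetric] kernel_H2[OF R_normal R_Z] V_def ..
  have V: "\<psi> \<in> carrier M.H1G" "\<And>x. x \<in> R \<Longrightarrow> \<psi> x = 0" if "\<psi> \<in> V" for \<psi>
    using that by (auto simp: V_def)
  have range: "0 \<le> \<psi> x" "\<psi> x < int p" if "\<psi> \<in> V" "x \<in> Z n" for \<psi> x
    using V(1)[OF that(1)] that(2) by (auto simp: M.H1_iff M.H1_cochain)
  have add: "\<psi> (x \<otimes> y) = (\<psi> x + \<psi> y) mod int p" if "\<psi> \<in> V" "x \<in> Z n" "y \<in> Z n" for \<psi> x y
  proof -
    have "int p dvd \<psi> x + \<psi> y - \<psi> (x \<otimes> y)" using V(1)[OF that(1)] that unfolding M.H1_iff by blast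
    then have "(\<psi> x + \<psi> y) mod int p = \<psi> (x \<otimes> y) mod int p" by (simp add: mod_eq_dvd_iff)
    moreover have "\<psi> (x \<otimes> y) mod int p = \<psi> (x \<otimes> y)"
      using range[OF that(1) subgroup.m_closed[OF Z_subgroup that(2,3)]] by (rule mod_pos_pos_trivial)
    ultimately show ?thesis by (simp only:)
  qed
  \<comment> \<open>An arbitrary element of the coset is taken; the choice is immaterial for
    characters that vanish on R.\<close>
  define f where "f A \<alpha> = ?inv \<alpha> (SOME \<sigma>. \<sigma> \<in> A)" for A \<alpha>
  have f: "f (R #> \<sigma>) (M.trg \<psi>) = \<psi> \<sigma>" if \<psi>: "\<psi> \<in> V" and \<sigma>: "\<sigma> \<in> Z n" for \<psi> \<sigma>
  proof -
    have "\<sigma> \<in> R #> \<sigma>" using rcos_self[OF Z_carrier[OF \<sigma>] R.subgroup_axioms] .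
    then have "(SOME \<sigma>'. \<sigma>' \<in> R #> \<sigma>) \<in> R #> \<sigma>" by (rule someI)
    then obtain r where r: "r \<in> R" "(SOME \<sigma>'. \<sigma>' \<in> R #> \<sigma>) = r \<otimes> \<sigma>" by (auto simp: r_coset_def)
    have "\<psi> (r \<otimes> \<sigma>) = (\<psi> r + \<psi> \<sigma>) mod int p" using add[OF \<psi> _ \<sigma>, of r] r(1) R_Z by blast
    also have "\<dots> = \<psi> \<sigma>" using V(2)[OF \<psi> r(1)] range[OF \<psi> \<sigma>] by (simp add: mod_pos_pos_trivial)
    finally show ?thesis using trg_inv[OF V(1)[OF \<psi>]] by (simp add: f_def r(2))
  qed
  let ?Q = "G\<lparr>carrier := Z n\<rparr> Mod R" and ?K = "(H2_Massey_Mod p n G T (Z n))\<lparr>carrier := KM\<rparr>"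
  have Qc: "A \<in> carrier ?Q \<longleftrightarrow> (\<exists>\<sigma>\<in>Z n. A = R #> \<sigma>)" for A
    by (auto simp: carrier_FactGroup r_coset_def)
  have Qm: "(R #> \<sigma>) \<otimes>\<^bsub>?Q\<^esub> (R #> \<tau>) = R #> (\<sigma> \<otimes> \<tau>)" if "\<sigma> \<in> Z n" "\<tau> \<in> Z n" for \<sigma> \<tau>
    using R.rcos_sum[of \<sigma> \<tau>] that Z_carrier by (simp add: set_mult_def)
  have Km: "\<alpha> \<otimes>\<^bsub>?K\<^esub> \<beta> = \<alpha> \<otimes>\<^bsub>M.Q.H2G\<^esub> \<beta>" for \<alpha> \<beta>
    by (simp add: H2_Massey_def)
  have K1: "\<one>\<^bsub>?K\<^esub> = \<one>\<^bsub>M.Q.H2G\<^esub>" by (simp add: H2_Massey_def)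
  have V_mult: "\<psi> \<otimes>\<^bsub>M.H1G\<^esub> \<psi>' \<in> V" if "\<psi> \<in> V" "\<psi>' \<in> V" for \<psi> \<psi>'
  proof -
    have "(\<psi> \<otimes>\<^bsub>M.H1G\<^esub> \<psi>') x = 0" if "x \<in> R" for x
      using V(2)[OF \<open>\<psi> \<in> V\<close> that] V(2)[OF \<open>\<psi>' \<in> V\<close> that] that R_Z by (auto simp: M.H1_mult)
    then show ?thesis using V(1) that H1.m_closed by (simp add: V_def)
  qed
  have Zp: "a \<in> carrier (integer_mod_group p) \<longleftrightarrow> 0 \<le> a \<and> a < int p" for a
    using p_pos by (simp add: carrier_integer_mod_group)
  have "f A \<in> hom ?K (integer_mod_group p)" if A: "A \<in> carrier ?Q" for A
  proof (rule homI)
    obtain \<sigma> where \<sigma>: "\<sigma> \<in> Z n" "A = R #> \<sigma>" using A Qc by blast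
    fix \<alpha> assume "\<alpha> \<in> carrier ?K"
    then obtain \<psi> where \<psi>: "\<psi> \<in> V" "\<alpha> = M.trg \<psi>" by (auto simp: KM)
    then show "f A \<alpha> \<in> carrier (integer_mod_group p)"
      using f[OF \<psi>(1) \<sigma>(1)] range[OF \<psi>(1) \<sigma>(1)] \<sigma>(2) by (simp add: Zp)
    fix \<beta> assume "\<beta> \<in> carrier ?K"
    then obtain \<psi>' where \<psi>': "\<psi>' \<in> V" "\<beta> = M.trg \<psi>'" by (auto simp: KM)
    have "\<alpha> \<otimes>\<^bsub>?K\<^esub> \<beta> = M.trg (\<psi> \<otimes>\<^bsub>M.H1G\<^esub> \<psi>')"
      unfolding Km \<psi>(2) \<psi>'(2) using V(1)[OF \<psi>(1)] V(1)[OF \<psi>'(1)] by simp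
    then show "f A (\<alpha> \<otimes>\<^bsub>?K\<^esub> \<beta>) = f A \<alpha> \<otimes>\<^bsub>integer_mod_group p\<^esub> f A \<beta>"
      using f[OF V_mult[OF \<psi>(1) \<psi>'(1)] \<sigma>(1)] f[OF \<psi>(1) \<sigma>(1)] f[OF \<psi>'(1) \<sigma>(1)] \<psi>(2) \<psi>'(2) \<sigma>
      by (simp add: M.H1_mult)
  qed
  moreover have "(\<lambda>A. f A \<alpha>) \<in> hom ?Q (integer_mod_group p)" if \<alpha>: "\<alpha> \<in> carrier ?K" for \<alpha>
  proof (rule homI)
    obtain \<psi> where \<psi>: "\<psi> \<in> V" "\<alpha> = M.trg \<psi>" using \<alpha> by (auto simp: KM)
    fix A assume "A \<in> carrier ?Q"
    then obtain \<sigma> where \<sigma>: "\<sigma> \<in> Z n" "A = R #> \<sigma>" using Qc by blast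
    then show "f A \<alpha> \<in> carrier (integer_mod_group p)"
      using f[OF \<psi>(1) \<sigma>(1)] range[OF \<psi>(1) \<sigma>(1)] \<psi>(2) by (simp add: Zp)
    fix B assume "B \<in> carrier ?Q"
    then obtain \<tau> where \<tau>: "\<tau> \<in> Z n" "B = R #> \<tau>" using Qc by blast
    have "\<sigma> \<otimes> \<tau> \<in> Z n" using \<sigma>(1) \<tau>(1) by (rule subgroup.m_closed[OF Z_subgroup])
    then have "f (A \<otimes>\<^bsub>?Q\<^esub> B) \<alpha> = \<psi> (\<sigma> \<otimes> \<tau>)"
      unfolding \<sigma>(2) \<tau>(2) Qm[OF \<sigma>(1) \<tau>(1)] \<psi>(2) by (rule f[OF \<psi>(1)])
    then show "f (A \<otimes>\<^bsub>?Q\<^esub> B) \<alpha> = f A \<alpha> \<otimes>\<^bsub>integer_mod_group p\<^esub> f B \<alpha>"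
      using f[OF \<psi>(1) \<sigma>(1)] f[OF \<psi>(1) \<tau>(1)] add[OF \<psi>(1) \<sigma>(1) \<tau>(1)] \<sigma>(2) \<tau>(2) \<psi>(2) by simp
  qed
  ultimately have "bilinear_pairing ?Q ?K (integer_mod_group p) f"
    unfolding bilinear_pairing_def by blast
  moreover have "A = \<one>\<^bsub>?Q\<^esub>" if A: "A \<in> carrier ?Q" and 0: "\<forall>\<alpha>\<in>carrier ?K. f A \<alpha> = \<one>\<^bsub>integer_mod_group p\<^esub>" for A
  proof -
    obtain \<sigma> where \<sigma>: "\<sigma> \<in> Z n" "A = R #> \<sigma>" using A Qc by blast
    have "\<sigma> \<in> R"
    proof (rule ccontr)
      assume "\<sigma> \<notin> R"
      then obtain \<psi> where \<psi>: "\<psi> \<in> carrier M.H1G" "\<And>x. x \<in> R \<Longrightarrow> \<psi> x = 0" "\<psi> \<sigma> \<noteq> 0"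
        using separation[OF R_normal R_closed Z_R R_Z \<sigma>(1)] by blast
      then have "\<psi> \<in> V" by (simp add: V_def)
      then show False using 0 f[OF _ \<sigma>(1)] \<sigma>(2) \<psi>(3) KM by auto
    qed
    then show ?thesis using \<sigma>(2) R.rcos_const by simp
  qed
  moreover have "\<alpha> = \<one>\<^bsub>?K\<^esub>" if \<alpha>: "\<alpha> \<in> carrier ?K" and 0: "\<forall>A\<in>carrier ?Q. f A \<alpha> = \<one>\<^bsub>integer_mod_group p\<^esub>" for \<alpha>
  proof -
    obtain \<psi> where \<psi>: "\<psi> \<in> V" "\<alpha> = M.trg \<psi>" using \<alpha> by (auto simp: KM)
    have "\<psi> \<sigma> = 0" if "\<sigma> \<in> Z n" for \<sigma>
    proof -
      have "f (R #> \<sigma>) \<alpha> = 0" using 0 Qc that by auto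
      then show ?thesis using f[OF \<psi>(1) that] \<psi>(2) by simp
    qed
    then have "\<psi> = \<one>\<^bsub>M.H1G\<^esub>"
      using V(1)[OF \<psi>(1)] by (intro extensionalityI[of _ "Z n"]) (auto simp: M.H1_one M.H1_iff M.H1_cochain)
    then show ?thesis unfolding K1 \<psi>(2) by simp
  qed
  ultimately have "bilinear_pairing ?Q ?K (integer_mod_group p) f \<and> nondegenerate_pairing ?Q ?K (integer_mod_group p) f"
    unfolding nondegenerate_pairing_def by blast
  moreover have "\<forall>\<sigma>\<in>Z n. \<forall>\<alpha>\<in>KM. f (R #> \<sigma>) \<alpha> = ?inv \<alpha> \<sigma>"
  proof (intro ballI)
    fix \<sigma> \<alpha> assume \<sigma>: "\<sigma> \<in> Z n" and "\<alpha> \<in> KM"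
    then obtain \<psi> where \<psi>: "\<psi> \<in> V" "\<alpha> = M.trg \<psi>" by (auto simp: KM)
    then show "f (R #> \<sigma>) \<alpha> = ?inv \<alpha> \<sigma>" using f[OF \<psi>(1) \<sigma>] trg_inv[OF V(1)[OF \<psi>(1)]] by simp
  qed
  ultimately show ?thesis by blast
qed

end

end

text \<open>Well-definedness of the pairing is the existence of a function f on cosets with the
  given values; the clause on transgression ensures that \<open>inv_into\<close> is its
  inverse.\<close>

theorem theorem10p3:
  fixes p n :: nat and S :: "'a monoid" and T :: "'a topology" and N :: "'a set"
  assumes "prime p" and "n \<ge> 2"
    and "free_profinite_group S T"
    and "N \<lhd> S" and "closedin T N" and "N \<subseteq> zassenhaus p S T n"
  shows
    "let Sn = zassenhaus p S T n;
         NSn1 = N <#>\<^bsub>S\<^esub> zassenhaus p S T (n + 1);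
         H1 = H1_invariants p S T Sn;
         trg = transgression p S T Sn;
         KM = kernel (H2_Massey_Mod p n S T Sn) (H2_Mod p S T N) (inflation2 p S T Sn N);
         K = kernel (H2_Mod p S T Sn) (H2_Mod p S T NSn1) (inflation2 p S T Sn NSn1);
         Q = S\<lparr>carrier := Sn\<rparr> Mod NSn1;
         KM_grp = (H2_Massey_Mod p n S T Sn)\<lparr>carrier := KM\<rparr>
     in (trg \<in> iso H1 (H2_Mod p S T Sn) \<and>
         (\<exists>f. (\<forall>\<sigma>\<in>Sn. \<forall>\<alpha>\<in>KM. f (NSn1 #>\<^bsub>S\<^esub> \<sigma>) \<alpha> = inv_into (carrier H1) trg \<alpha> \<sigma>) \<and>
              bilinear_pairing Q KM_grp (integer_mod_group p) f \<and>
              nondegenerate_pairing Q KM_grp (integer_mod_group p) f)) \<and>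
        K = KM"
proof -
  obtain X where X: "free_profinite_basis S T X" and prof: "profinite_group S T"
    using assms(3) by (auto simp: free_profinite_group_def)
  have "topological_group S T" "group S"
    using prof by (auto simp: profinite_group_def topological_group_def)
  then interpret free_profinite_massey S T p X n
    using X prof assms(1,2)
    by (intro free_profinite_massey.intro free_profinite_massey_axioms.intro free_profinite.intro
        free_profinite_axioms.intro profinite_prime.intro profinite_prime_axioms.intro
        profinite.intro profinite_axioms.intro top_group.intro top_group_axioms.intro)
  show ?thesis
    unfolding Let_def Suc_eq_plus1[symmetric]
    using M.trg_iso pairing[OF assms(4-6)] kernel_eq[OF assms(4-6)] by blast
qed

end
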